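(* Let $\Lambda$ be an integer lattice with symmetric bilinear form $(\cdot|\cdot)$, let $V_\Lambda$ be the corresponding lattice vertex algebra, and let $\mathcal B\subset\Lambda$ be a linearly independent set. Then the elements $v_a$, $a\in\mathcal B$, generate a free vertex subalgebra in $V_\Lambda$; that is, with $N(a,b)=-(a|b)$ for $a,b\in\mathcal B$, the vertex algebra homomorphism $\varphi:\mathfrak F_N(\mathcal B)\to V_\Lambda$ with $\varphi(a)=v_a$ for all $a\in\mathcal B$ is injective.
   Context: All spaces are over a field $\Bbbk$ of characteristic $0$. A vertex algebra is a superspace $A=A_{\bar0}\oplus A_{\bar1}$ with even bilinear products $(a,b)\mapsto a_{(n)}b$, $n\in\mathbb Z$, and a distinguished even element $\mathbf 1$. Put $Da=a_{(-2)}\mathbf 1$, $D^{(k)}=\frac1{k!}D^k$, $Y(a)(z)=\sum_{n\in\mathbb Z}a_{(n)}z^{-n-1}$, where $a_{(n)}$ is viewed as an operator on $A$. Axioms: (V1) $a_{(n)}b=0$ for $n\gg0$; (V2) $\mathbf 1_{(n)}a=\delta_{n,-1}a$, $a_{(n)}\mathbf 1=0$ for $n\ge0$ and $a_{(n)}\mathbf 1=D^{(-n-1)}a$ for $n<0$; (V3) $(Da)_{(n)}b=-n\,a_{(n-1)}b$ and $a_{(n)}(Db)=n\,a_{(n-1)}b+D(a_{(n)}b)$; (V4) locality: for parity-homogeneous $a,b$ there is $M\in\mathbb Z$ such that $Y(a)(w)Y(b)(z)\,\iota_{w,z}(w-z)^M=(-1)^{p(a)p(b)}Y(b)(z)Y(a)(w)\,\iota_{z,w}(w-z)^M$,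 where $p$ is the parity and $\iota_{w,z}$ (resp. $\iota_{z,w}$) means expansion in nonnegative powers of $z$ (resp. of $w$). Homomorphisms preserve $\mathbf 1$ and all products. Free vertex algebra: for a set $\mathcal B$ and a symmetric $N:\mathcal B\times\mathcal B\to\mathbb Z$, $\mathfrak F_N(\mathcal B)$ is the vertex algebra generated by $\mathcal B$, where $a\in\mathcal B$ has parity $N(a,a)\bmod 2$ and $a_{(n)}b=0$ for $a,b\in\mathcal B$, $n\ge N(a,b)$, which is universal with these properties: for any vertex algebra $A$ and any map $\iota:\mathcal B\to A$ with $\iota(a)$ of parity $N(a,a)\bmod 2$ and $\iota(a)_{(n)}\iota(b)=0$ whenever $n\ge N(a,b)$, there is a unique vertex algebra homomorphism $\mathfrak F_N(\mathcal B)\to A$ extending $\iota$. Lattice vertex algebra: an integer lattice is a free abelian group $\Lambda$ (any rank, possibly infinite) with a symmetric bilinear form $(\cdot|\cdot)$ with values in $\mathbb Z$ (possibly degenerate or indefinite). Let $\mathfrak h=\Lambda\otimes_{\mathbb Z}\Bbbk$ and $H=\mathfrak h\otimes\Bbbk[t,t^{-1}]\oplus\Bbbk\mathsf c$, $h(n)=h\otimes t^n$, with brackets $[g(m),h(n)]=\delta_{m,-n}m(g|h)\mathsf c$, $\mathsf c$ central. For $a\in\Lambda$ let $V_a$ be the Verma $H$-module generated by a vector $v_a$ with $h(n)v_a=0$ for $n>0$, $h(0)v_a=(h|a)v_a$, $\mathsf c=\mathrm{Id}$; it has as basis-free description $S(\mathfrak h\otimes t^{-1}\Bbbk[t^{-1}])\,v_a$.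 Put $V_\Lambda=\bigoplus_{a\in\Lambda}V_a$, with $V_a$ of parity $(a|a)\bmod2$. Fix a bimultiplicative $\varepsilon:\Lambda\times\Lambda\to\{\pm1\}$ with $\varepsilon(a,b)=(-1)^{(a|a)(b|b)+(a|b)}\varepsilon(b,a)$. Then $V_\Lambda$ has a unique vertex algebra structure with $\mathbf 1=v_0$, $(h(-1)v_0)_{(n)}v=h(n)v$ for $h\in\mathfrak h$, $v\in V_\Lambda$, $n\in\mathbb Z$, and $v_{a\,(n)}v_b=0$ for $n\ge-(a|b)$, $v_{a\,(-(a|b)-k-1)}v_b=\varepsilon(a,b)\frac1{k!}(D-b(-1))^kv_{a+b}$ for $k\ge0$ ($a,b\in\Lambda$). *)

theory Defs
  imports
    Complex_Main
    "HOL-Library.FuncSet"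
    "HOL-Library.Multiset"
    "HOL-Library.Poly_Mapping"
    "HOL-Library.Groups_Big_Fun"
    "HOL-Algebra.Free_Abelian_Groups"
begin

section \<open>Vertex superalgebras\<close>

text \<open>
  The underlying superspace is a pair of subspaces of an ambient vector space (over a field of
  characteristic 0, with scalar multiplication \<open>scale\<close>). Parities are booleans,
  \<open>True\<close> being odd, so that parities add by \<open>\<noteq>\<close>.
  The operation \<open>nprod A a n b\<close> is the product \<open>a\<^sub>(\<^sub>n\<^sub>)b\<close>; it is only
  meaningful for \<open>a\<close>, \<open>b\<close> in the carrier.
\<close>

record 'a va =
  grade :: "bool \<Rightarrow> 'a set"
  vac :: 'a
  nprod :: "'a \<Rightarrow> int \<Rightarrow> 'a \<Rightarrow> 'a"

definition va_carrier :: "'a::ab_group_add va \<Rightarrow> 'a set" where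
  "va_carrier A = {x + y | x y. x \<in> grade A False \<and> y \<in> grade A True}"

definition va_D :: "'a va \<Rightarrow> 'a \<Rightarrow> 'a" where
  "va_D A a = nprod A a (- 2) (vac A)"

text \<open>
  Locality of order \<open>M\<close>, with \<open>s\<close> the sign \<open>(-1)^(p(a)p(b))\<close>. Since
  \<open>\<iota>\<^sub>w\<^sub>,\<^sub>z (w - z)^M = (\<Sum>j\<ge>0. (-1)^j (M choose j) w^(M-j) z^j)\<close> and
  \<open>\<iota>\<^sub>z\<^sub>,\<^sub>w (w - z)^M = (\<Sum>j\<ge>0. (-1)^(M-j) (M choose j) w^j z^(M-j))\<close>,
  the two sides below are the coefficients of \<open>w^(-m-1) z^(-n-1)\<close>, applied to \<open>c\<close>, in
  \<open>Y(a)(w) Y(b)(z) \<iota>\<^sub>w\<^sub>,\<^sub>z (w - z)^M\<close> and in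
  \<open>s Y(b)(z) Y(a)(w) \<iota>\<^sub>z\<^sub>,\<^sub>w (w - z)^M\<close>. In a vertex algebra both sums are finite
  because \<open>b\<^sub>(\<^sub>n\<^sub>)c = 0\<close> and \<open>a\<^sub>(\<^sub>n\<^sub>)c = 0\<close> for large \<open>n\<close>.
\<close>

definition va_local ::
  "('k::field_char_0 \<Rightarrow> 'a::ab_group_add \<Rightarrow> 'a) \<Rightarrow> 'a va \<Rightarrow> 'k \<Rightarrow> int \<Rightarrow> 'a \<Rightarrow> 'a \<Rightarrow> bool" where
  "va_local scale A s M a b \<longleftrightarrow> (\<forall>m n. \<forall>c\<in>va_carrier A.
     Sum_any (\<lambda>j::nat. scale ((- 1) ^ j * (of_int M gchoose j))
        (nprod A a (m + M - int j) (nprod A b (n + int j) c)))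
   = Sum_any (\<lambda>j::nat. scale (s * (- 1) powi (M - int j) * (of_int M gchoose j))
        (nprod A b (n + M - int j) (nprod A a (m + int j) c))))"

locale vertex_algebra = vector_space scale
  for scale :: "'k::field_char_0 \<Rightarrow> 'a::ab_group_add \<Rightarrow> 'a" +
  fixes A :: "'a va"
  assumes grade_subspace: "subspace (grade A p)"
    and grade_direct: "grade A False \<inter> grade A True = {0}"
    and vac_even: "vac A \<in> grade A False"
    and nprod_grade: "\<lbrakk>a \<in> grade A p; b \<in> grade A q\<rbrakk> \<Longrightarrow> nprod A a n b \<in> grade A (p \<noteq> q)"
    and nprod_add_left: "\<lbrakk>a \<in> va_carrier A; a' \<in> va_carrier A; b \<in> va_carrier A\<rbrakk>
          \<Longrightarrow> nprod A (a + a') n b = nprod A a n b + nprod A a' n b"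
    and nprod_add_right: "\<lbrakk>a \<in> va_carrier A; b \<in> va_carrier A; b' \<in> va_carrier A\<rbrakk>
          \<Longrightarrow> nprod A a n (b + b') = nprod A a n b + nprod A a n b'"
    and nprod_scale_left: "\<lbrakk>a \<in> va_carrier A; b \<in> va_carrier A\<rbrakk>
          \<Longrightarrow> nprod A (scale r a) n b = scale r (nprod A a n b)"
    and nprod_scale_right: "\<lbrakk>a \<in> va_carrier A; b \<in> va_carrier A\<rbrakk>
          \<Longrightarrow> nprod A a n (scale r b) = scale r (nprod A a n b)"
    and nprod_bounded: "\<lbrakk>a \<in> va_carrier A; b \<in> va_carrier A\<rbrakk>
          \<Longrightarrow> \<exists>n\<^sub>0. \<forall>n\<ge>n\<^sub>0. nprod A a n b = 0"
    and vac_nprod: "a \<in> va_carrier A \<Longrightarrow> nprod A (vac A) n a = (if n = - 1 then a else 0)"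
    and nprod_vac_nonneg: "\<lbrakk>a \<in> va_carrier A; n \<ge> 0\<rbrakk> \<Longrightarrow> nprod A a n (vac A) = 0"
    and nprod_vac_neg: "\<lbrakk>a \<in> va_carrier A; n < 0\<rbrakk>
          \<Longrightarrow> nprod A a n (vac A)
              = scale (1 / fact (nat (- n - 1))) ((va_D A ^^ nat (- n - 1)) a)"
    and D_nprod: "\<lbrakk>a \<in> va_carrier A; b \<in> va_carrier A\<rbrakk>
          \<Longrightarrow> nprod A (va_D A a) n b = scale (- of_int n) (nprod A a (n - 1) b)"
    and nprod_D: "\<lbrakk>a \<in> va_carrier A; b \<in> va_carrier A\<rbrakk>
          \<Longrightarrow> nprod A a n (va_D A b) = scale (of_int n) (nprod A a (n - 1) b) + va_D A (nprod A a n b)"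
    and locality: "\<lbrakk>a \<in> grade A p; b \<in> grade A q\<rbrakk>
          \<Longrightarrow> \<exists>M. va_local scale A (if p \<and> q then - 1 else 1) M a b"

definition va_hom ::
  "('k \<Rightarrow> 'a::ab_group_add \<Rightarrow> 'a) \<Rightarrow> 'a va \<Rightarrow> ('k \<Rightarrow> 'b::ab_group_add \<Rightarrow> 'b) \<Rightarrow> 'b va \<Rightarrow> ('a \<Rightarrow> 'b) set" where
  "va_hom scale\<^sub>A A scale\<^sub>B B = {\<phi> \<in> va_carrier A \<rightarrow>\<^sub>E va_carrier B.
     (\<forall>x\<in>va_carrier A. \<forall>y\<in>va_carrier A. \<phi> (x + y) = \<phi> x + \<phi> y) \<and>
     (\<forall>r. \<forall>x\<in>va_carrier A. \<phi> (scale\<^sub>A r x) = scale\<^sub>B r (\<phi> x)) \<and>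
     \<phi> (vac A) = vac B \<and>
     (\<forall>x\<in>va_carrier A. \<forall>n. \<forall>y\<in>va_carrier A. \<phi> (nprod A x n y) = nprod B (\<phi> x) n (\<phi> y))}"

definition va_generated ::
  "('k::field_char_0 \<Rightarrow> 'a::ab_group_add \<Rightarrow> 'a) \<Rightarrow> 'a va \<Rightarrow> 'a set \<Rightarrow> 'a set" where
  "va_generated scale A S = \<Inter>{C. module.subspace scale C \<and> C \<subseteq> va_carrier A \<and> vac A \<in> C \<and> S \<subseteq> C \<and>
     (\<forall>x\<in>C. \<forall>n. \<forall>y\<in>C. nprod A x n y \<in> C)}"

section \<open>Free vertex algebras\<close>

definition va_admissible ::
  "'a::ab_group_add va \<Rightarrow> 'b set \<Rightarrow> ('b \<Rightarrow> 'b \<Rightarrow> int) \<Rightarrow> ('b \<Rightarrow> 'a) \<Rightarrow> bool" where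
  "va_admissible A B N j \<longleftrightarrow>
     (\<forall>a\<in>B. j a \<in> grade A (odd (N a a))) \<and>
     (\<forall>a\<in>B. \<forall>b\<in>B. \<forall>n\<ge>N a b. nprod A (j a) n (j b) = 0)"

text \<open>
  \<open>F\<close> with \<open>j : B \<rightarrow> F\<close> is the free vertex algebra on \<open>B\<close> for the locality function
  \<open>N\<close>. HOL cannot quantify over all types, so the universal property is required for the
  vertex algebras carried by subspaces of one ambient space, with scalar multiplication
  \<open>scale\<^sub>U\<close>. Nothing is lost when that space has infinite dimension at least \<open>|B|\<close>: the image
  of a homomorphism from \<open>F\<close> lies in the subalgebra generated by the images of \<open>B\<close>, whose
  dimension is at most \<open>max |B| \<aleph>\<^sub>0\<close>.
\<close>

definition free_vertex_algebra ::
  "('k::field_char_0 \<Rightarrow> 'u::ab_group_add \<Rightarrow> 'u) \<Rightarrow> ('k \<Rightarrow> 'f::ab_group_add \<Rightarrow> 'f) \<Rightarrow> 'f va \<Rightarrow>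
   'b set \<Rightarrow> ('b \<Rightarrow> 'b \<Rightarrow> int) \<Rightarrow> ('b \<Rightarrow> 'f) \<Rightarrow> bool" where
  "free_vertex_algebra scale\<^sub>U scale F B N j \<longleftrightarrow>
     vertex_algebra scale F \<and> va_admissible F B N j \<and>
     va_generated scale F (j ` B) = va_carrier F \<and>
     (\<forall>A i. vertex_algebra scale\<^sub>U A \<and> va_admissible A B N i \<longrightarrow>
        (\<exists>!\<phi>. \<phi> \<in> va_hom scale F scale\<^sub>U A \<and> (\<forall>b\<in>B. \<phi> (j b) = i b)))"

section \<open>Integer lattices\<close>

text \<open>
  The free abelian group on a set \<open>I\<close> (of any cardinality, possibly empty) is the library's
  \<open>free_Abelian_group I\<close>, whose elements are the finitely supported functions
  \<open>'i \<Rightarrow>\<^sub>0 int\<close> supported in \<open>I\<close>.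
\<close>

abbreviation lattice_carrier :: "'i set \<Rightarrow> ('i \<Rightarrow>\<^sub>0 int) set" where
  "lattice_carrier I \<equiv> carrier (free_Abelian_group I)"

locale integer_lattice =
  fixes I :: "'i set" and form :: "('i \<Rightarrow>\<^sub>0 int) \<Rightarrow> ('i \<Rightarrow>\<^sub>0 int) \<Rightarrow> int"
  assumes form_sym: "\<lbrakk>a \<in> lattice_carrier I; b \<in> lattice_carrier I\<rbrakk> \<Longrightarrow> form a b = form b a"
    and form_add: "\<lbrakk>a \<in> lattice_carrier I; b \<in> lattice_carrier I; c \<in> lattice_carrier I\<rbrakk>
          \<Longrightarrow> form (a + b) c = form a c + form b c"

interpretation frag: module frag_cmul
  by unfold_locales (simp_all add: frag_cmul_distrib frag_cmul_distrib2)

locale lattice_cocycle = integer_lattice I form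
  for I :: "'i set" and form +
  fixes \<epsilon> :: "('i \<Rightarrow>\<^sub>0 int) \<Rightarrow> ('i \<Rightarrow>\<^sub>0 int) \<Rightarrow> 'k::field_char_0"
  assumes eps_values: "\<lbrakk>a \<in> lattice_carrier I; b \<in> lattice_carrier I\<rbrakk> \<Longrightarrow> \<epsilon> a b \<in> {1, - 1}"
    and eps_mult_left: "\<lbrakk>a \<in> lattice_carrier I; b \<in> lattice_carrier I; c \<in> lattice_carrier I\<rbrakk>
          \<Longrightarrow> \<epsilon> (a + b) c = \<epsilon> a c * \<epsilon> b c"
    and eps_mult_right: "\<lbrakk>a \<in> lattice_carrier I; b \<in> lattice_carrier I; c \<in> lattice_carrier I\<rbrakk>
          \<Longrightarrow> \<epsilon> a (b + c) = \<epsilon> a b * \<epsilon> a c"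
    and eps_commutator: "\<lbrakk>a \<in> lattice_carrier I; b \<in> lattice_carrier I\<rbrakk>
          \<Longrightarrow> \<epsilon> a b = (- 1) powi (form a a * form b b + form a b) * \<epsilon> b a"

section \<open>The Fock space of a lattice\<close>

text \<open>
  The space \<open>\<hh> = \<Lambda> \<otimes> \<k>\<close> consists of the finitely supported functions \<open>'i \<Rightarrow>\<^sub>0 'k\<close>
  supported in \<open>I\<close>.
\<close>

definition cartan :: "'i set \<Rightarrow> ('i \<Rightarrow>\<^sub>0 'k::zero) set" where
  "cartan I = {h. Poly_Mapping.keys h \<subseteq> I}"

definition to_cartan :: "('i \<Rightarrow>\<^sub>0 int) \<Rightarrow> ('i \<Rightarrow>\<^sub>0 'k::field_char_0)" where
  "to_cartan a = Poly_Mapping.map of_int a"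

definition cartan_form ::
  "(('i \<Rightarrow>\<^sub>0 int) \<Rightarrow> ('i \<Rightarrow>\<^sub>0 int) \<Rightarrow> int) \<Rightarrow> ('i \<Rightarrow>\<^sub>0 'k) \<Rightarrow> ('i \<Rightarrow>\<^sub>0 'k) \<Rightarrow> 'k::field_char_0" where
  "cartan_form form g h = (\<Sum>i\<in>Poly_Mapping.keys g. \<Sum>j\<in>Poly_Mapping.keys h.
     Poly_Mapping.lookup g i * Poly_Mapping.lookup h j * of_int (form (frag_of i) (frag_of j)))"

text \<open>
  \<open>V\<^sub>\<Lambda>\<close> is the direct sum over \<open>a \<in> \<Lambda>\<close> of the copies
  \<open>S(\<hh> \<otimes> t\<^sup>-\<^sup>1\<k>[t\<^sup>-\<^sup>1]) v\<^sub>a\<close> of the symmetric algebra. Its basis vector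
  indexed by \<open>(a, {#(i\<^sub>1,n\<^sub>1), \<dots>, (i\<^sub>r,n\<^sub>r)#})\<close> is the monomial
  \<open>i\<^sub>1(-n\<^sub>1) \<dots> i\<^sub>r(-n\<^sub>r) v\<^sub>a\<close>, where \<open>i\<^sub>1, \<dots>, i\<^sub>r \<in> I\<close> and
  \<open>n\<^sub>1, \<dots>, n\<^sub>r \<ge> 1\<close>. The type \<open>('i, 'k) fock\<close> is an ambient space which
  also has basis vectors violating these restrictions; its dimension is infinite and at least
  \<open>|\<Lambda>|\<close>, so it can serve as the ambient space in \<open>free_vertex_algebra\<close> for any
  \<open>B \<subseteq> \<Lambda>\<close>.
\<close>

type_synonym ('i, 'k) fock = "(('i \<Rightarrow>\<^sub>0 int) \<times> ('i \<times> nat) multiset) \<Rightarrow>\<^sub>0 'k"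

definition fscale :: "'k::field \<Rightarrow> ('x \<Rightarrow>\<^sub>0 'k) \<Rightarrow> ('x \<Rightarrow>\<^sub>0 'k)" where
  "fscale r v = Poly_Mapping.map ((*) r) v"

lemma lookup_fscale: "Poly_Mapping.lookup (fscale r v) x = r * Poly_Mapping.lookup v x"
  by (simp add: fscale_def map.rep_eq when_def)

interpretation fscale: vector_space fscale
  by unfold_locales (simp_all add: poly_mapping_eq_iff fun_eq_iff lookup_fscale lookup_add algebra_simps)

definition fock_grade ::
  "'i set \<Rightarrow> (('i \<Rightarrow>\<^sub>0 int) \<Rightarrow> ('i \<Rightarrow>\<^sub>0 int) \<Rightarrow> int) \<Rightarrow> bool \<Rightarrow> ('i, 'k::zero) fock set" where
  "fock_grade I form p = {v. \<forall>(a, m)\<in>Poly_Mapping.keys v.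
     a \<in> lattice_carrier I \<and> set_mset m \<subseteq> I \<times> {1..} \<and> odd (form a a) = p}"

definition lattice_vec :: "('i \<Rightarrow>\<^sub>0 int) \<Rightarrow> ('i, 'k::zero_neq_one) fock" where
  "lattice_vec a = Poly_Mapping.single (a, {#}) 1"

text \<open>
  The operators \<open>h(n)\<close>. For \<open>n < 0\<close>, \<open>h(n)\<close> is multiplication by \<open>h(n)\<close> in the symmetric
  algebra; \<open>h(0)\<close> acts on \<open>V\<^sub>a\<close> as \<open>(h|a)\<close>; for \<open>n > 0\<close>, \<open>h(n)\<close> is the derivation
  which kills \<open>v\<^sub>a\<close> and sends \<open>i(-n')\<close> to \<open>[h(n), i(-n')] = \<delta>\<^sub>n\<^sub>,\<^sub>n\<^sub>' n (h|i)\<close>.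
\<close>

definition heis_basis ::
  "(('i \<Rightarrow>\<^sub>0 int) \<Rightarrow> ('i \<Rightarrow>\<^sub>0 int) \<Rightarrow> int) \<Rightarrow> ('i \<Rightarrow>\<^sub>0 'k) \<Rightarrow> int \<Rightarrow>
   ('i \<Rightarrow>\<^sub>0 int) \<times> ('i \<times> nat) multiset \<Rightarrow> ('i, 'k::field_char_0) fock" where
  "heis_basis form h n = (\<lambda>(a, m).
     if n < 0 then
       \<Sum>i\<in>Poly_Mapping.keys h.
         Poly_Mapping.single (a, add_mset (i, nat (- n)) m) (Poly_Mapping.lookup h i)
     else if n = 0 then
       Poly_Mapping.single (a, m) (cartan_form form h (to_cartan a))
     else
       \<Sum>y\<in>{y \<in> set_mset m. snd y = nat n}.
         Poly_Mapping.single (a, m - {#y#})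
           (of_nat (count m y) * of_int n * cartan_form form h (Poly_Mapping.single (fst y) 1)))"

definition heis ::
  "(('i \<Rightarrow>\<^sub>0 int) \<Rightarrow> ('i \<Rightarrow>\<^sub>0 int) \<Rightarrow> int) \<Rightarrow> ('i \<Rightarrow>\<^sub>0 'k) \<Rightarrow> int \<Rightarrow>
   ('i, 'k) fock \<Rightarrow> ('i, 'k::field_char_0) fock" where
  "heis form h n v =
     (\<Sum>x\<in>Poly_Mapping.keys v. fscale (Poly_Mapping.lookup v x) (heis_basis form h n x))"

section \<open>Lattice vertex algebras\<close>

locale lattice_vertex_algebra =
  lattice_cocycle I form \<epsilon> + vertex_algebra fscale V
  for I :: "'i set" and form
    and \<epsilon> :: "('i \<Rightarrow>\<^sub>0 int) \<Rightarrow> ('i \<Rightarrow>\<^sub>0 int) \<Rightarrow> 'k::field_char_0"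
    and V :: "('i, 'k) fock va" +
  assumes grade_V: "grade V = fock_grade I form"
    and vac_V: "vac V = lattice_vec 0"
    and heis_V: "\<lbrakk>h \<in> cartan I; v \<in> va_carrier V\<rbrakk>
          \<Longrightarrow> nprod V (heis form h (- 1) (lattice_vec 0)) n v = heis form h n v"
    and lattice_vec_zero: "\<lbrakk>a \<in> lattice_carrier I; b \<in> lattice_carrier I; n \<ge> - form a b\<rbrakk>
          \<Longrightarrow> nprod V (lattice_vec a) n (lattice_vec b) = 0"
    and lattice_vec_nprod: "\<lbrakk>a \<in> lattice_carrier I; b \<in> lattice_carrier I\<rbrakk>
          \<Longrightarrow> nprod V (lattice_vec a) (- form a b - int k - 1) (lattice_vec b)
              = fscale (\<epsilon> a b / fact k)
                  (((\<lambda>x. va_D V x - heis form (to_cartan b) (- 1) x) ^^ k) (lattice_vec (a + b)))"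

end

theory Submission
  imports Defs
begin

text \<open>
  For letters \<open>a\<^sub>1, \<dots>, a\<^sub>l\<close> of \<open>B\<close> consider the regularised series
  \<open>\<Prod>\<^sub>i\<^sub><\<^sub>j (z\<^sub>i - z\<^sub>j)^N(a\<^sub>i,a\<^sub>j) Y(a\<^sub>1)(z\<^sub>1) \<dots> Y(a\<^sub>l)(z\<^sub>l) 1\<close>
  (\<open>reg_coeff\<close> is its coefficient at \<open>z\<^sub>1^r\<^sub>1 \<dots> z\<^sub>l^r\<^sub>l\<close>). Locality of order
  exactly \<open>N(a,b)\<close> makes it, up to sign, symmetric under permutations of the pairs
  \<open>(a\<^sub>i, z\<^sub>i)\<close>, and it contains no negative powers of \<open>z\<^sub>l\<close>
  since \<open>a\<^sub>(\<^sub>n\<^sub>)1 = 0\<close> for \<open>n \<ge> 0\<close>; hence it is a power series in all variables.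
  So a coefficient depends, up to sign, only on the multiset of the pairs
  \<open>(a\<^sub>i, r\<^sub>i)\<close> with \<open>r\<^sub>i \<ge> 0\<close>, and these coefficients span the vertex algebra
  generated by the letters (\<open>generated_subset_span_R\<close>). This bounds the free vertex algebra from above.

  In the lattice vertex algebra the same series is, up to sign,
  \<open>exp (\<Sum>\<^sub>i \<Sum>\<^sub>n\<^sub>\<ge>\<^sub>1 a\<^sub>i(-n) z\<^sub>i^n / n) v\<close> with \<open>v = v\<^sub>b\<close>,
  \<open>b = a\<^sub>1 + \<dots> + a\<^sub>l\<close>. Its coefficients are products of complete homogeneous symmetric
  functions in the \<open>a\<^sub>i(-n)\<close>, which are algebraically independent when \<open>B\<close> is
  linearly independent, so the images of the spanning elements are linearly independent
  (\<open>R_linear_independent\<close>) and \<open>\<phi>\<close> is injective.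

  The exponential is never computed. Since the form may be degenerate, the annihilation operators
  \<open>h(n)\<close> do not separate vectors; instead a linear functional \<open>l\<close> on \<open>\<hh>\<close> takes the place of
  \<open>(h|\<cdot>)\<close>. This gives derivations \<open>\<delta>\<^sub>l\<^sub>,\<^sub>n\<close> of the symmetric algebras with
  \<open>[\<delta>\<^sub>l\<^sub>,\<^sub>n, v\<^sub>a\<^sub>(\<^sub>k\<^sub>)] = l(a) v\<^sub>a\<^sub>(\<^sub>k\<^sub>+\<^sub>n\<^sub>)\<close> (\<open>der_nprod\<close>), and
  \<open>\<delta>\<^sub>l\<^sub>,\<^sub>n\<close> sends the regularised coefficient at \<open>(r\<^sub>i)\<close> to the sum over \<open>i\<close> of \<open>l(a\<^sub>i)\<close>
  times the one with \<open>r\<^sub>i\<close> lowered by \<open>n\<close> (\<open>der_R\<close>). Taking for \<open>l\<close> the functionals dual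
  to \<open>B\<close>, the product of the \<open>\<delta>\<close>'s belonging to the pairs of one multiset with positive exponent,
  followed by the coefficient of \<open>v\<^sub>b\<close>, kills every other multiset having at least as many
  positive exponents (\<open>dual_coef_R\<close>).

  The exact order of locality comes from the identity \<open>local_comm_top\<close>: if \<open>a\<close>, \<open>b\<close>
  are local of order \<open>M + 1\<close>, the failure of locality of order \<open>M\<close> is the field of
  \<open>a\<^sub>(\<^sub>M\<^sub>)b\<close>. It also supplies the commutators of \<open>h(n)\<close> with \<open>v\<^sub>a\<^sub>(\<^sub>k\<^sub>)\<close>.
\<close>

section \<open>Bilinearity and the translation operator\<close>

context vertex_algebra
begin

lemma subspace_carrier: "subspace (va_carrier A)"
  unfolding va_carrier_def by (rule subspace_sums[OF grade_subspace grade_subspace])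

lemma grade_carrier: "a \<in> grade A p \<Longrightarrow> a \<in> va_carrier A"
proof -
  assume a: "a \<in> grade A p"
  have z: "0 \<in> grade A q" for q using grade_subspace subspace_0 by blast
  have "a = a + 0" "a = 0 + a" by simp_all
  with a z have "\<exists>x y. a = x + y \<and> x \<in> grade A False \<and> y \<in> grade A True"
    by (cases p) (metis (full_types))+
  then show ?thesis unfolding va_carrier_def by blast
qed

lemma carrier_cases:
  assumes "x \<in> va_carrier A"
  obtains y z where "y \<in> grade A False" "z \<in> grade A True" "x = y + z"
  using assms unfolding va_carrier_def by blast

lemma carrier_0 [simp]: "0 \<in> va_carrier A"
  by (rule subspace_0[OF subspace_carrier])

lemma carrier_add: "x \<in> va_carrier A \<Longrightarrow> y \<in> va_carrier A \<Longrightarrow> x + y \<in> va_carrier A"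
  by (rule subspace_add[OF subspace_carrier])

lemma carrier_diff: "x \<in> va_carrier A \<Longrightarrow> y \<in> va_carrier A \<Longrightarrow> x - y \<in> va_carrier A"
  by (rule subspace_diff[OF subspace_carrier])

lemma carrier_scale: "x \<in> va_carrier A \<Longrightarrow> scale r x \<in> va_carrier A"
  by (rule subspace_scale[OF subspace_carrier])

lemma carrier_sum: "(\<And>i. i \<in> S \<Longrightarrow> f i \<in> va_carrier A) \<Longrightarrow> sum f S \<in> va_carrier A"
  by (rule subspace_sum[OF subspace_carrier])

lemma vac_carrier [simp]: "vac A \<in> va_carrier A"
  using vac_even by (rule grade_carrier)

lemma nprod_carrier:
  assumes "a \<in> va_carrier A" "b \<in> va_carrier A" shows "nprod A a n b \<in> va_carrier A"
proof -
  obtain a0 a1 where a: "a0 \<in> grade A False" "a1 \<in> grade A True" "a = a0 + a1"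
    using assms(1) by (rule carrier_cases)
  obtain b0 b1 where b: "b0 \<in> grade A False" "b1 \<in> grade A True" "b = b0 + b1"
    using assms(2) by (rule carrier_cases)
  note gc = grade_carrier[OF nprod_grade]
  have "nprod A a n b = nprod A a0 n b0 + nprod A a0 n b1 + (nprod A a1 n b0 + nprod A a1 n b1)"
    using a b by (simp add: nprod_add_left nprod_add_right grade_carrier carrier_add)
  then show ?thesis using a(1,2) b(1,2) by (auto intro!: carrier_add gc)
qed

lemma D_carrier: "a \<in> va_carrier A \<Longrightarrow> va_D A a \<in> va_carrier A"
  by (simp add: va_D_def nprod_carrier)

lemma nprod_zero_right [simp]: "a \<in> va_carrier A \<Longrightarrow> nprod A a n 0 = 0"
  using nprod_scale_right[of a 0 n 0] by simp

lemma nprod_zero_left [simp]: "a \<in> va_carrier A \<Longrightarrow> nprod A 0 n a = 0"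
  using nprod_scale_left[of 0 a 0 n] by simp

lemma nprod_diff_right: "a \<in> va_carrier A \<Longrightarrow> b \<in> va_carrier A \<Longrightarrow> b' \<in> va_carrier A \<Longrightarrow>
    nprod A a n (b - b') = nprod A a n b - nprod A a n b'"
  using nprod_add_right[of a b "scale (-1) b'" n] nprod_scale_right[of a b' n "-1"]
    carrier_scale[of b' "-1"] by simp

lemma nprod_sum_right:
  assumes "a \<in> va_carrier A" "\<And>i. i \<in> S \<Longrightarrow> f i \<in> va_carrier A"
  shows "nprod A a n (sum f S) = (\<Sum>i\<in>S. nprod A a n (f i))"
  using assms(2)
proof (induction S rule: infinite_finite_induct)
  case (insert x F)
  then show ?case by (simp add: nprod_add_right assms(1) carrier_sum)
qed (simp_all add: assms(1))

lemma D_add: "a \<in> va_carrier A \<Longrightarrow> b \<in> va_carrier A \<Longrightarrow> va_D A (a + b) = va_D A a + va_D A b"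
  by (simp add: va_D_def nprod_add_left)

lemma D_scale: "a \<in> va_carrier A \<Longrightarrow> va_D A (scale r a) = scale r (va_D A a)"
  by (simp add: va_D_def nprod_scale_left)

lemma D_zero [simp]: "va_D A 0 = 0"
  by (simp add: va_D_def)

lemma D_diff: "a \<in> va_carrier A \<Longrightarrow> b \<in> va_carrier A \<Longrightarrow> va_D A (a - b) = va_D A a - va_D A b"
  using D_add[of a "scale (-1) b"] D_scale[of b "-1"] carrier_scale[of b "-1"] by simp

lemma D_sum:
  assumes "\<And>i. i \<in> S \<Longrightarrow> f i \<in> va_carrier A"
  shows "va_D A (sum f S) = (\<Sum>i\<in>S. va_D A (f i))"
  using assms
proof (induction S rule: infinite_finite_induct)
  case (insert x F)
  then show ?case by (simp add: D_add carrier_sum)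
qed (simp_all)

lemma D_vac [simp]: "va_D A (vac A) = 0"
  by (simp add: va_D_def vac_nprod)

lemma nprod_vac_minus1: "a \<in> va_carrier A \<Longrightarrow> nprod A a (-1) (vac A) = a"
  by (simp add: nprod_vac_neg)

lemma D_nprod':
  "a \<in> va_carrier A \<Longrightarrow> b \<in> va_carrier A \<Longrightarrow>
    va_D A (nprod A a n b) = nprod A a n (va_D A b) - scale (of_int n) (nprod A a (n - 1) b)"
  by (simp add: nprod_D)

lemma eventually_nprod_zero:
  assumes "b \<in> va_carrier A" "c \<in> va_carrier A"
  shows "\<forall>\<^sub>F K in sequentially. \<forall>j\<ge>K. \<forall>n'\<ge>n. nprod A b (n' + int j) c = 0"
proof -
  obtain n0 where n0: "\<forall>n\<ge>n0. nprod A b n c = 0" using nprod_bounded[OF assms] by blast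
  show ?thesis unfolding eventually_sequentially
    by (rule exI[of _ "nat (n0 - n)"]) (use n0 in auto)
qed

section \<open>Locality\<close>

text \<open>
  The coefficient of \<open>w^(-m-1) z^(-n-1)\<close> in \<open>Y(a)(w) Y(b)(z) \<iota>\<^sub>w\<^sub>,\<^sub>z (w - z)^M c\<close>. The other side of
  the locality identity is the same expression with \<open>(a, m)\<close> and \<open>(b, n)\<close> exchanged.
\<close>
definition local_sum :: "'a \<Rightarrow> 'a \<Rightarrow> int \<Rightarrow> int \<Rightarrow> int \<Rightarrow> 'a \<Rightarrow> 'a" where
  "local_sum a b M m n c = Sum_any (\<lambda>j::nat. scale ((- 1) ^ j * (of_int M gchoose j))
        (nprod A a (m + M - int j) (nprod A b (n + int j) c)))"

lemma local_sum_finite: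
  assumes "a \<in> va_carrier A" "\<And>j. j \<ge> K \<Longrightarrow> nprod A b (n + int j) c = 0"
  shows "local_sum a b M m n c = (\<Sum>j<K. scale ((- 1) ^ j * (of_int M gchoose j))
        (nprod A a (m + M - int j) (nprod A b (n + int j) c)))"
  unfolding local_sum_def
proof (rule Sum_any.expand_superset)
  show "{j. scale ((- 1) ^ j * (of_int M gchoose j))
        (nprod A a (m + M - int j) (nprod A b (n + int j) c)) \<noteq> 0} \<subseteq> {..<K}"
    using assms by (auto intro: ccontr)
qed simp

text \<open>
  The truncation bound is uniform in \<open>n' \<ge> n\<close>, so that finitely many shifts of the indices can be
  treated with a single finite sum.
\<close>
lemma eventually_local_sum:
  assumes "a \<in> va_carrier A" "b \<in> va_carrier A" "c \<in> va_carrier A"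
  shows "\<forall>\<^sub>F K in sequentially. \<forall>M m. \<forall>n'\<ge>n. local_sum a b M m n' c = (\<Sum>j<K. scale ((- 1) ^ j * (of_int M gchoose j))
        (nprod A a (m + M - int j) (nprod A b (n' + int j) c)))"
  using eventually_nprod_zero[OF assms(2,3), of n]
proof eventually_elim
  case (elim K)
  then show ?case using local_sum_finite[OF assms(1)] by blast
qed

lemma local_sum_carrier:
  assumes "a \<in> va_carrier A" "b \<in> va_carrier A" "c \<in> va_carrier A"
  shows "local_sum a b M m n c \<in> va_carrier A"
proof -
  obtain K where "local_sum a b M m n c = (\<Sum>j<K. scale ((- 1) ^ j * (of_int M gchoose j))
        (nprod A a (m + M - int j) (nprod A b (n + int j) c)))"
    using eventually_happens'[OF _ eventually_local_sum[OF assms, of n]] by auto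
  then show ?thesis by (simp add: carrier_sum carrier_scale nprod_carrier assms)
qed

lemma powi_minus_one_diff: "(- 1 :: 'k) powi (M - int j) = (- 1) powi M * (- 1) ^ j"
proof -
  have "(- 1 :: 'k) powi (M - int j) = (- 1) powi M * (- 1) powi (- int j)"
    using power_int_add[of "-1::'k" M "- int j"] by simp
  also have "(- 1 :: 'k) powi (- int j) = (- 1) ^ j"
    by (cases "even j") (simp_all add: power_int_minus)
  finally show ?thesis .
qed

lemma local_iff_local_sum:
  assumes "a \<in> va_carrier A" "b \<in> va_carrier A"
  shows "va_local scale A s M a b \<longleftrightarrow>
    (\<forall>m n. \<forall>c\<in>va_carrier A. local_sum a b M m n c = scale (s * (- 1) powi M) (local_sum b a M n m c))"
proof -
  have "Sum_any (\<lambda>j::nat. scale (s * (- 1) powi (M - int j) * (of_int M gchoose j))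
        (nprod A b (n + M - int j) (nprod A a (m + int j) c)))
      = scale (s * (- 1) powi M) (local_sum b a M n m c)" if c: "c \<in> va_carrier A" for m n c
  proof -
    obtain K where K: "\<forall>j\<ge>K. nprod A a (m + int j) c = 0"
      using eventually_happens'[OF _ eventually_nprod_zero[OF assms(1) c, of m]] by auto
    have "Sum_any (\<lambda>j::nat. scale (s * (- 1) powi (M - int j) * (of_int M gchoose j))
        (nprod A b (n + M - int j) (nprod A a (m + int j) c)))
      = (\<Sum>j<K. scale (s * (- 1) powi (M - int j) * (of_int M gchoose j))
        (nprod A b (n + M - int j) (nprod A a (m + int j) c)))"
      by (rule Sum_any.expand_superset) (use K assms in \<open>auto intro: ccontr\<close>)
    also have "\<dots> = scale (s * (- 1) powi M) (\<Sum>j<K. scale ((- 1) ^ j * (of_int M gchoose j))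
        (nprod A b (n + M - int j) (nprod A a (m + int j) c)))"
      by (simp add: scale_sum_right powi_minus_one_diff mult_ac)
    also have "\<dots> = scale (s * (- 1) powi M) (local_sum b a M n m c)"
      using local_sum_finite[OF assms(2), of K a m c M n] K by simp
    finally show ?thesis .
  qed
  then show ?thesis unfolding va_local_def local_sum_def[symmetric] by auto
qed

lemma local_sum_zero: "local_sum a b 0 m n c = nprod A a m (nprod A b n c)"
proof -
  have "local_sum a b 0 m n c = (\<Sum>j\<in>{0::nat}. scale ((- 1) ^ j * ((0::'k) gchoose j))
        (nprod A a (m + 0 - int j) (nprod A b (n + int j) c)))"
    unfolding local_sum_def of_int_0
  proof (rule Sum_any.expand_superset)
    show "{j::nat. scale ((- 1) ^ j * ((0::'k) gchoose j))
        (nprod A a (m + 0 - int j) (nprod A b (n + int j) c)) \<noteq> 0} \<subseteq> {0}"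
      by (auto simp: gbinomial_0_left split: if_splits)
  qed simp
  then show ?thesis by simp
qed

text \<open>
  This is \<open>(w - z)^(M+1) = (w - z) (w - z)^M\<close>, i.e. Pascal's rule.
\<close>
lemma local_sum_Suc:
  assumes "a \<in> va_carrier A" "b \<in> va_carrier A" "c \<in> va_carrier A"
  shows "local_sum a b (M + 1) m n c = local_sum a b M (m + 1) n c - local_sum a b M m (n + 1) c"
proof -
  define F where "F M m n j = scale ((- 1) ^ j * (of_int M gchoose j))
        (nprod A a (m + M - int j) (nprod A b (n + int j) c))" for M m n j
  obtain K where K: "\<forall>j\<ge>K. \<forall>n'\<ge>n. nprod A b (n' + int j) c = 0"
    using eventually_happens'[OF _ eventually_nprod_zero[OF assms(2,3), of n]] by auto
  have L: "local_sum a b M m n' c = (\<Sum>j<K'. F M m n' j)" if "n' \<ge> n" "K' \<ge> K" for M m n' K'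
    unfolding F_def by (rule local_sum_finite[OF assms(1)]) (use K that in auto)
  have step: "F (M + 1) m n (Suc j) = F M (m + 1) n (Suc j) - F M m (n + 1) j" for j
  proof -
    have "(of_int (M + 1) gchoose Suc j) = (of_int M gchoose j) + (of_int M gchoose Suc j :: 'k)"
      using gbinomial_Suc_Suc[of "of_int M :: 'k" j] by simp
    then have c: "(- 1) ^ Suc j * (of_int (M + 1) gchoose Suc j)
        = (- 1) ^ Suc j * (of_int M gchoose Suc j) - (- 1) ^ j * (of_int M gchoose j :: 'k)"
      by (simp only: power_Suc) (simp add: distrib_left)
    have i: "m + (M + 1) - int (Suc j) = m + M - int j" "m + 1 + M - int (Suc j) = m + M - int j"
      "n + int (Suc j) = n + 1 + int j" by simp_all
    show ?thesis unfolding F_def i c scale_left_diff_distrib ..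
  qed
  have "local_sum a b (M + 1) m n c = (\<Sum>j<Suc K. F (M + 1) m n j)" by (rule L) auto
  also have "\<dots> = F (M + 1) m n 0 + (\<Sum>j<K. F (M + 1) m n (Suc j))"
    by (simp only: sum.lessThan_Suc_shift)
  also have "\<dots> = (\<Sum>j<Suc K. F M (m + 1) n j) - (\<Sum>j<K. F M m (n + 1) j)"
  proof -
    have "F (M + 1) m n 0 = F M (m + 1) n 0" by (simp add: F_def add.commute add.left_commute)
    then show ?thesis by (simp only: step sum_subtractf sum.lessThan_Suc_shift add_diff_eq)
  qed
  also have "\<dots> = local_sum a b M (m + 1) n c - local_sum a b M m (n + 1) c"
    using L[of n "Suc K" M "m + 1"] L[of "n + 1" K M m] by simp
  finally show ?thesis .
qed

text \<open>
  Commuting \<open>D\<close> past the two fields produces \<open>\<partial>\<^sub>w + \<partial>\<^sub>z\<close>, which annihilates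
  \<open>(w - z)^M\<close>; hence only the exponents \<open>m\<close> and \<open>n\<close> of the coefficient are differentiated.
\<close>
lemma local_sum_D:
  assumes "a \<in> va_carrier A" "b \<in> va_carrier A" "c \<in> va_carrier A"
  shows "va_D A (local_sum a b M m n c) = local_sum a b M m n (va_D A c)
     - scale (of_int m) (local_sum a b M (m - 1) n c) - scale (of_int n) (local_sum a b M m (n - 1) c)"
proof -
  define C :: "nat \<Rightarrow> 'k" where "C j = (- 1) ^ j * (of_int M gchoose j)" for j
  define P where "P i k = nprod A a i (nprod A b k c)" for i k
  have Pc: "P i k \<in> va_carrier A" for i k by (simp add: P_def nprod_carrier assms)
  obtain K where K: "\<forall>j\<ge>K. \<forall>n'\<ge>n-1. nprod A b (n' + int j) c = 0"
      "\<forall>j\<ge>K. \<forall>n'\<ge>n. nprod A b (n' + int j) (va_D A c) = 0"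
    using eventually_happens'[OF _ eventually_conj[OF eventually_nprod_zero[OF assms(2,3), of "n-1"]
      eventually_nprod_zero[OF assms(2) D_carrier[OF assms(3)], of n]]] by auto
  have L: "local_sum a b M m n' c = (\<Sum>j<K'. scale (C j) (P (m + M - int j) (n' + int j)))"
    if "n' \<ge> n - 1" "K' \<ge> K" for m n' K'
    unfolding C_def P_def by (rule local_sum_finite[OF assms(1)]) (use K that in auto)
  have L2: "local_sum a b M m n (va_D A c)
      = (\<Sum>j<K. scale (C j) (nprod A a (m + M - int j) (nprod A b (n + int j) (va_D A c))))"
    unfolding C_def by (rule local_sum_finite[OF assms(1)]) (use K in auto)
  have DP: "va_D A (P i k) = nprod A a i (nprod A b k (va_D A c))
      - scale (of_int i) (P (i - 1) k) - scale (of_int k) (P i (k - 1))" for i k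
    unfolding P_def
    by (simp add: D_nprod' nprod_carrier assms D_carrier nprod_diff_right nprod_scale_right carrier_scale algebra_simps)
  have absorb: "of_nat (Suc j) * C (Suc j) = (of_nat j - of_int M) * C j" for j
  proof -
    have e: "of_nat (Suc j) * (of_int M gchoose Suc j) = (of_int M - of_nat j) * (of_int M gchoose j :: 'k)"
      using gbinomial_absorb_comp[of "of_int M :: 'k" j] gbinomial_absorption[of j "of_int M :: 'k"]
      by (simp add: algebra_simps)
    have "of_nat (Suc j) * C (Suc j) = - ((- 1) ^ j * (of_nat (Suc j) * (of_int M gchoose Suc j)))"
      unfolding C_def by (simp add: algebra_simps)
    also have "\<dots> = (of_nat j - of_int M) * C j"
      unfolding e C_def by (simp add: algebra_simps)
    finally show ?thesis .
  qed
  have sh: "(\<Sum>j<K. scale (C j * of_int (n + int j)) (P (m + M - int j) (n + int j - 1)))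
      = scale (C 0 * of_int n) (P (m + M) (n - 1)) + (\<Sum>j<K. scale (C (Suc j) * of_int (n + int j + 1)) (P (m + M - int j - 1) (n + int j)))"
  proof -
    have "(\<Sum>j<K. scale (C j * of_int (n + int j)) (P (m + M - int j) (n + int j - 1)))
       = (\<Sum>j<Suc K. scale (C j * of_int (n + int j)) (P (m + M - int j) (n + int j - 1)))"
      using K(1)[rule_format, of K "n - 1"] by (simp add: P_def assms algebra_simps)
    also have "\<dots> = scale (C 0 * of_int n) (P (m + M) (n - 1)) + (\<Sum>j<K. scale (C (Suc j) * of_int (n + int j + 1)) (P (m + M - int j - 1) (n + int j)))"
      unfolding sum.lessThan_Suc_shift by (simp add: algebra_simps)
    finally show ?thesis .
  qed
  have sh2: "local_sum a b M m (n - 1) c = scale (C 0) (P (m + M) (n - 1)) + (\<Sum>j<K. scale (C (Suc j)) (P (m + M - int j - 1) (n + int j)))"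
    using L[of "n - 1" "Suc K" m] unfolding sum.lessThan_Suc_shift by (simp add: algebra_simps)
  have "va_D A (local_sum a b M m n c) = (\<Sum>j<K. scale (C j) (va_D A (P (m + M - int j) (n + int j))))"
    using L[of n K m] by (simp add: D_sum D_scale carrier_scale Pc)
  also have "\<dots> = local_sum a b M m n (va_D A c)
     - (\<Sum>j<K. scale (C j * of_int (m + M - int j)) (P (m + M - int j - 1) (n + int j)))
     - (\<Sum>j<K. scale (C j * of_int (n + int j)) (P (m + M - int j) (n + int j - 1)))"
    unfolding L2 DP by (simp add: scale_right_diff_distrib sum_subtractf)
  also have "\<dots> = local_sum a b M m n (va_D A c)
     - scale (of_int m) (local_sum a b M (m - 1) n c) - scale (of_int n) (local_sum a b M m (n - 1) c)"
  proof -
    have "(\<Sum>j<K. scale (C j * of_int (m + M - int j)) (P (m + M - int j - 1) (n + int j)))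
       + (\<Sum>j<K. scale (C (Suc j) * of_int (n + int j + 1)) (P (m + M - int j - 1) (n + int j)))
      = (\<Sum>j<K. scale (of_int m * C j) (P (m + M - int j - 1) (n + int j)))
       + (\<Sum>j<K. scale (of_int n * C (Suc j)) (P (m + M - int j - 1) (n + int j)))"
      unfolding sum.distrib[symmetric] scale_left_distrib[symmetric]
    proof (rule sum.cong[OF refl])
      fix j
      have "C j * of_int (m + M - int j) + C (Suc j) * of_int (n + int j + 1)
          = of_int m * C j + of_int n * C (Suc j)"
        using absorb[of j] by (simp add: algebra_simps)
      then show "scale (C j * of_int (m + M - int j) + C (Suc j) * of_int (n + int j + 1)) (P (m + M - int j - 1) (n + int j))
        = scale (of_int m * C j + of_int n * C (Suc j)) (P (m + M - int j - 1) (n + int j))" by simp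
    qed
    then show ?thesis unfolding sh sh2 L[of n K "m - 1", simplified]
      by (simp add: scale_right_distrib scale_sum_right algebra_simps)
  qed
  finally show ?thesis .
qed

lemma local_sum_vac:
  assumes "a \<in> va_carrier A" "b \<in> va_carrier A"
  shows "local_sum a b M m (- 1) (vac A) = nprod A a (m + M) b"
proof -
  have "local_sum a b M m (-1) (vac A) = (\<Sum>j<1. scale ((- 1) ^ j * (of_int M gchoose j))
        (nprod A a (m + M - int j) (nprod A b (-1 + int j) (vac A))))"
    by (rule local_sum_finite) (use assms in \<open>auto simp: nprod_vac_nonneg\<close>)
  then show ?thesis using assms by (simp add: nprod_vac_minus1)
qed

lemma local_sum_vac_nonneg:
  assumes "a \<in> va_carrier A" "b \<in> va_carrier A" "n \<ge> 0"
  shows "local_sum a b M m n (vac A) = 0"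
  using local_sum_finite[of a 0 b n "vac A" M m] assms by (simp add: nprod_vac_nonneg)

lemma local_sum_add:
  assumes "a \<in> va_carrier A" "b \<in> va_carrier A" "c \<in> va_carrier A" "c' \<in> va_carrier A"
  shows "local_sum a b M m n (c + c') = local_sum a b M m n c + local_sum a b M m n c'"
proof -
  have "\<forall>\<^sub>F K in sequentially. local_sum a b M m n (c + c') = local_sum a b M m n c + local_sum a b M m n c'"
    using eventually_local_sum[OF assms(1-3), of n] eventually_local_sum[OF assms(1,2,4), of n]
      eventually_local_sum[OF assms(1,2) carrier_add[OF assms(3,4)], of n]
  proof eventually_elim
    case (elim K)
    then show ?case
      by (simp add: nprod_add_right nprod_carrier assms scale_right_distrib sum.distrib)
  qed
  then show ?thesis by simp
qed

end

section \<open>The order of locality\<close>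

text \<open>
  Multiplication of a series in two or three variables by the difference of two of them, on
  coefficients: \<open>shift2\<close> for both variables, \<open>shift13\<close> and \<open>shift23\<close> for the first or second
  variable and the third one.
\<close>
definition shift2 :: "(int \<Rightarrow> int \<Rightarrow> 'a::ab_group_add) \<Rightarrow> int \<Rightarrow> int \<Rightarrow> 'a" where
  "shift2 h k p = h (k + 1) p - h k (p + 1)"

definition shift13 :: "(int \<Rightarrow> int \<Rightarrow> int \<Rightarrow> 'a::ab_group_add) \<Rightarrow> int \<Rightarrow> int \<Rightarrow> int \<Rightarrow> 'a" where
  "shift13 f m n p = f (m + 1) n p - f m n (p + 1)"

definition shift23 :: "(int \<Rightarrow> int \<Rightarrow> int \<Rightarrow> 'a::ab_group_add) \<Rightarrow> int \<Rightarrow> int \<Rightarrow> int \<Rightarrow> 'a" where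
  "shift23 f m n p = f m (n + 1) p - f m n (p + 1)"

lemma shift13_eq_shift2: "(shift13 ^^ K) f m n p = (shift2 ^^ K) (\<lambda>m p. f m n p) m p"
  by (induction K arbitrary: m p) (simp_all add: shift13_def shift2_def)

lemma shift23_eq_shift2: "(shift23 ^^ K) f m n p = (shift2 ^^ K) (\<lambda>n p. f m n p) n p"
  by (induction K arbitrary: n p) (simp_all add: shift23_def shift2_def)

lemma shift13_shift23_commute:
  "(shift13 ^^ K) ((shift23 ^^ L) f) = (shift23 ^^ L) ((shift13 ^^ K) f)"
proof -
  have c: "shift13 (shift23 f) = shift23 (shift13 f)" for f :: "int \<Rightarrow> int \<Rightarrow> int \<Rightarrow> 'a"
    by (simp add: fun_eq_iff shift13_def shift23_def algebra_simps)
  have "shift13 ((shift23 ^^ L) f) = (shift23 ^^ L) (shift13 f)" for f :: "int \<Rightarrow> int \<Rightarrow> int \<Rightarrow> 'a"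
    by (induction L) (simp_all add: c)
  then show ?thesis by (induction K) simp_all
qed

lemma shift2_diff: "(shift2 ^^ K) (\<lambda>k p. f k p - g k p) k p = (shift2 ^^ K) f k p - (shift2 ^^ K) g k p"
  by (induction K arbitrary: k p) (simp_all add: shift2_def)

lemma shift13_diff: "(shift13 ^^ K) (\<lambda>m n p. f m n p - g m n p) = (\<lambda>m n p. (shift13 ^^ K) f m n p - (shift13 ^^ K) g m n p)"
  by (intro ext) (simp only: shift13_eq_shift2 shift2_diff)

lemma shift23_diff: "(shift23 ^^ K) (\<lambda>m n p. f m n p - g m n p) = (\<lambda>m n p. (shift23 ^^ K) f m n p - (shift23 ^^ K) g m n p)"
  by (intro ext) (simp only: shift23_eq_shift2 shift2_diff)

lemma shift2_add: "(shift2 ^^ K) (\<lambda>k p. f k p + g k p) k p = (shift2 ^^ K) f k p + (shift2 ^^ K) g k p"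
  by (induction K arbitrary: k p) (simp_all add: shift2_def)

lemma shift2_0: "(shift2 ^^ K) (\<lambda>k p. 0) k p = 0"
  by (induction K arbitrary: k p) (simp_all add: shift2_def)

lemma shift2_sum: "(shift2 ^^ K) (\<lambda>k p. \<Sum>j\<in>J. f j k p) k p = (\<Sum>j\<in>J. (shift2 ^^ K) (f j) k p)"
  by (induction K arbitrary: k p) (simp_all add: shift2_def sum_subtractf)

lemma shift2_translate: "(shift2 ^^ K) (\<lambda>k p. h (i + k) p) k p = (shift2 ^^ K) h (i + k) p"
  by (induction K arbitrary: k p) (simp_all add: shift2_def add.assoc)

lemma shift2_linear:
  assumes "\<And>x y. x \<in> S \<Longrightarrow> y \<in> S \<Longrightarrow> T (x - y) = T x - T y"
    and "\<And>x y. x \<in> S \<Longrightarrow> y \<in> S \<Longrightarrow> x - y \<in> S" and "\<And>k p. h k p \<in> S"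
  shows "(shift2 ^^ K) (\<lambda>k p. T (h k p)) k p = T ((shift2 ^^ K) h k p)"
proof -
  have "(\<forall>k p. (shift2 ^^ K) h k p \<in> S \<and> (shift2 ^^ K) (\<lambda>k p. T (h k p)) k p = T ((shift2 ^^ K) h k p))"
    by (induction K) (simp_all add: shift2_def assms)
  then show ?thesis by blast
qed

lemma shift2_cong_ge:
  assumes "\<And>k p. k \<ge> k0 \<Longrightarrow> p \<ge> p0 \<Longrightarrow> f k p = g k p" "k \<ge> k0" "p \<ge> p0"
  shows "(shift2 ^^ K) f k p = (shift2 ^^ K) g k p"
  using assms(2,3) by (induction K arbitrary: k p) (simp_all add: shift2_def assms(1))

text \<open>
  Setting the second variable to zero. For \<open>h k p\<close> of the form \<open>E\<^sub>k (d\<^sub>p 1)\<close> this turns a locality relation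
  applied to the vacuum into the values of the field \<open>E\<close> at \<open>d\<close>.
\<close>
lemma shift2_boundary:
  assumes "\<And>k p. p \<ge> 0 \<Longrightarrow> h k p = 0"
  shows "(shift2 ^^ K) h k (- 1) = h (k + int K) (- 1)"
proof -
  have z: "(shift2 ^^ K) h k p = 0" if "p \<ge> 0" for K k p
    using that by (induction K arbitrary: k p) (simp_all add: shift2_def assms)
  show ?thesis
    by (induction K arbitrary: k) (simp_all add: shift2_def z add_ac)
qed

text \<open>
  The coefficients of \<open>\<delta>(w - z) E(z)\<close> depend only on the sum of their two indices, and there \<open>w - x\<close>
  acts in the same way as \<open>z - x\<close>.
\<close>
lemma shift2_diag:
  assumes "\<And>m n p. f m n p = h (m + n) p"
  shows "(shift13 ^^ K) ((shift23 ^^ L) f) m n p = (shift2 ^^ (K + L)) h (m + n) p"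
proof -
  have a: "(shift23 ^^ L) f m n p = (shift2 ^^ L) h (m + n) p" for m n p
    unfolding shift23_eq_shift2 assms by (rule shift2_translate)
  have "(shift13 ^^ K) ((shift23 ^^ L) f) m n p = (shift2 ^^ K) (\<lambda>m p. (shift2 ^^ L) h (n + m) p) m p"
    unfolding shift13_eq_shift2 a by (simp add: add.commute)
  also have "\<dots> = (shift2 ^^ K) ((shift2 ^^ L) h) (n + m) p" by (rule shift2_translate)
  finally show ?thesis by (simp add: funpow_add add.commute)
qed

context vertex_algebra
begin

definition local_comm :: "'k \<Rightarrow> 'a \<Rightarrow> 'a \<Rightarrow> int \<Rightarrow> int \<Rightarrow> int \<Rightarrow> 'a \<Rightarrow> 'a" where
  "local_comm s a b M m n c = local_sum a b M m n c - scale (s * (- 1) powi M) (local_sum b a M n m c)"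

lemma local_iff_local_comm:
  assumes "a \<in> va_carrier A" "b \<in> va_carrier A"
  shows "va_local scale A s M a b \<longleftrightarrow> (\<forall>m n. \<forall>c\<in>va_carrier A. local_comm s a b M m n c = 0)"
  unfolding local_iff_local_sum[OF assms] local_comm_def by simp

lemma local_comm_carrier:
  assumes "a \<in> va_carrier A" "b \<in> va_carrier A" "c \<in> va_carrier A"
  shows "local_comm s a b M m n c \<in> va_carrier A"
  unfolding local_comm_def by (simp add: assms carrier_diff carrier_scale local_sum_carrier)

lemma local_comm_zero: "local_comm s a b 0 m n c = nprod A a m (nprod A b n c) - scale s (nprod A b n (nprod A a m c))"
  by (simp add: local_comm_def local_sum_zero)

lemma local_comm_Suc:
  assumes "a \<in> va_carrier A" "b \<in> va_carrier A" "c \<in> va_carrier A"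
  shows "local_comm s a b (M + 1) m n c = local_comm s a b M (m + 1) n c - local_comm s a b M m (n + 1) c"
proof -
  have p: "(- 1 :: 'k) powi (M + 1) = - ((- 1) powi M)"
    by (simp add: power_int_add)
  show ?thesis unfolding local_comm_def local_sum_Suc[OF assms] local_sum_Suc[OF assms(2,1,3)] p
    by (simp add: algebra_simps scale_right_diff_distrib)
qed

text \<open>
  For a nonnegative order no expansion is involved: the commutator is multiplied by a polynomial.
\<close>
lemma local_comm_shift2:
  assumes "a \<in> va_carrier A" "b \<in> va_carrier A" "c \<in> va_carrier A"
  shows "(shift2 ^^ K) (\<lambda>m n. nprod A a m (nprod A b n c) - scale s (nprod A b n (nprod A a m c))) m n
    = local_comm s a b (int K) m n c"
proof (induction K arbitrary: m n)
  case (Suc K)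
  then show ?case using local_comm_Suc[OF assms, of s "int K" m n] by (simp add: shift2_def add.commute)
qed (simp add: local_comm_zero)

lemma local_comm_add:
  assumes "a \<in> va_carrier A" "b \<in> va_carrier A" "c \<in> va_carrier A" "c' \<in> va_carrier A"
  shows "local_comm s a b M m n (c + c') = local_comm s a b M m n c + local_comm s a b M m n c'"
  unfolding local_comm_def using assms by (simp add: local_sum_add scale_right_distrib)

lemma local_sum_arg_0 [simp]: "a \<in> va_carrier A \<Longrightarrow> b \<in> va_carrier A \<Longrightarrow> local_sum a b M m n 0 = 0"
  using local_sum_add[of a b 0 0 M m n] by simp

lemma local_comm_D:
  assumes "a \<in> va_carrier A" "b \<in> va_carrier A" "c \<in> va_carrier A"
  shows "va_D A (local_comm s a b M m n c) = local_comm s a b M m n (va_D A c)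
     - scale (of_int m) (local_comm s a b M (m - 1) n c) - scale (of_int n) (local_comm s a b M m (n - 1) c)"
  unfolding local_comm_def
  by (simp add: D_diff D_scale carrier_scale local_sum_carrier assms local_sum_D scale_right_diff_distrib
      scale_left_commute algebra_simps)

lemma local_mono:
  assumes "a \<in> va_carrier A" "b \<in> va_carrier A" "va_local scale A s M a b" "M \<le> M'"
  shows "va_local scale A s M' a b"
  using assms(4,3)
proof (induction M' rule: int_ge_induct)
  case (step i)
  then show ?case
    by (simp add: local_iff_local_comm assms(1,2) local_comm_Suc)
qed

lemma local_nprod_zero:
  assumes "a \<in> va_carrier A" "b \<in> va_carrier A" "va_local scale A s M a b" "n \<ge> M"
  shows "nprod A a n b = 0"
  using assms(3,4) local_sum_vac[OF assms(1,2), of M "n - M"] local_sum_vac_nonneg[OF assms(2,1), of "n - M" M "-1"]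
  by (simp add: local_iff_local_sum assms(1,2))

lemma local_nat:
  assumes "a \<in> grade A p" "b \<in> grade A q"
  obtains K0 where "\<And>K. K \<ge> K0 \<Longrightarrow> va_local scale A (if p \<and> q then - 1 else 1) (int K) a b"
proof -
  obtain M where M: "va_local scale A (if p \<and> q then - 1 else 1) M a b" using locality[OF assms] by blast
  show thesis
  proof (rule that)
    fix K assume "K \<ge> nat M"
    then have "M \<le> int K" by simp
    with M show "va_local scale A (if p \<and> q then - 1 else 1) (int K) a b"
      using local_mono assms grade_carrier by blast
  qed
qed

text \<open>
  Locality of order \<open>M + 1\<close> says that \<open>w - z\<close> annihilates the difference of the two sides of order
  \<open>M\<close>, so this difference is \<open>\<delta>(w - z)\<close> times a field; let \<open>E(z)\<close> be that field minus the field of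
  \<open>a\<^sub>(\<^sub>M\<^sub>)b\<close>. As in the uniqueness theorem for fields, \<open>E = 0\<close> since \<open>E\<close> kills the vacuum and is
  local with respect to every \<open>d\<close> (Dong's lemma): then
  \<open>(z - x)^K E(z) Y(d)(x) 1 = \<plusminus> (z - x)^K Y(d)(x) E(z) 1 = 0\<close>, and \<open>x = 0\<close> gives \<open>E(z) d = 0\<close>.
\<close>
lemma local_comm_top_homogeneous:
  assumes a: "a \<in> grade A p" and b: "b \<in> grade A q" and d: "d \<in> grade A r"
    and loc: "va_local scale A (if p \<and> q then - 1 else 1) (M + 1) a b"
  shows "local_comm (if p \<and> q then - 1 else 1) a b M m n d = nprod A (nprod A a M b) (m + n) d"
proof -
  define s :: 'k where "s = (if p \<and> q then - 1 else 1)"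
  define sa :: 'k where "sa = (if p \<and> r then - 1 else 1)"
  define sb :: 'k where "sb = (if q \<and> r then - 1 else 1)"
  define e where "e = nprod A a M b"
  define E where "E k c = local_comm s a b M k 0 c - nprod A e k c" for k c
  have car [simp]: "a \<in> va_carrier A" "b \<in> va_carrier A" "d \<in> va_carrier A"
    using a b d grade_carrier by auto
  have eg: "e \<in> grade A (p \<noteq> q)" unfolding e_def using nprod_grade[OF a b] .
  then have [simp]: "e \<in> va_carrier A" by (rule grade_carrier)
  have L0: "local_comm s a b (M + 1) m n c = 0" if "c \<in> va_carrier A" for m n c
    using loc that by (simp add: local_iff_local_comm s_def)
  have diag1: "local_comm s a b M (m + 1) n c = local_comm s a b M m (n + 1) c" if "c \<in> va_carrier A" for m n c
    using L0[OF that, of m n] local_comm_Suc[of a b c s M m n] that by simp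
  have diag: "local_comm s a b M m n c = local_comm s a b M (m + n) 0 c" if c: "c \<in> va_carrier A" for m n c
  proof (induction n arbitrary: m rule: int_induct[where k = 0])
    case (step1 i)
    then show ?case using diag1[OF c, of m i] by (simp add: add_ac)
  next
    case (step2 i)
    then show ?case using diag1[OF c, of "m - 1" "i - 1"] step2(2)[of "m - 1"]
      by (simp add: algebra_simps)
  qed simp
  have Ev_nonneg: "E k (vac A) = 0" if "k \<ge> - 1" for k
  proof -
    have "local_comm s a b M k 0 (vac A) = local_comm s a b M (k + 1) (- 1) (vac A)"
      using diag[of "vac A" "k + 1" "- 1"] by simp
    also have "\<dots> = nprod A a (k + 1 + M) b"
      using that by (simp add: local_comm_def local_sum_vac local_sum_vac_nonneg)
    also have "\<dots> = nprod A e k (vac A)"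
    proof (cases "k = - 1")
      case True
      then show ?thesis using nprod_vac_minus1[OF \<open>e \<in> va_carrier A\<close>] by (simp add: e_def)
    next
      case False
      with that have "k \<ge> 0" by simp
      then show ?thesis using local_nprod_zero[OF _ _ loc, of "k + 1 + M"] by (simp add: nprod_vac_nonneg)
    qed
    finally show ?thesis by (simp add: E_def)
  qed
  \<comment> \<open>\<open>D\<close> maps \<open>E k (vac A)\<close> to \<open>-k E (k - 1) (vac A)\<close>, so the vanishing descends from \<open>k = -1\<close>.\<close>
  have Ev: "E k (vac A) = 0" for k
  proof (cases "k \<ge> - 1")
    case False
    have "E k (vac A) = 0" if "k \<le> - 1" for k
      using that
    proof (induction k rule: int_le_induct)
      case (step i)
      have "va_D A (E i (vac A)) = scale (- of_int i) (E (i - 1) (vac A))"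
        unfolding E_def by (simp add: D_diff local_comm_carrier nprod_carrier local_comm_D D_nprod' scale_right_diff_distrib)
          (simp add: local_comm_def)
      with step show ?case by simp
    qed (simp add: Ev_nonneg)
    with False show ?thesis by simp
  qed (simp add: Ev_nonneg)
  obtain K1 where K1: "\<And>K. K \<ge> K1 \<Longrightarrow> va_local scale A sa (int K) a d"
    using local_nat[OF a d] unfolding sa_def by blast
  obtain K2 where K2: "\<And>K. K \<ge> K2 \<Longrightarrow> va_local scale A sb (int K) b d"
    using local_nat[OF b d] unfolding sb_def by blast
  have sab: "(if (p \<noteq> q) \<and> r then - 1 else 1) = sa * sb" by (auto simp: sa_def sb_def)
  obtain K3 where K3: "\<And>K. K \<ge> K3 \<Longrightarrow> va_local scale A (sa * sb) (int K) e d"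
    using local_nat[OF eg d] unfolding sab by blast
  define K where "K = max K1 (max K2 K3)"
  have Ka: "(shift2 ^^ K) (\<lambda>m n. nprod A a m (nprod A d n c) - scale sa (nprod A d n (nprod A a m c))) m n = 0"
    if "c \<in> va_carrier A" for m n c
    using K1[of K] that by (simp add: local_comm_shift2 local_iff_local_comm K_def)
  have Kb: "(shift2 ^^ K) (\<lambda>m n. nprod A b m (nprod A d n c) - scale sb (nprod A d n (nprod A b m c))) m n = 0"
    if "c \<in> va_carrier A" for m n c
    using K2[of K] that by (simp add: local_comm_shift2 local_iff_local_comm K_def)
  have Ke: "(shift2 ^^ (K + K)) (\<lambda>m n. nprod A e m (nprod A d n c) - scale (sa * sb) (nprod A d n (nprod A e m c))) m n = 0"
    if "c \<in> va_carrier A" for m n c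
    using K3[of "K + K"] that unfolding local_comm_shift2[OF \<open>e \<in> va_carrier A\<close> \<open>d \<in> va_carrier A\<close> that] by (simp add: local_iff_local_comm K_def)
  \<comment> \<open>Dong: \<open>(w - x)^K (z - x)^K\<close> moves \<open>Y(d)(x)\<close> past both factors of each term of a locality sum.\<close>
  have half: "(shift13 ^^ K) ((shift23 ^^ K) (\<lambda>m n p. local_sum a' b' M m n (nprod A d p (vac A))
      - scale (sa * sb) (nprod A d p (local_sum a' b' M m n (vac A))))) m n (- 1) = 0"
    if a': "a' \<in> va_carrier A" and b': "b' \<in> va_carrier A"
      and KA: "\<And>c m n. c \<in> va_carrier A \<Longrightarrow> (shift2 ^^ K) (\<lambda>m n. nprod A a' m (nprod A d n c) - scale s1 (nprod A d n (nprod A a' m c))) m n = 0"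
      and KB: "\<And>c m n. c \<in> va_carrier A \<Longrightarrow> (shift2 ^^ K) (\<lambda>m n. nprod A b' m (nprod A d n c) - scale s2 (nprod A d n (nprod A b' m c))) m n = 0"
      and s12: "sa * sb = s1 * s2" for a' b' s1 s2 m n
  proof -
    define v where "v = vac A"
    have [simp]: "v \<in> va_carrier A" by (simp add: v_def)
    have vd: "nprod A d p v = (if p = - 1 then d else 0)" if "p \<ge> - 1" for p
      using that by (simp add: v_def nprod_vac_minus1 nprod_vac_nonneg)
    define C :: "nat \<Rightarrow> 'k" where "C j = (- 1) ^ j * (of_int M gchoose j)" for j
    define f where "f = (\<lambda>m n p. local_sum a' b' M m n (nprod A d p v) - scale (sa * sb) (nprod A d p (local_sum a' b' M m n v)))"
    define g where "g j = (\<lambda>m n p. nprod A a' m (nprod A b' n (nprod A d p v)) - scale (sa * sb) (nprod A d p (nprod A a' m (nprod A b' n v))))" for j :: nat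
    obtain J where J: "\<forall>M m. \<forall>n'\<ge>n. local_sum a' b' M m n' d = (\<Sum>j<J. scale ((- 1) ^ j * (of_int M gchoose j))
        (nprod A a' (m + M - int j) (nprod A b' (n' + int j) d)))"
      "\<forall>M m. \<forall>n'\<ge>n. local_sum a' b' M m n' v = (\<Sum>j<J. scale ((- 1) ^ j * (of_int M gchoose j))
        (nprod A a' (m + M - int j) (nprod A b' (n' + int j) v)))"
      using eventually_happens'[OF _ eventually_conj[OF eventually_local_sum[OF a' b' \<open>d \<in> va_carrier A\<close>, of n] eventually_local_sum[OF a' b' \<open>v \<in> va_carrier A\<close>, of n]]]
      by (auto simp: v_def)
    have fg: "f m n' p = (\<Sum>j<J. scale (C j) (g j (m + M - int j) (n' + int j) p))" if "n' \<ge> n" "p \<ge> - 1" for m n' p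
    proof -
      have "local_sum a' b' M m n' (nprod A d p v) = (\<Sum>j<J. scale (C j) (nprod A a' (m + M - int j) (nprod A b' (n' + int j) (nprod A d p v))))"
        using J(1) that a' b' by (simp add: vd C_def)
      moreover have "nprod A d p (local_sum a' b' M m n' v) = (\<Sum>j<J. scale (C j) (nprod A d p (nprod A a' (m + M - int j) (nprod A b' (n' + int j) v))))"
        using J(2) that a' b' by (simp add: C_def nprod_sum_right nprod_scale_right nprod_carrier carrier_scale)
      ultimately show ?thesis unfolding f_def g_def
        by (simp add: scale_right_diff_distrib sum_subtractf scale_sum_right mult.commute[of "sa * sb"])
    qed
    have kill: "(shift13 ^^ K) ((shift23 ^^ K) (g j)) m n p = 0" for j m n p
    proof -
      define g1 where "g1 = (\<lambda>m n p. nprod A a' m (nprod A b' n (nprod A d p v) - scale s2 (nprod A d p (nprod A b' n v))))"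
      define g2 where "g2 = (\<lambda>m n p. scale s2 (nprod A a' m (nprod A d p (nprod A b' n v)) - scale s1 (nprod A d p (nprod A a' m (nprod A b' n v)))))"
      have "g j = (\<lambda>m n p. g1 m n p + g2 m n p)"
        unfolding g_def g1_def g2_def s12 using a' b'
        by (simp add: fun_eq_iff nprod_diff_right nprod_carrier carrier_scale nprod_scale_right scale_right_diff_distrib mult.commute)
      moreover have "(shift23 ^^ K) g1 m n p = 0" for m n p
      proof -
        have "(shift23 ^^ K) g1 m n p = nprod A a' m ((shift2 ^^ K) (\<lambda>n p. nprod A b' n (nprod A d p v) - scale s2 (nprod A d p (nprod A b' n v))) n p)"
          unfolding shift23_eq_shift2 g1_def
          by (rule shift2_linear[where S = "va_carrier A"])
            (simp_all add: nprod_diff_right a' b' carrier_diff carrier_scale nprod_carrier)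
        then show ?thesis by (simp add: KB a')
      qed
      moreover have "(shift13 ^^ K) g2 m n p = 0" for m n p
      proof -
        have "(shift13 ^^ K) g2 m n p = scale s2 ((shift2 ^^ K) (\<lambda>m p. nprod A a' m (nprod A d p (nprod A b' n v)) - scale s1 (nprod A d p (nprod A a' m (nprod A b' n v)))) m p)"
          unfolding shift13_eq_shift2 g2_def
          by (rule shift2_linear[where S = UNIV]) (simp_all add: scale_right_diff_distrib)
        then show ?thesis by (simp add: KA nprod_carrier b')
      qed
      ultimately show ?thesis
      proof -
        assume gg: "g j = (\<lambda>m n p. g1 m n p + g2 m n p)"
          and 1: "\<And>m n p. (shift23 ^^ K) g1 m n p = 0" and 2: "\<And>m n p. (shift13 ^^ K) g2 m n p = 0"
        have "(shift23 ^^ K) (g j) = (\<lambda>m n p. (shift23 ^^ K) g2 m n p)"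
          unfolding gg using 1 unfolding fun_eq_iff shift23_eq_shift2 shift2_add by simp
        moreover have "(shift13 ^^ K) ((shift23 ^^ K) g2) m n p = 0"
        proof -
          have "(shift13 ^^ K) g2 = (\<lambda>m n p. 0)" using 2 by (simp add: fun_eq_iff)
          then show ?thesis unfolding shift13_shift23_commute shift23_eq_shift2 by (simp add: shift2_0)
        qed
        ultimately show ?thesis by simp
      qed
    qed
    have "(shift13 ^^ K) ((shift23 ^^ K) f) m n (- 1)
        = (\<Sum>j<J. scale (C j) ((shift13 ^^ K) ((shift23 ^^ K) (g j)) (m + M - int j) (n + int j) (- 1)))"
    proof -
      have s23: "(shift23 ^^ K) f m n p = (\<Sum>j<J. scale (C j) ((shift23 ^^ K) (g j) (m + M - int j) (n + int j) p))"
        if "p \<ge> - 1" for m p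
      proof -
        have "(shift23 ^^ K) f m n p = (shift2 ^^ K) (\<lambda>n p. \<Sum>j<J. scale (C j) (g j (m + M - int j) (n + int j) p)) n p"
          unfolding shift23_eq_shift2 by (rule shift2_cong_ge[of n "- 1"]) (use fg that in auto)
        also have "\<dots> = (\<Sum>j<J. (shift2 ^^ K) (\<lambda>n p. scale (C j) (g j (m + M - int j) (n + int j) p)) n p)"
          by (rule shift2_sum)
        also have "\<dots> = (\<Sum>j<J. scale (C j) ((shift2 ^^ K) (\<lambda>n p. g j (m + M - int j) (n + int j) p) n p))"
          by (intro sum.cong refl shift2_linear[where S = UNIV]) (simp_all add: scale_right_diff_distrib)
        also have "\<dots> = (\<Sum>j<J. scale (C j) ((shift23 ^^ K) (g j) (m + M - int j) (n + int j) p))"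
          unfolding shift23_eq_shift2
          using shift2_translate[where K = K and h = "\<lambda>n p. g j (m + M - int j) n p" and i = "int j" and k = n and p = p for j]
          by (simp add: add.commute)
        finally show ?thesis .
      qed
      have "(shift13 ^^ K) ((shift23 ^^ K) f) m n (- 1)
          = (shift2 ^^ K) (\<lambda>m p. \<Sum>j<J. scale (C j) ((shift23 ^^ K) (g j) (m + M - int j) (n + int j) p)) m (- 1)"
        unfolding shift13_eq_shift2 by (rule shift2_cong_ge[of m "- 1"]) (use s23 in auto)
      also have "\<dots> = (\<Sum>j<J. (shift2 ^^ K) (\<lambda>m p. scale (C j) ((shift23 ^^ K) (g j) (m + M - int j) (n + int j) p)) m (- 1))"
        by (rule shift2_sum)
      also have "\<dots> = (\<Sum>j<J. scale (C j) ((shift2 ^^ K) (\<lambda>m p. (shift23 ^^ K) (g j) (m + M - int j) (n + int j) p) m (- 1)))"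
        by (intro sum.cong refl shift2_linear[where S = UNIV]) (simp_all add: scale_right_diff_distrib)
      also have "\<dots> = (\<Sum>j<J. scale (C j) ((shift13 ^^ K) ((shift23 ^^ K) (g j)) (m + M - int j) (n + int j) (- 1)))"
        unfolding shift13_eq_shift2
        using shift2_translate[where K = K and h = "\<lambda>m p. (shift23 ^^ K) (g j) m (n + int j) p" and i = "M - int j" and k = m and p = "-1" for j]
        by (simp add: algebra_simps)
      finally show ?thesis .
    qed
    then show ?thesis unfolding f_def v_def kill by simp
  qed
  define h where "h k p' = E k (nprod A d p' (vac A)) - scale (sa * sb) (nprod A d p' (E k (vac A)))" for k p'
  define fab where "fab a' b' = (\<lambda>m n p. local_sum a' b' M m n (nprod A d p (vac A))
      - scale (sa * sb) (nprod A d p (local_sum a' b' M m n (vac A))))" for a' b'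
  define u where "u k p = nprod A e k (nprod A d p (vac A)) - scale (sa * sb) (nprod A d p (nprod A e k (vac A)))" for k p
  define t where "t = s * (- 1) powi M"
  have hh: "h (m + n) p + u (m + n) p = fab a b m n p - scale t (fab b a n m p)" for m n p
  proof -
    have "h (m + n) p + u (m + n) p = local_comm s a b M (m + n) 0 (nprod A d p (vac A))
        - scale (sa * sb) (nprod A d p (local_comm s a b M (m + n) 0 (vac A)))"
      unfolding h_def E_def u_def
      by (simp add: nprod_diff_right local_comm_carrier nprod_carrier scale_right_diff_distrib)
    also have "\<dots> = local_comm s a b M m n (nprod A d p (vac A))
        - scale (sa * sb) (nprod A d p (local_comm s a b M m n (vac A)))"
      using diag[of "vac A" m n] diag[of "nprod A d p (vac A)" m n] by (simp add: nprod_carrier)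
    also have "\<dots> = fab a b m n p - scale t (fab b a n m p)"
      unfolding fab_def local_comm_def t_def[symmetric]
      by (simp add: nprod_carrier nprod_diff_right nprod_scale_right carrier_scale local_sum_carrier
        scale_right_diff_distrib mult_ac)
    finally show ?thesis .
  qed
  have z1: "(shift13 ^^ K) ((shift23 ^^ K) (fab a b)) m n (- 1) = 0" for m n
    unfolding fab_def by (rule half[where ?s1.0 = sa and ?s2.0 = sb]) (use Ka Kb in simp_all)
  have z2: "(shift13 ^^ K) ((shift23 ^^ K) (\<lambda>m n p. scale t (fab b a n m p))) m n (- 1) = 0" for m n
  proof -
    have z: "(shift13 ^^ K) ((shift23 ^^ K) (fab b a)) n m (- 1) = 0"
      unfolding fab_def by (rule half[where ?s1.0 = sb and ?s2.0 = sa]) (use Ka Kb in simp_all)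
    have e: "(shift23 ^^ K) (\<lambda>m n p. scale t (fab b a n m p)) = (\<lambda>m n p. scale t ((shift13 ^^ K) (fab b a) n m p))"
      unfolding fun_eq_iff shift23_eq_shift2 shift13_eq_shift2
      by (intro allI shift2_linear[where S = UNIV and T = "scale t"]) (simp_all add: scale_right_diff_distrib)
    have "(shift13 ^^ K) ((shift23 ^^ K) (\<lambda>m n p. scale t (fab b a n m p))) m n (- 1)
        = (shift2 ^^ K) (\<lambda>m p. scale t ((shift13 ^^ K) (fab b a) n m p)) m (- 1)"
      unfolding e by (rule shift13_eq_shift2)
    also have "\<dots> = scale t ((shift2 ^^ K) (\<lambda>m p. (shift13 ^^ K) (fab b a) n m p) m (- 1))"
      by (rule shift2_linear[where S = UNIV and T = "scale t"]) (simp_all add: scale_right_diff_distrib)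
    also have "\<dots> = scale t ((shift23 ^^ K) ((shift13 ^^ K) (fab b a)) n m (- 1))"
      by (rule arg_cong[where f = "scale t"], rule shift23_eq_shift2[symmetric])
    also have "\<dots> = scale t ((shift13 ^^ K) ((shift23 ^^ K) (fab b a)) n m (- 1))"
      unfolding shift13_shift23_commute ..
    finally show ?thesis unfolding z by simp
  qed
  have hz: "(shift2 ^^ (K + K)) h k (- 1) = 0" for k
  proof -
    have "(shift2 ^^ (K + K)) (\<lambda>k p. h k p + u k p) (k + 0) (- 1)
        = (shift13 ^^ K) ((shift23 ^^ K) (\<lambda>m n p. fab a b m n p - scale t (fab b a n m p))) k 0 (- 1)"
      by (rule shift2_diag[symmetric]) (simp only: hh)
    also have "\<dots> = (shift13 ^^ K) ((shift23 ^^ K) (fab a b)) k 0 (- 1)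
       - (shift13 ^^ K) ((shift23 ^^ K) (\<lambda>m n p. scale t (fab b a n m p))) k 0 (- 1)"
      by (simp only: shift23_diff shift13_diff)
    also have "\<dots> = 0" by (simp only: z1 z2) simp
    finally have "(shift2 ^^ (K + K)) h k (- 1) + (shift2 ^^ (K + K)) u k (- 1) = 0"
      by (simp only: shift2_add add_0_right)
    moreover have "(shift2 ^^ (K + K)) u k (- 1) = 0" unfolding u_def by (rule Ke) simp
    ultimately show ?thesis by simp
  qed
  have hE: "h k p = (if p = - 1 then E k d else 0)" if "p \<ge> - 1" for k p
    using that unfolding h_def Ev
    by (auto simp: nprod_vac_minus1 nprod_vac_nonneg E_def local_comm_def)
  have "E (m + n) d = h (m + n - int (K + K) + int (K + K)) (- 1)" by (simp add: hE)
  also have "\<dots> = 0" using shift2_boundary[of h "K + K" "m + n - int (K + K)"] hz hE by simp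
  finally show ?thesis using diag[of d m n] by (simp add: E_def e_def s_def)
qed

lemma local_comm_top:
  assumes a: "a \<in> grade A p" and b: "b \<in> grade A q" and c: "c \<in> va_carrier A"
    and loc: "va_local scale A (if p \<and> q then - 1 else 1) (M + 1) a b"
  shows "local_comm (if p \<and> q then - 1 else 1) a b M m n c = nprod A (nprod A a M b) (m + n) c"
proof -
  obtain y z where "y \<in> grade A False" "z \<in> grade A True" "c = y + z" using c by (rule carrier_cases)
  then show ?thesis
    using local_comm_top_homogeneous[OF a b _ loc]
    by (simp add: local_comm_add nprod_add_right nprod_carrier grade_carrier[OF a] grade_carrier[OF b] grade_carrier)
qed

text \<open>
  The vanishing of the products \<open>a\<^sub>(\<^sub>n\<^sub>)b\<close> for \<open>n \<ge> N\<close> lowers any known order of locality step by step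
  down to \<open>N\<close>.
\<close>
lemma local_of_nprod_zero:
  assumes a: "a \<in> grade A p" and b: "b \<in> grade A q" and z: "\<And>n. n \<ge> N \<Longrightarrow> nprod A a n b = 0"
  shows "va_local scale A (if p \<and> q then - 1 else 1) N a b"
proof -
  note car = grade_carrier[OF a] grade_carrier[OF b]
  obtain K where K: "va_local scale A (if p \<and> q then - 1 else 1) (int K) a b"
    using local_nat[OF a b] by blast
  have "va_local scale A (if p \<and> q then - 1 else 1) (max N (int K)) a b"
    using local_mono[OF car K] by simp
  moreover have "va_local scale A (if p \<and> q then - 1 else 1) i a b
      \<longrightarrow> va_local scale A (if p \<and> q then - 1 else 1) N a b" if "N \<le> i" for i
    using that
  proof (induction i rule: int_ge_induct)
    case (step i)
    have "va_local scale A (if p \<and> q then - 1 else 1) i a b"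
      if "va_local scale A (if p \<and> q then - 1 else 1) (i + 1) a b"
      unfolding local_iff_local_comm[OF car] using local_comm_top[OF a b _ that] z[OF step(1)] by simp
    with step show ?case by blast
  qed simp
  ultimately show ?thesis using max.cobounded1 by blast
qed

section \<open>Generators\<close>

inductive_set monomials :: "'a set \<Rightarrow> 'a set" for S where
  vac: "vac A \<in> monomials S"
| nprod: "x \<in> S \<Longrightarrow> y \<in> monomials S \<Longrightarrow> nprod A x n y \<in> monomials S"

lemma monomials_homogeneous:
  assumes "x \<in> monomials S" "\<And>a. a \<in> S \<Longrightarrow> \<exists>p. a \<in> grade A p"
  shows "\<exists>p. x \<in> grade A p"
  using assms(1) by induction (use assms(2) vac_even nprod_grade in blast)+

text \<open>
  A weak form of skew-symmetry: locality applied to the vacuum writes \<open>x\<^sub>(\<^sub>n\<^sub>)y\<close> as a combination of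
  products \<open>y\<^sub>(\<^sub>k\<^sub>)(D^i x)\<close>.
\<close>
lemma skew_mem:
  assumes x: "x \<in> grade A p" and y: "y \<in> grade A q" and W: "subspace W"
    and D: "\<And>w. w \<in> W \<Longrightarrow> va_D A w \<in> W" and m: "\<And>n. nprod A y n x \<in> W"
  shows "nprod A x n y \<in> W"
proof -
  note [simp] = grade_carrier[OF x] grade_carrier[OF y]
  have Dc: "(va_D A ^^ k) x \<in> va_carrier A" for k by (induction k) (simp_all add: D_carrier)
  have D1: "nprod A y n ((va_D A ^^ k) x) \<in> W" for n k
    by (induction k arbitrary: n)
      (use m D Dc in \<open>simp_all add: nprod_D subspace_add[OF W] subspace_scale[OF W]\<close>)
  have V: "nprod A y n (nprod A x k (vac A)) \<in> W" for n k
    by (cases "k \<ge> 0") (simp_all add: nprod_vac_nonneg nprod_vac_neg nprod_scale_right Dc D1 subspace_scale[OF W] subspace_0[OF W])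
  obtain K where K: "va_local scale A (if p \<and> q then - 1 else 1) (int K) x y"
    using local_nat[OF x y] by blast
  have "nprod A x n y = local_sum x y K (n - K) (- 1) (vac A)" by (simp add: local_sum_vac)
  also have "\<dots> = scale ((if p \<and> q then - 1 else 1) * (- 1) powi int K) (local_sum y x K (- 1) (n - K) (vac A))"
    using K by (simp add: local_iff_local_sum)
  also have "\<dots> \<in> W"
  proof -
    obtain J where "local_sum y x K (- 1) (n - K) (vac A) = (\<Sum>j<J. scale ((- 1) ^ j * (of_int K gchoose j))
        (nprod A y (- 1 + K - int j) (nprod A x (n - K + int j) (vac A))))"
      using eventually_happens'[OF _ eventually_local_sum[of y x "vac A" "n - K"]] by auto
    then show ?thesis by (simp add: subspace_scale[OF W] subspace_sum[OF W] V)
  qed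
  finally show ?thesis .
qed

text \<open>
  Closure under all products, without the associativity formula. If all \<open>x\<^sub>(\<^sub>n\<^sub>)y\<close> lie in the span, then so do, by skew-symmetry,
  all \<open>y\<^sub>(\<^sub>k\<^sub>)x\<close>; locality of \<open>y\<close> with a generator \<open>a\<close> gives \<open>y\<^sub>(\<^sub>k\<^sub>)(a\<^sub>(\<^sub>m\<^sub>)x)\<close> by downward induction
  on \<open>m\<close>, and skew-symmetry once more gives \<open>(a\<^sub>(\<^sub>m\<^sub>)x)\<^sub>(\<^sub>n\<^sub>)y\<close>.
\<close>
lemma generated_subset_span_monomials:
  assumes S: "\<And>a. a \<in> S \<Longrightarrow> \<exists>p. a \<in> grade A p"
  shows "va_generated scale A S \<subseteq> span (monomials S)"
proof -
  define W where "W = span (monomials S)"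
  have W: "subspace W" by (simp add: W_def)
  have MW: "x \<in> monomials S \<Longrightarrow> x \<in> W" for x by (simp add: W_def span_base)
  have Sc: "a \<in> S \<Longrightarrow> a \<in> va_carrier A" for a using S grade_carrier by blast
  have Mg: "x \<in> monomials S \<Longrightarrow> \<exists>p. x \<in> grade A p" for x using monomials_homogeneous S by blast
  have Mc: "x \<in> monomials S \<Longrightarrow> x \<in> va_carrier A" for x using Mg grade_carrier by blast
  have WC: "W \<subseteq> va_carrier A" unfolding W_def by (rule span_minimal) (use Mc subspace_carrier in auto)
  have SW: "nprod A a n w \<in> W" if a: "a \<in> S" and w: "w \<in> W" for a n w
  proof -
    have "w \<in> va_carrier A \<and> nprod A a n w \<in> W"
      using w unfolding W_def
    proof (induction rule: span_induct_alt)
      case base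
      then show ?case using Sc[OF a] by (simp add: span_zero)
    next
      case (step c x y)
      then show ?case using a Sc Mc
        by (simp add: nprod_add_right nprod_scale_right carrier_scale carrier_add span_add span_scale span_base monomials.nprod)
    qed
    then show ?thesis by blast
  qed
  have DM: "va_D A x \<in> W" if "x \<in> monomials S" for x
    using that
  proof induction
    case vac
    then show ?case by (simp add: subspace_0[OF W])
  next
    case (nprod x y n)
    then show ?case
      by (simp add: D_nprod' Sc Mc subspace_diff[OF W] subspace_scale[OF W] SW MW monomials.nprod)
  qed
  have DW: "va_D A w \<in> W" if w: "w \<in> W" for w
  proof -
    have "w \<in> va_carrier A \<and> va_D A w \<in> W"
      using w unfolding W_def
    proof (induction rule: span_induct_alt)
      case base
      then show ?case by (simp add: span_zero)
    next
      case (step c x y)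
      then show ?case using DM[of x] Mc
        by (simp add: D_add D_scale carrier_scale carrier_add span_add span_scale W_def)
    qed
    then show ?thesis by blast
  qed
  have MM: "\<forall>y\<in>monomials S. \<forall>n. nprod A x n y \<in> W" if "x \<in> monomials S" for x
    using that
  proof induction
    case vac
    then show ?case by (auto simp: vac_nprod Mc MW subspace_0[OF W])
  next
    case (nprod a x m)
    show ?case
    proof (intro ballI allI)
      fix y n assume y: "y \<in> monomials S"
      obtain p where p: "a \<in> grade A p" using S nprod by blast
      obtain r where r: "x \<in> grade A r" using Mg nprod by blast
      obtain q where q: "y \<in> grade A q" using Mg y by blast
      note [simp] = grade_carrier[OF p] grade_carrier[OF q] grade_carrier[OF r]
      have yx: "nprod A y k x \<in> W" for k
        by (rule skew_mem[OF q r W DW]) (use nprod y in auto)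
      obtain K where K: "va_local scale A (if q \<and> p then - 1 else 1) (int K) y a"
        using local_nat[OF q p] by blast
      have L: "local_sum y a (int K) k l x \<in> W" for k l
      proof -
        obtain J where "local_sum a y K l k x = (\<Sum>j<J. scale ((- 1) ^ j * (of_int K gchoose j))
            (nprod A a (l + K - int j) (nprod A y (k + int j) x)))"
          using eventually_happens'[OF _ eventually_local_sum[of a y x k]] by auto
        then have "local_sum a y K l k x \<in> W"
          using nprod(1) by (simp add: subspace_scale[OF W] subspace_sum[OF W] SW yx)
        then show ?thesis using K by (simp add: local_iff_local_sum subspace_scale[OF W])
      qed
      obtain n0 where n0: "\<forall>n\<ge>n0. nprod A a n x = 0" using nprod_bounded[of a x] by auto
      have Z: "\<forall>l. l \<ge> n0 - int i \<longrightarrow> (\<forall>k. nprod A y k (nprod A a l x) \<in> W)" for i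
      proof (induction i)
        case 0
        then show ?case using n0 by (simp add: subspace_0[OF W])
      next
        case (Suc i)
        show ?case
        proof (intro allI impI)
          fix l k :: int assume l: "n0 - int (Suc i) \<le> l"
          have "\<forall>\<^sub>F J in sequentially. local_sum y a K (k - K) l x = (\<Sum>j<J. scale ((- 1) ^ j * (of_int K gchoose j))
            (nprod A y (k - K + K - int j) (nprod A a (l + int j) x))) \<and> J \<ge> 1"
            by (rule eventually_conj[OF _ eventually_ge_at_top])
              (rule eventually_mono[OF eventually_local_sum[of y a x l]], auto)
          then obtain J where J: "local_sum y a K (k - K) l x = (\<Sum>j<J. scale ((- 1) ^ j * (of_int K gchoose j))
            (nprod A y (k - K + K - int j) (nprod A a (l + int j) x)))" "J \<ge> 1"
            using eventually_happens'[OF sequentially_bot] by blast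
          obtain J' where J': "J = Suc J'" using J(2) by (cases J) auto
          have "(\<Sum>j<J'. scale ((- 1) ^ Suc j * (of_int K gchoose Suc j))
            (nprod A y (k - K + K - int (Suc j)) (nprod A a (l + int (Suc j)) x))) \<in> W" (is "?R \<in> W")
            by (intro subspace_sum[OF W] subspace_scale[OF W]) (use Suc l in auto)
          moreover have "nprod A y k (nprod A a l x) = local_sum y a K (k - K) l x - ?R"
            unfolding J(1) J' sum.lessThan_Suc_shift by simp
          ultimately show "nprod A y k (nprod A a l x) \<in> W"
            using L subspace_diff[OF W] by simp
        qed
      qed
      have yk: "nprod A y k (nprod A a m x) \<in> W" for k
        using Z[of "nat (n0 - m)"] by simp
      show "nprod A (nprod A a m x) n y \<in> W"
        by (rule skew_mem[OF nprod_grade[OF p r] q W DW yk])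
    qed
  qed
  have MW2: "nprod A x n w \<in> W" if x: "x \<in> monomials S" and w: "w \<in> W" for x n w
  proof -
    have "w \<in> va_carrier A \<and> nprod A x n w \<in> W"
      using w unfolding W_def
    proof (induction rule: span_induct_alt)
      case base
      then show ?case using Mc[OF x] by (simp add: span_zero)
    next
      case (step c z y)
      then show ?case using x MM[OF x] Mc
        by (simp add: nprod_add_right nprod_scale_right carrier_scale carrier_add span_add span_scale W_def)
    qed
    then show ?thesis by blast
  qed
  have WW: "nprod A v n w \<in> W" if v: "v \<in> W" and w: "w \<in> W" for v n w
  proof -
    have wc: "w \<in> va_carrier A" using w WC by blast
    have "v \<in> va_carrier A \<and> nprod A v n w \<in> W"
      using v unfolding W_def
    proof (induction rule: span_induct_alt)
      case base
      then show ?case using wc by (simp add: span_zero)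
    next
      case (step c z y)
      then show ?case using wc MW2[OF _ w] Mc
        by (simp add: nprod_add_left nprod_scale_left carrier_scale carrier_add span_add span_scale W_def)
    qed
    then show ?thesis by blast
  qed
  have "a \<in> W" if "a \<in> S" for a
    using SW[OF that MW[OF monomials.vac], of "-1"] Sc[OF that] by (simp add: nprod_vac_minus1)
  then show ?thesis
    unfolding va_generated_def W_def[symmetric]
    using W WC MW[OF monomials.vac] WW by (intro Inter_lower) auto
qed

section \<open>Multiplication by powers of differences\<close>

text \<open>
  Let \<open>f t ys\<close> be the coefficient of a series at \<open>z^(-t-1) z\<^sub>1^s\<^sub>1 \<dots> z\<^sub>l^s\<^sub>l\<close>, where \<open>ys\<close> lists pairs
  of a letter \<open>b\<^sub>i\<close> and the exponent \<open>s\<^sub>i\<close>. The result is the coefficient of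
  \<open>\<Prod>\<^sub>i (1 - z\<^sub>i/z)^N(b\<^sub>i)\<close> times that series, provided that it contains no negative powers of the \<open>z\<^sub>i\<close>;
  the omitted powers \<open>z^N(b\<^sub>i)\<close> are accounted for by the initial value of \<open>t\<close> in \<open>reg_coeff\<close>.
\<close>
fun mul_factors :: "('l \<Rightarrow> int) \<Rightarrow> (int \<Rightarrow> ('l \<times> int) list \<Rightarrow> 'a) \<Rightarrow> int \<Rightarrow> ('l \<times> int) list \<Rightarrow> 'a" where
  "mul_factors N f t [] = f t []"
| "mul_factors N f t ((b, s) # xs) = (\<Sum>k<nat (s + 1). scale ((- 1) ^ k * (of_int (N b) gchoose k))
      (mul_factors N (\<lambda>t ys. f t ((b, s - int k) # ys)) (t - int k) xs))"

lemma mul_factors_cong: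
  assumes "\<And>t ys. map fst ys = map fst xs \<Longrightarrow> f t ys = g t ys"
  shows "mul_factors N f t xs = mul_factors N g t xs"
  using assms
proof (induction xs arbitrary: f g t)
  case (Cons x xs)
  obtain b s where x: "x = (b, s)" by (cases x)
  have "mul_factors N (\<lambda>t ys. f t ((b, s - int k) # ys)) t xs = mul_factors N (\<lambda>t ys. g t ((b, s - int k) # ys)) t xs" for k t
    by (rule Cons.IH) (use Cons.prems x in auto)
  then show ?case by (simp add: x)
qed simp

text \<open>
  Termination of \<open>reg_coeff\<close> depends on this: the argument \<open>f\<close> only sees lists of the given length.
\<close>
lemma mul_factors_cong_fundef [fundef_cong]:
  assumes "xs = xs'" "t = t'" "\<And>t ys. length ys = length xs' \<Longrightarrow> f t ys = g t ys"
  shows "mul_factors N f t xs = mul_factors N g t' xs'"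
  unfolding assms(1,2) by (rule mul_factors_cong) (metis assms(3) length_map)

lemma mul_factors_mem:
  assumes W: "subspace W"
    and "\<And>t' ys. map fst ys = map fst xs \<Longrightarrow> t' - sum_list (map snd ys) = t - sum_list (map snd xs) \<Longrightarrow> f t' ys \<in> W"
  shows "mul_factors N f t xs \<in> W"
  using assms(2)
proof (induction xs arbitrary: f t)
  case (Cons x xs)
  obtain b s where x: "x = (b, s)" by (cases x)
  have "mul_factors N (\<lambda>t ys. f t ((b, s - int k) # ys)) (t - int k) xs \<in> W" for k
    by (rule Cons.IH) (use Cons.prems x in auto)
  then show ?case by (simp add: x subspace_sum[OF W] subspace_scale[OF W])
qed simp

lemma mul_factors_neg:
  assumes "\<exists>x\<in>set xs. snd x < 0"
  shows "mul_factors N f t xs = 0"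
  using assms
proof (induction xs arbitrary: f t)
  case (Cons x xs)
  obtain b s where x: "x = (b, s)" by (cases x)
  show ?case by (cases "s < 0") (use Cons x in auto)
qed simp

end

lemma mul_factors_hom:
  assumes "vertex_algebra scale A" "vertex_algebra scale' A'"
    and T: "\<And>x y. x \<in> S \<Longrightarrow> y \<in> S \<Longrightarrow> T (x + y) = T x + T y" "\<And>r x. x \<in> S \<Longrightarrow> T (scale r x) = scale' r (T x)"
    and S: "module.subspace scale S" and f: "\<And>t ys. map fst ys = map fst xs \<Longrightarrow> f t ys \<in> S"
  shows "T (vertex_algebra.mul_factors scale N f t xs) = vertex_algebra.mul_factors scale' N (\<lambda>t ys. T (f t ys)) t xs"
proof -
  interpret A: vertex_algebra scale A by fact
  interpret A': vertex_algebra scale' A' by fact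
  show ?thesis using f
  proof (induction xs arbitrary: f t)
    case (Cons x xs)
    obtain b s where x: "x = (b, s)" by (cases x)
    have T0: "T 0 = 0" using T(2)[of 0 0] A.subspace_0[OF S] by simp
    have sum: "T (\<Sum>i\<in>I. g i) = (\<Sum>i\<in>I. T (g i))" if "\<And>i. g i \<in> S" for g and I :: "nat set"
      by (induction I rule: infinite_finite_induct) (simp_all add: T0 T(1) that A.subspace_sum[OF S])
    have IH: "T (A.mul_factors N (\<lambda>t ys. f t ((b, s - int k) # ys)) t xs) = A'.mul_factors N (\<lambda>t ys. T (f t ((b, s - int k) # ys))) t xs" for k t
      by (rule Cons.IH) (use Cons.prems x in simp)
    have m: "A.mul_factors N (\<lambda>t ys. f t ((b, s - int k) # ys)) t xs \<in> S" for k t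
      by (rule A.mul_factors_mem[OF S]) (use Cons.prems x in auto)
    show ?case by (simp add: x sum T(2) m IH A.subspace_scale[OF S])
  qed simp
qed

context vertex_algebra
begin

lemmas mul_factors_linear = mul_factors_hom[OF vertex_algebra_axioms vertex_algebra_axioms]

lemma mul_factors_scale: "mul_factors N (\<lambda>t ys. scale r (f t ys)) t xs = scale r (mul_factors N f t xs)"
  by (rule mul_factors_linear[of UNIV "scale r", symmetric]) (simp_all add: scale_right_distrib)

lemma mul_factors_add: "mul_factors N (\<lambda>t ys. f t ys + g t ys) t xs = mul_factors N f t xs + mul_factors N g t xs"
  by (induction xs arbitrary: f g t) (auto simp: scale_right_distrib sum.distrib)

lemma mul_factors_0: "mul_factors N (\<lambda>t ys. 0) t xs = 0"
  by (induction xs arbitrary: t) auto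

lemma mul_factors_sum: "mul_factors N (\<lambda>t ys. \<Sum>i\<in>I. f i t ys) t xs = (\<Sum>i\<in>I. mul_factors N (f i) t xs)"
  by (induction I rule: infinite_finite_induct) (simp_all add: mul_factors_0 mul_factors_add)

lemma mul_factors_translate: "mul_factors N f (t + d) xs = mul_factors N (\<lambda>t. f (t + d)) t xs"
proof (induction xs arbitrary: f t)
  case (Cons x xs)
  obtain b s where x: "x = (b, s)" by (cases x)
  have "t + d - int k = (t - int k) + d" for k by simp
  then show ?case unfolding x mul_factors.simps by (simp only: Cons.IH)
qed simp

lemma mul_factors_swap_adjacent:
  assumes "\<And>t us' c' d' vs'. map fst us' = map fst us \<Longrightarrow> fst c' = fst c \<Longrightarrow> fst d' = fst d \<Longrightarrow> map fst vs' = map fst vs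
      \<Longrightarrow> f t (us' @ c' # d' # vs') = g t (us' @ d' # c' # vs')"
  shows "mul_factors N f t (us @ c # d # vs) = mul_factors N g t (us @ d # c # vs)"
  using assms
proof (induction us arbitrary: f g t)
  case Nil
  obtain a r where c: "c = (a, r)" by (cases c)
  obtain b s where d: "d = (b, s)" by (cases d)
  have e: "mul_factors N (\<lambda>t ys. f t ((a, i) # (b, j) # ys)) t vs = mul_factors N (\<lambda>t ys. g t ((b, j) # (a, i) # ys)) t vs" for i j t
    by (rule mul_factors_cong) (use Nil[of "[]"] c d in auto)
  have "mul_factors N f t ([] @ c # d # vs) = (\<Sum>k<nat (r + 1). \<Sum>l<nat (s + 1).
      scale ((- 1) ^ k * (of_int (N a) gchoose k) * ((- 1) ^ l * (of_int (N b) gchoose l)))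
      (mul_factors N (\<lambda>t ys. g t ((b, s - int l) # (a, r - int k) # ys)) (t - int k - int l) vs))"
    by (simp add: c d e scale_sum_right)
  also have "\<dots> = (\<Sum>l<nat (s + 1). \<Sum>k<nat (r + 1).
      scale ((- 1) ^ l * (of_int (N b) gchoose l) * ((- 1) ^ k * (of_int (N a) gchoose k)))
      (mul_factors N (\<lambda>t ys. g t ((b, s - int l) # (a, r - int k) # ys)) (t - int l - int k) vs))"
    by (subst sum.swap) (simp only: mult_ac diff_diff_eq add.commute)
  also have "\<dots> = mul_factors N g t ([] @ d # c # vs)"
    by (simp add: c d scale_sum_right)
  finally show ?case .
next
  case (Cons u us)
  obtain b s where u: "u = (b, s)" by (cases u)
  have "mul_factors N (\<lambda>t ys. f t ((b, i) # ys)) t (us @ c # d # vs) = mul_factors N (\<lambda>t ys. g t ((b, i) # ys)) t (us @ d # c # vs)" for i t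
    by (rule Cons.IH) (use Cons.prems[of "(b, i) # us'" for us'] u in simp)
  then show ?case by (simp add: u)
qed

text \<open>
  Both sides expand the same product of factors; the triangular double sum over the exponents taken
  from one variable is symmetric.
\<close>
lemma mul_factors_commute:
  "mul_factors N (\<lambda>t ys. mul_factors N' (h t) t' ys) t xs = mul_factors N' (\<lambda>t' ys. mul_factors N (\<lambda>t. h t t') t ys) t' xs"
proof (induction xs arbitrary: h t t')
  case (Cons x xs)
  obtain b s where x: "x = (b, s)" by (cases x)
  define C C' :: "nat \<Rightarrow> 'k" where "C k = (- 1) ^ k * (of_int (N b) gchoose k)" and "C' k = (- 1) ^ k * (of_int (N' b) gchoose k)" for k
  define P where "P k k' = mul_factors N (\<lambda>t ys. mul_factors N' (\<lambda>t' zs. h t t' ((b, s - int k - int k') # zs)) (t' - int k') ys) (t - int k) xs" for k k'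
  have "mul_factors N (\<lambda>t ys. mul_factors N' (h t) t' ys) t (x # xs)
     = (\<Sum>k<nat (s + 1). \<Sum>k'<nat (s - int k + 1). scale (C k * C' k') (P k k'))"
    by (simp add: x mul_factors_sum mul_factors_scale scale_sum_right C_def C'_def P_def)
  also have "\<dots> = (\<Sum>(k, k')\<in>(SIGMA k:{..<nat (s + 1)}. {..<nat (s - int k + 1)}). scale (C k * C' k') (P k k'))"
    by (rule sum.Sigma) auto
  also have "\<dots> = (\<Sum>(k', k)\<in>(SIGMA k':{..<nat (s + 1)}. {..<nat (s - int k' + 1)}). scale (C k * C' k') (P k k'))"
    by (rule sum.reindex_bij_witness[where i = prod.swap and j = prod.swap]) auto
  also have "\<dots> = (\<Sum>k'<nat (s + 1). \<Sum>k<nat (s - int k' + 1). scale (C k * C' k') (P k k'))"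
    by (rule sum.Sigma[symmetric]) auto
  also have "\<dots> = mul_factors N' (\<lambda>t' ys. mul_factors N (\<lambda>t. h t t') t ys) t' (x # xs)"
  proof -
    have sw: "s - int k - int k' = s - int k' - int k" for k k' by simp
    have "P k k' = mul_factors N' (\<lambda>t' ys. mul_factors N (\<lambda>t zs. h t t' ((b, s - int k' - int k) # zs)) (t - int k) ys) (t' - int k') xs" for k k'
      unfolding P_def sw by (rule Cons.IH)
    then show ?thesis
      by (simp add: x mul_factors_sum mul_factors_scale scale_sum_right C_def C'_def mult_ac)
  qed
  finally show ?case .
qed simp

lemma mul_factors_eventually_cong:
  assumes "\<And>t ys. map fst ys = map fst xs \<Longrightarrow> \<forall>\<^sub>F K in sequentially. f K t ys = g t ys"
  shows "\<forall>\<^sub>F K in sequentially. mul_factors N (f K) t xs = mul_factors N g t xs"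
  using assms
proof (induction xs arbitrary: f g t)
  case (Cons x xs)
  obtain b s where x: "x = (b, s)" by (cases x)
  have "\<forall>\<^sub>F K in sequentially. \<forall>k\<in>{..<nat (s + 1)}. mul_factors N (\<lambda>t ys. f K t ((b, s - int k) # ys)) (t - int k) xs
      = mul_factors N (\<lambda>t ys. g t ((b, s - int k) # ys)) (t - int k) xs"
    by (intro eventually_ball_finite ballI finite_lessThan Cons.IH) (use Cons.prems x in auto)
  then show ?case by (rule eventually_mono) (simp add: x)
qed simp

text \<open>
  All further terms of the expansion lower the exponents of the \<open>z\<^sub>i\<close>; this drives the induction
  which inverts the multiplication.
\<close>
lemma mul_factors_lead:
  assumes W: "subspace W" and "\<forall>x\<in>set xs. snd x \<ge> 0"
    and "\<And>t' ys. map fst ys = map fst xs \<Longrightarrow> sum_list (map snd ys) < sum_list (map snd xs) \<Longrightarrow> \<forall>x\<in>set ys. snd x \<ge> 0 \<Longrightarrow> f t' ys \<in> W"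
  shows "mul_factors N f t xs - f t xs \<in> W"
proof -
  have mem: "mul_factors N f t xs \<in> W"
    if "\<And>t' ys. map fst ys = map fst xs \<Longrightarrow> sum_list (map snd ys) \<le> sum_list (map snd xs) \<Longrightarrow> \<forall>x\<in>set ys. snd x \<ge> 0 \<Longrightarrow> f t' ys \<in> W"
    for f t xs
    using that
  proof (induction xs arbitrary: f t)
    case (Cons x xs)
    obtain b s where x: "x = (b, s)" by (cases x)
    have "mul_factors N (\<lambda>t ys. f t ((b, s - int k) # ys)) t xs \<in> W" if "k < nat (s + 1)" for k t
      by (rule Cons.IH) (use Cons.prems x that in auto)
    then show ?case by (auto simp add: x intro!: subspace_sum[OF W] subspace_scale[OF W])
  qed simp
  show ?thesis using assms(2,3)
  proof (induction xs arbitrary: f t)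
    case Nil
    then show ?case by (simp add: subspace_0[OF W])
  next
    case (Cons x xs)
    obtain b s where x: "x = (b, s)" by (cases x)
    have s: "s \<ge> 0" using Cons.prems x by simp
    then have n: "nat (s + 1) = Suc (nat s)" by simp
    define R where "R = (\<Sum>k<nat s. scale ((- 1) ^ Suc k * (of_int (N b) gchoose Suc k))
      (mul_factors N (\<lambda>t ys. f t ((b, s - int (Suc k)) # ys)) (t - int (Suc k)) xs))"
    have "R \<in> W" unfolding R_def
      by (intro subspace_sum[OF W] subspace_scale[OF W] mem) (use Cons.prems x in auto)
    moreover have "mul_factors N (\<lambda>t ys. f t ((b, s) # ys)) t xs - f t ((b, s) # xs) \<in> W"
      by (rule Cons.IH) (use Cons.prems x s in auto)
    moreover have "mul_factors N f t (x # xs) - f t (x # xs) = (mul_factors N (\<lambda>t ys. f t ((b, s) # ys)) t xs - f t ((b, s) # xs)) + R"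
      unfolding x mul_factors.simps n sum.lessThan_Suc_shift R_def by simp
    ultimately show ?case using subspace_add[OF W] by simp
  qed
qed

text \<open>
  Shifting an exponent commutes with the multiplication. The hypothesis compensates for the
  range of summation, which depends on that exponent.
\<close>
lemma mul_factors_decrement:
  assumes "i < length xs" "n \<ge> 0"
    and "\<And>t ys. map fst ys = map fst xs \<Longrightarrow> snd (ys ! i) < 0 \<Longrightarrow> f t ys = 0"
  shows "mul_factors N (\<lambda>t ys. f t (ys[i := apsnd (\<lambda>s. s - n) (ys ! i)])) t xs
    = mul_factors N f t (xs[i := apsnd (\<lambda>s. s - n) (xs ! i)])"
  using assms(1,3)
proof (induction xs arbitrary: f t i)
  case (Cons x xs)
  obtain b s where x: "x = (b, s)" by (cases x)
  show ?case
  proof (cases i)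
    case 0
    have z: "mul_factors N (\<lambda>t ys. f t ((b, s - n - int k) # ys)) (t - int k) xs = 0" if "s - n - int k < 0" for k
    proof -
      have "mul_factors N (\<lambda>t ys. f t ((b, s - n - int k) # ys)) (t - int k) xs = mul_factors N (\<lambda>t ys. 0) (t - int k) xs"
        by (rule mul_factors_cong) (use Cons.prems x 0 that in auto)
      then show ?thesis by (simp add: mul_factors_0)
    qed
    have "s - int k - n = s - n - int k" for k by simp
    then have "mul_factors N (\<lambda>t ys. f t (ys[i := apsnd (\<lambda>s. s - n) (ys ! i)])) t (x # xs)
       = (\<Sum>k<nat (s + 1). scale ((- 1) ^ k * (of_int (N b) gchoose k))
      (mul_factors N (\<lambda>t ys. f t ((b, s - n - int k) # ys)) (t - int k) xs))"
      by (simp only: x 0 mul_factors.simps nth_Cons_0 list_update_code apsnd_conv)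
    also have "\<dots> = (\<Sum>k<nat (s - n + 1). scale ((- 1) ^ k * (of_int (N b) gchoose k))
      (mul_factors N (\<lambda>t ys. f t ((b, s - n - int k) # ys)) (t - int k) xs))"
      by (rule sum.mono_neutral_right) (use assms(2) z in auto)
    finally show ?thesis by (simp add: x 0)
  next
    case (Suc j)
    have "mul_factors N (\<lambda>t ys. f t ((b, r) # ys[j := apsnd (\<lambda>s. s - n) (ys ! j)])) t xs
      = mul_factors N (\<lambda>t ys. f t ((b, r) # ys)) t (xs[j := apsnd (\<lambda>s. s - n) (xs ! j)])" for r t
      by (rule Cons.IH[of j "\<lambda>t ys. f t ((b, r) # ys)"]) (use Cons.prems x Suc in auto)
    then show ?thesis by (simp add: x Suc)
  qed
qed simp

section \<open>The regularised series\<close>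

text \<open>
  The coefficient at \<open>\<Prod> z\<^sub>i^r\<^sub>i\<close> of
  \<open>\<Prod>\<^sub>i\<^sub><\<^sub>j (z\<^sub>i - z\<^sub>j)^N(a\<^sub>i,a\<^sub>j) Y(a\<^sub>1)(z\<^sub>1) \<dots> Y(a\<^sub>l)(z\<^sub>l) 1\<close>, expanded in
  \<open>|z\<^sub>1| > |z\<^sub>2| > \<dots>\<close>. The first variable is regularised against the regularised
  series of the others, and the mode of \<open>Y(a\<^sub>1)\<close> is found by comparing the exponents of \<open>z\<^sub>1\<close>.
\<close>
fun reg_coeff :: "('l \<Rightarrow> 'l \<Rightarrow> int) \<Rightarrow> ('l \<Rightarrow> 'a) \<Rightarrow> ('l \<times> int) list \<Rightarrow> 'a" where
  "reg_coeff N X [] = vac A"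
| "reg_coeff N X ((a, r) # xs) =
     mul_factors (N a) (\<lambda>t ys. nprod A (X a) t (reg_coeff N X ys)) ((\<Sum>b\<leftarrow>map fst xs. N a b) - r - 1) xs"

end

locale local_family = vertex_algebra scale A
  for scale :: "'k::field_char_0 \<Rightarrow> 'a::ab_group_add \<Rightarrow> 'a" and A +
  fixes L :: "'l set" and N :: "'l \<Rightarrow> 'l \<Rightarrow> int" and X :: "'l \<Rightarrow> 'a"
  assumes admissible: "va_admissible A L N X"
    and N_sym: "a \<in> L \<Longrightarrow> b \<in> L \<Longrightarrow> N a b = N b a"
begin

abbreviation "R \<equiv> reg_coeff N X"

lemma X_grade: "a \<in> L \<Longrightarrow> X a \<in> grade A (odd (N a a))"
  using admissible by (simp add: va_admissible_def)

lemma X_carrier: "a \<in> L \<Longrightarrow> X a \<in> va_carrier A"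
  using X_grade grade_carrier by blast

lemma R_carrier: "fst ` set xs \<subseteq> L \<Longrightarrow> R xs \<in> va_carrier A"
proof (induction "length xs" arbitrary: xs)
  case (Suc n)
  then obtain a r ys where xs: "xs = (a, r) # ys" by (cases xs) auto
  have "R zs \<in> va_carrier A" if "map fst zs = map fst ys" for zs
  proof (rule Suc.hyps(1))
    show "n = length zs" using Suc.hyps(2) xs map_eq_imp_length_eq[OF that] by simp
    show "fst ` set zs \<subseteq> L" using Suc.prems arg_cong[OF that, of set] xs by simp
  qed
  then show ?case unfolding xs reg_coeff.simps
    by (intro mul_factors_mem[OF subspace_carrier] nprod_carrier X_carrier) (use Suc.prems xs in auto)
qed simp

definition swap_sign :: "'l \<Rightarrow> 'l \<Rightarrow> 'k" where
  "swap_sign a b = (if odd (N a a) \<and> odd (N b b) then - 1 else 1) * (- 1) powi N a b"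

lemma swap_sign_values: "swap_sign a b \<in> {1, - 1}"
proof -
  have "(- 1 :: 'k) powi N a b \<in> {1, - 1}" by (simp add: power_int_minus_left)
  then show ?thesis by (auto simp: swap_sign_def)
qed

lemma local_sum_swap:
  assumes "a \<in> L" "b \<in> L" "c \<in> va_carrier A"
  shows "local_sum (X a) (X b) (N a b) m n c = scale (swap_sign a b) (local_sum (X b) (X a) (N a b) n m c)"
proof -
  have "va_local scale A (if odd (N a a) \<and> odd (N b b) then - 1 else 1) (N a b) (X a) (X b)"
    by (rule local_of_nprod_zero[OF X_grade X_grade])
      (use assms admissible in \<open>auto simp: va_admissible_def\<close>)
  then show ?thesis
    using local_iff_local_sum[OF X_carrier X_carrier] assms unfolding swap_sign_def by blast
qed

text \<open>
  The regularised series for two letters and a word, with the factors \<open>z\<^sub>1 - z\<^sub>i\<close>, \<open>z\<^sub>2 - z\<^sub>i\<close> pulled to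
  the front. The two fields then enter only through the locality sum, so that
  the effect of exchanging the letters is visible.
\<close>
definition reg_two :: "'l \<Rightarrow> 'l \<Rightarrow> int \<Rightarrow> int \<Rightarrow> ('l \<times> int) list \<Rightarrow> 'a" where
  "reg_two a b r s xs = mul_factors (N a) (\<lambda>t ys. mul_factors (N b) (\<lambda>t' zs. local_sum (X a) (X b) (N a b) t t' (R zs))
      ((\<Sum>c\<leftarrow>map fst xs. N b c) - s - 1) ys) ((\<Sum>c\<leftarrow>map fst xs. N a c) - r - 1) xs"

lemma reg_two_swap:
  assumes "a \<in> L" "b \<in> L" "fst ` set xs \<subseteq> L"
  shows "reg_two a b r s xs = scale (swap_sign a b) (reg_two b a s r xs)"
proof -
  have "reg_two a b r s xs = mul_factors (N a) (\<lambda>t ys. mul_factors (N b) (\<lambda>t' zs. scale (swap_sign a b) (local_sum (X b) (X a) (N b a) t' t (R zs)))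
      ((\<Sum>c\<leftarrow>map fst xs. N b c) - s - 1) ys) ((\<Sum>c\<leftarrow>map fst xs. N a c) - r - 1) xs"
    unfolding reg_two_def
  proof (intro mul_factors_cong)
    fix t t' :: int and ys zs :: "('l \<times> int) list" assume "map fst ys = map fst xs" "map fst zs = map fst ys"
    then have "fst ` set zs \<subseteq> L" using assms(3) by (metis set_map)
    then show "local_sum (X a) (X b) (N a b) t t' (R zs) = scale (swap_sign a b) (local_sum (X b) (X a) (N b a) t' t (R zs))"
      using local_sum_swap[OF assms(1,2) R_carrier] N_sym[OF assms(1,2)] by simp
  qed
  also have "\<dots> = scale (swap_sign a b) (reg_two b a s r xs)"
    unfolding reg_two_def mul_factors_scale by (subst mul_factors_commute) (rule refl)
  finally show ?thesis .
qed

text \<open>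
  The factor \<open>(z\<^sub>1 - z\<^sub>2)^N\<close> is expanded up to the exponent of \<open>z\<^sub>2\<close> on the left and without bound in
  the locality sum; the additional terms vanish by the regularity hypothesis \<open>neg\<close>.
\<close>
lemma R_eq_reg_two:
  assumes a: "a \<in> L" and b: "b \<in> L" and xs: "fst ` set xs \<subseteq> L"
    and neg: "\<And>ys. map fst ys = b # map fst xs \<Longrightarrow> \<exists>y\<in>set ys. snd y < 0 \<Longrightarrow> R ys = 0"
  shows "R ((a, r) # (b, s) # xs) = reg_two a b r s xs"
proof -
  define C :: "nat \<Rightarrow> 'k" where "C k = (- 1) ^ k * (of_int (N a b) gchoose k)" for k
  define m where "m = (\<Sum>c\<leftarrow>map fst xs. N a c) - r - 1"
  define n where "n = (\<Sum>c\<leftarrow>map fst xs. N b c) - s - 1"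
  define f where "f K t ys = mul_factors (N b) (\<lambda>t' zs. \<Sum>k<K. scale (C k)
      (nprod A (X a) (t + N a b - int k) (nprod A (X b) (t' + int k) (R zs)))) n ys" for K t ys
  have eq: "R ((a, r) # (b, s) # xs) = mul_factors (N a) (f K) m xs" if K: "nat (s + 1) \<le> K" for K
  proof -
    define G where "G k = mul_factors (N a) (\<lambda>t ys. nprod A (X a) t (R ((b, s - int k) # ys))) (m + (N a b - int k)) xs" for k
    have z: "G k = 0" if "k \<in> {..<K} - {..<nat (s + 1)}" for k
    proof -
      have "G k = mul_factors (N a) (\<lambda>t ys. 0) (m + (N a b - int k)) xs"
        unfolding G_def
      proof (rule mul_factors_cong)
        fix t :: int and ys :: "('l \<times> int) list" assume "map fst ys = map fst xs"
        then have "R ((b, s - int k) # ys) = 0" by (intro neg) (use that in auto)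
        then show "nprod A (X a) t (R ((b, s - int k) # ys)) = 0" using X_carrier[OF a] by simp
      qed
      then show ?thesis by (simp add: mul_factors_0)
    qed
    have G: "G k = mul_factors (N a) (\<lambda>t ys. mul_factors (N b) (\<lambda>t' zs. nprod A (X a) (t + N a b - int k) (nprod A (X b) (t' + int k) (R zs))) n ys) m xs" for k
      unfolding G_def mul_factors_translate
    proof (rule mul_factors_cong)
      fix t :: int and ys :: "('l \<times> int) list" assume ys: "map fst ys = map fst xs"
      have n: "(\<Sum>c\<leftarrow>map fst ys. N b c) - (s - int k) - 1 = n + int k"
        unfolding ys n_def by simp
      have "nprod A (X a) (t + (N a b - int k)) (R ((b, s - int k) # ys))
        = mul_factors (N b) (\<lambda>t' zs. nprod A (X a) (t + (N a b - int k)) (nprod A (X b) t' (R zs))) (n + int k) ys"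
        unfolding reg_coeff.simps n
      proof (rule mul_factors_linear[where S = "va_carrier A"])
        fix t' :: int and zs :: "('l \<times> int) list" assume "map fst zs = map fst ys"
        then have "fst ` set zs \<subseteq> L" using ys xs by (metis set_map)
        then show "nprod A (X b) t' (R zs) \<in> va_carrier A"
          by (intro nprod_carrier R_carrier X_carrier b)
      qed (simp_all add: nprod_add_right nprod_scale_right X_carrier a subspace_carrier)
      then show "nprod A (X a) (t + (N a b - int k)) (R ((b, s - int k) # ys))
        = mul_factors (N b) (\<lambda>t' zs. nprod A (X a) (t + N a b - int k) (nprod A (X b) (t' + int k) (R zs))) n ys"
        unfolding mul_factors_translate by (simp add: add_diff_eq)
    qed
    have "R ((a, r) # (b, s) # xs) = (\<Sum>k<nat (s + 1). scale (C k) (G k))"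
      unfolding C_def G_def m_def by (simp add: algebra_simps)
    also have "\<dots> = (\<Sum>k<K. scale (C k) (G k))"
      by (rule sum.mono_neutral_left) (use z K in auto)
    also have "\<dots> = mul_factors (N a) (f K) m xs"
      unfolding f_def G mul_factors_sum mul_factors_scale ..
    finally show ?thesis .
  qed
  have "\<forall>\<^sub>F K in sequentially. mul_factors (N a) (f K) m xs
      = mul_factors (N a) (\<lambda>t ys. mul_factors (N b) (\<lambda>t' zs. local_sum (X a) (X b) (N a b) t t' (R zs)) n ys) m xs"
    unfolding f_def
  proof (intro mul_factors_eventually_cong)
    fix t t' :: int and ys zs :: "('l \<times> int) list" assume "map fst ys = map fst xs" "map fst zs = map fst ys"
    then have "fst ` set zs \<subseteq> L" using xs by (metis set_map)
    from eventually_local_sum[OF X_carrier[OF a] X_carrier[OF b] R_carrier[OF this], of t']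
    show "\<forall>\<^sub>F K in sequentially. (\<Sum>k<K. scale (C k) (nprod A (X a) (t + N a b - int k) (nprod A (X b) (t' + int k) (R zs))))
        = local_sum (X a) (X b) (N a b) t t' (R zs)"
      by (rule eventually_mono) (simp add: C_def)
  qed
  then have "\<forall>\<^sub>F K in sequentially. R ((a, r) # (b, s) # xs) = reg_two a b r s xs"
    using eventually_ge_at_top[of "nat (s + 1)"]
    by eventually_elim (simp only: eq reg_two_def m_def n_def)
  then show ?thesis by simp
qed

lemma R_swap_aux:
  assumes "a \<in> L" "b \<in> L" "fst ` set xs \<subseteq> L"
    and "\<And>c ys. c \<in> L \<Longrightarrow> map fst ys = c # map fst xs \<Longrightarrow> \<exists>y\<in>set ys. snd y < 0 \<Longrightarrow> R ys = 0"
  shows "R ((a, r) # (b, s) # xs) = scale (swap_sign a b) (R ((b, s) # (a, r) # xs))"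
  using R_eq_reg_two[OF assms(1-3)] R_eq_reg_two[OF assms(2,1,3)] reg_two_swap[OF assms(1-3)] assms by simp

text \<open>
  Regularity in every variable but the first is built into \<open>mul_factors\<close>. A negative exponent of the
  first variable is moved to the second place by a swap, which needs regularity of shorter words only.
\<close>
lemma R_neg:
  assumes "fst ` set xs \<subseteq> L" "\<exists>x\<in>set xs. snd x < 0"
  shows "R xs = 0"
  using assms
proof (induction "length xs" arbitrary: xs rule: less_induct)
  case less
  then obtain a r ys where xs: "xs = (a, r) # ys" by (cases xs) auto
  show ?case
  proof (cases "\<exists>y\<in>set ys. snd y < 0")
    case True
    then show ?thesis by (simp add: xs mul_factors_neg)
  next
    case False
    then have r: "r < 0" using less.prems xs by auto
    show ?thesis
    proof (cases ys)
      case Nil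
      then show ?thesis using r less.prems xs by (simp add: X_carrier nprod_vac_nonneg)
    next
      case (Cons y zs)
      obtain b s where y: "y = (b, s)" by (cases y)
      have L: "a \<in> L" "b \<in> L" "fst ` set zs \<subseteq> L" using less.prems xs Cons y by auto
      have "R xs = scale (swap_sign a b) (R ((b, s) # (a, r) # zs))"
        unfolding xs Cons y
      proof (rule R_swap_aux[OF L])
        fix c :: 'l and us :: "('l \<times> int) list" assume c: "c \<in> L" and us: "map fst us = c # map fst zs" and n: "\<exists>y\<in>set us. snd y < 0"
        have "length us < length xs" using xs Cons arg_cong[OF us, of length] by simp
        moreover have "fst ` set us \<subseteq> L" using arg_cong[OF us, of set] c L by simp
        ultimately show "R us = 0" using less.hyps n by blast
      qed
      also have "R ((b, s) # (a, r) # zs) = 0"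
        using r by (simp only: reg_coeff.simps) (rule mul_factors_neg, simp)
      finally show ?thesis by simp
    qed
  qed
qed

lemma R_swap:
  assumes "fst ` set (us @ x # y # vs) \<subseteq> L"
  shows "R (us @ x # y # vs) = scale (swap_sign (fst x) (fst y)) (R (us @ y # x # vs))"
  using assms
proof (induction "length us" arbitrary: us x y vs)
  case 0
  obtain a r b s where xy: "x = (a, r)" "y = (b, s)" by (cases x, cases y)
  have "R ((a, r) # (b, s) # vs) = scale (swap_sign a b) (R ((b, s) # (a, r) # vs))"
  proof (rule R_swap_aux)
    fix c :: 'l and ys :: "('l \<times> int) list" assume "c \<in> L" and ys: "map fst ys = c # map fst vs" and "\<exists>y\<in>set ys. snd y < 0"
    moreover have "fst ` set ys \<subseteq> L" using arg_cong[OF ys, of set] \<open>c \<in> L\<close> 0(2) by auto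
    ultimately show "R ys = 0" by (intro R_neg)
  qed (use 0 xy in auto)
  then show ?case using 0 xy by simp
next
  case (Suc n)
  then obtain a r ws where us: "us = (a, r) # ws" by (cases us) auto
  let ?s = "swap_sign (fst x) (fst y)"
  have "mul_factors (N a) (\<lambda>t ys. nprod A (X a) t (R ys)) t (ws @ x # y # vs)
      = mul_factors (N a) (\<lambda>t ys. scale ?s (nprod A (X a) t (R ys))) t (ws @ y # x # vs)" for t
  proof (rule mul_factors_swap_adjacent)
    fix t :: int and ws' vs' :: "('l \<times> int) list" and x' y' :: "'l \<times> int" assume e: "map fst ws' = map fst ws" "fst x' = fst x" "fst y' = fst y" "map fst vs' = map fst vs"
    have L: "fst ` set (ws' @ x' # y' # vs') \<subseteq> L"
      using Suc.prems us e(2,3) arg_cong[OF e(1), of set] arg_cong[OF e(4), of set]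
      by (simp add: image_Un)
    then have L': "fst ` set (ws' @ y' # x' # vs') \<subseteq> L" by auto
    have "R (ws' @ x' # y' # vs') = scale ?s (R (ws' @ y' # x' # vs'))"
      using Suc.hyps(1)[OF _ L] Suc.hyps(2) us e map_eq_imp_length_eq[OF e(1)] by simp
    then show "nprod A (X a) t (R (ws' @ x' # y' # vs')) = scale ?s (nprod A (X a) t (R (ws' @ y' # x' # vs')))"
      using Suc.prems us R_carrier[OF L'] by (simp add: nprod_scale_right X_carrier)
  qed
  then show ?case unfolding us by (simp add: mul_factors_scale add.left_commute)
qed

lemma R_move:
  assumes "fst ` set (us @ x # ws @ vs) \<subseteq> L"
  shows "\<exists>e\<in>{1, - 1}. R (us @ x # ws @ vs) = scale e (R (us @ ws @ x # vs))"
  using assms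
proof (induction ws arbitrary: us)
  case (Cons w ws)
  obtain e where e: "e \<in> {1, - 1}" "R ((us @ [w]) @ x # ws @ vs) = scale e (R ((us @ [w]) @ ws @ x # vs))"
  proof -
    have "fst ` set ((us @ [w]) @ x # ws @ vs) \<subseteq> L" using Cons.prems by auto
    from Cons.IH[OF this] show thesis using that by blast
  qed
  have "R (us @ x # (w # ws) @ vs) = scale (swap_sign (fst x) (fst w)) (R (us @ w # x # ws @ vs))"
    using R_swap[of us x w "ws @ vs"] Cons.prems by simp
  then have "R (us @ x # (w # ws) @ vs) = scale (swap_sign (fst x) (fst w) * e) (R (us @ (w # ws) @ x # vs))"
    using e(2) by simp
  moreover have "swap_sign (fst x) (fst w) * e \<in> {1, - 1}"
    using swap_sign_values[of "fst x" "fst w"] e(1) by auto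
  ultimately show ?case by blast
qed simp

lemma R_perm:
  assumes "mset xs = mset ys" "fst ` set xs \<subseteq> L"
  shows "\<exists>e\<in>{1, - 1}. R xs = scale e (R ys)"
proof -
  have "\<exists>e\<in>{1, - 1}. R (us @ xs) = scale e (R (us @ ys))" if "fst ` set us \<subseteq> L" for us
    using assms that
  proof (induction xs arbitrary: ys us)
    case (Cons x xs)
    have "x \<in> set ys" using Cons.prems(1) by (metis list.set_intros(1) set_mset_mset)
    then obtain ps qs where ys: "ys = ps @ x # qs" by (meson split_list)
    have m: "mset xs = mset (ps @ qs)" using Cons.prems(1) ys by simp
    have sx: "set xs = set (ps @ qs)" using m mset_eq_setD by blast
    obtain e where e: "e \<in> {1, - 1}" "R ((us @ [x]) @ xs) = scale e (R ((us @ [x]) @ ps @ qs))"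
    proof -
      have "fst ` set (us @ [x]) \<subseteq> L" "fst ` set xs \<subseteq> L" using Cons.prems by auto
      from Cons.IH[OF m this(2,1)] show thesis using that by blast
    qed
    obtain e' where e': "e' \<in> {1, - 1}" "R (us @ x # ps @ qs) = scale e' (R (us @ ps @ x # qs))"
    proof -
      have "fst ` set (us @ x # ps @ qs) \<subseteq> L" using Cons.prems sx by auto
      from R_move[OF this] show thesis using that by blast
    qed
    have "R (us @ x # xs) = scale (e * e') (R (us @ ys))" using e e' ys by simp
    moreover have "e * e' \<in> {1, - 1}" using e e' by auto
    ultimately show ?case by blast
  qed simp
  from this[of "[]"] show ?thesis by simp
qed

text \<open>
  \<open>a\<^sub>(\<^sub>n\<^sub>)\<close> applied to a coefficient is the leading term of a coefficient of the longer word; the remaining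
  terms have smaller exponents.
\<close>
lemma nprod_R_span:
  assumes a: "a \<in> L" and "fst ` set xs \<subseteq> L"
  shows "nprod A (X a) n (R xs) \<in> span {R ys | ys. fst ` set ys \<subseteq> L}"
proof (cases "\<exists>x\<in>set xs. snd x < 0")
  case True
  then show ?thesis using R_neg assms by (simp add: X_carrier span_zero)
next
  case False
  let ?W = "span {R ys | ys. fst ` set ys \<subseteq> L}"
  from False have "\<forall>x\<in>set xs. snd x \<ge> 0" by auto
  then show ?thesis using assms(2)
  proof (induction "nat (sum_list (map snd xs))" arbitrary: xs n rule: less_induct)
    case less
    define r where "r = (\<Sum>b\<leftarrow>map fst xs. N a b) - n - 1"
    have "mul_factors (N a) (\<lambda>t ys. nprod A (X a) t (R ys)) n xs - nprod A (X a) n (R xs) \<in> ?W"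
    proof (rule mul_factors_lead)
      fix t' :: int and ys :: "('l \<times> int) list" assume y: "map fst ys = map fst xs" "sum_list (map snd ys) < sum_list (map snd xs)" "\<forall>x\<in>set ys. 0 \<le> snd x"
      have "sum_list (map snd ys) \<ge> 0" using y(3) by (intro sum_list_nonneg) auto
      with y(2) have lt: "nat (sum_list (map snd ys)) < nat (sum_list (map snd xs))" by simp
      show "nprod A (X a) t' (R ys) \<in> ?W"
        by (rule less.hyps[OF lt y(3)]) (use less.prems(2) arg_cong[OF y(1), of set] in auto)
    qed (use less.prems in auto)
    moreover have "mul_factors (N a) (\<lambda>t ys. nprod A (X a) t (R ys)) n xs = R ((a, r) # xs)"
      by (simp add: r_def)
    moreover have "R ((a, r) # xs) \<in> ?W"
    proof (rule span_base)
      have "fst ` set ((a, r) # xs) \<subseteq> L" using a less.prems by simp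
      then show "R ((a, r) # xs) \<in> {R ys | ys. fst ` set ys \<subseteq> L}" by blast
    qed
    ultimately have "R ((a, r) # xs) - nprod A (X a) n (R xs) \<in> ?W" "R ((a, r) # xs) \<in> ?W" by simp_all
    then have "R ((a, r) # xs) - (R ((a, r) # xs) - nprod A (X a) n (R xs)) \<in> ?W"
      by (blast intro: span_diff)
    then show ?case by (simp only: diff_diff_eq2 add_diff_cancel_left')
  qed
qed

lemma generated_subset_span_R:
  "va_generated scale A (X ` L) \<subseteq> span {R xs | xs. fst ` set xs \<subseteq> L \<and> (\<forall>x\<in>set xs. snd x \<ge> 0)}" (is "_ \<subseteq> span ?S")
proof -
  let ?S' = "{R xs | xs. fst ` set xs \<subseteq> L}"
  have S'c: "?S' \<subseteq> va_carrier A" using R_carrier by blast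
  have "w \<in> span ?S' \<Longrightarrow> w \<in> va_carrier A \<and> nprod A (X a) n w \<in> span ?S'" if a: "a \<in> L" for a n w
  proof (induction rule: span_induct_alt)
    case base
    then show ?case using a by (simp add: X_carrier span_zero)
  next
    case (step c x y)
    moreover have "nprod A (X a) n x \<in> span ?S'" using step(1) nprod_R_span[OF a] by blast
    moreover have "x \<in> va_carrier A" using step(1) S'c by blast
    ultimately show ?case
      by (simp add: nprod_add_right nprod_scale_right X_carrier a carrier_add carrier_scale span_add span_scale)
  qed
  then have st: "nprod A (X a) n w \<in> span ?S'" if "a \<in> L" "w \<in> span ?S'" for a n w using that by blast
  have "monomials (X ` L) \<subseteq> span ?S'"
  proof
    fix x assume "x \<in> monomials (X ` L)"
    then show "x \<in> span ?S'"
    proof induction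
      case vac
      have "fst ` set ([] :: ('l \<times> int) list) \<subseteq> L" by simp
      then have "R [] \<in> span ?S'" by (intro span_base) blast
      then show ?case by simp
    qed (use st in auto)
  qed
  then have "span (monomials (X ` L)) \<subseteq> span ?S'" by (simp add: span_minimal)
  moreover have "va_generated scale A (X ` L) \<subseteq> span (monomials (X ` L))"
    by (rule generated_subset_span_monomials) (use X_grade in auto)
  moreover have "span ?S' \<subseteq> span ?S"
  proof (rule span_minimal)
    show "?S' \<subseteq> span ?S"
    proof
      fix x assume "x \<in> ?S'"
      then obtain xs where x: "x = R xs" and xs: "fst ` set xs \<subseteq> L" by blast
      show "x \<in> span ?S"
      proof (cases "\<exists>x\<in>set xs. snd x < 0")
        case True
        then show ?thesis using R_neg[OF xs] x by (simp add: span_zero)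
      next
        case False
        then have "\<forall>x\<in>set xs. snd x \<ge> 0" by auto
        then show ?thesis using xs x by (intro span_base) blast
      qed
    qed
  qed simp
  ultimately show ?thesis by blast
qed

end

section \<open>Linear maps on the Fock space\<close>

definition lift :: "('x \<Rightarrow> ('y \<Rightarrow>\<^sub>0 'k)) \<Rightarrow> ('x \<Rightarrow>\<^sub>0 'k) \<Rightarrow> ('y \<Rightarrow>\<^sub>0 'k::field_char_0)" where
  "lift g v = (\<Sum>x\<in>Poly_Mapping.keys v. fscale (Poly_Mapping.lookup v x) (g x))"

lemma lift_superset:
  assumes "finite S" "Poly_Mapping.keys v \<subseteq> S"
  shows "lift g v = (\<Sum>x\<in>S. fscale (Poly_Mapping.lookup v x) (g x))"
  unfolding lift_def by (rule sum.mono_neutral_left) (use assms in \<open>auto simp: in_keys_iff\<close>)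

lemma lift_add: "lift g (v + w) = lift g v + lift g w"
proof -
  let ?S = "Poly_Mapping.keys v \<union> Poly_Mapping.keys w"
  have "Poly_Mapping.keys (v + w) \<subseteq> ?S" by (rule keys_add)
  then show ?thesis
    by (simp add: lift_superset[of ?S] lookup_add fscale.scale_left_distrib sum.distrib)
qed

lemma lift_0 [simp]: "lift g 0 = 0"
  by (simp add: lift_def)

lemma lift_scale: "lift g (fscale r v) = fscale r (lift g v)"
proof -
  have "Poly_Mapping.keys (fscale r v) \<subseteq> Poly_Mapping.keys v"
    by (auto simp: in_keys_iff lookup_fscale)
  then show ?thesis
    by (simp add: lift_superset[of "Poly_Mapping.keys v"] lookup_fscale fscale.scale_sum_right)
qed

lemma lift_single [simp]: "lift g (Poly_Mapping.single x r) = fscale r (g x)"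
  by (simp add: lift_def)

lemma lift_sum: "lift g (sum f S) = (\<Sum>i\<in>S. lift g (f i))"
  by (induction S rule: infinite_finite_induct) (simp_all add: lift_add)

lemma fscale_single [simp]: "fscale r (Poly_Mapping.single x s) = Poly_Mapping.single x (r * s)"
  by (rule poly_mapping_eqI) (simp add: lookup_fscale lookup_single when_def)

lemma sum_singles: "v = (\<Sum>x\<in>Poly_Mapping.keys v. fscale (Poly_Mapping.lookup v x) (Poly_Mapping.single x 1))"
  by (rule poly_mapping_eqI) (simp add: lookup_sum lookup_single when_def in_keys_iff)

lemma linear_mem:
  fixes T :: "('x \<Rightarrow>\<^sub>0 'k::field_char_0) \<Rightarrow> ('y \<Rightarrow>\<^sub>0 'k)"
  assumes C: "fscale.subspace C" and W: "fscale.subspace W"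
    and add: "\<And>v w. v \<in> C \<Longrightarrow> w \<in> C \<Longrightarrow> T (v + w) = T v + T w"
    and scale: "\<And>r v. v \<in> C \<Longrightarrow> T (fscale r v) = fscale r (T v)"
    and basis: "\<And>x. x \<in> Poly_Mapping.keys v \<Longrightarrow> Poly_Mapping.single x 1 \<in> C"
      "\<And>x. x \<in> Poly_Mapping.keys v \<Longrightarrow> T (Poly_Mapping.single x 1) \<in> W"
  shows "T v \<in> W"
proof -
  have T0: "T 0 = 0" using scale[of 0 0] fscale.subspace_0[OF C] by simp
  have "(\<Sum>x\<in>S. fscale (Poly_Mapping.lookup v x) (Poly_Mapping.single x 1)) \<in> C
      \<and> T (\<Sum>x\<in>S. fscale (Poly_Mapping.lookup v x) (Poly_Mapping.single x 1)) \<in> W"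
    if "finite S" "S \<subseteq> Poly_Mapping.keys v" for S
    using that
  proof induction
    case empty
    then show ?case by (simp add: T0 fscale.subspace_0 C W)
  next
    case (insert x F)
    then show ?case
      by (simp add: add scale basis fscale.subspace_add C W fscale.subspace_scale del: fscale_single)
  qed
  from this[of "Poly_Mapping.keys v"] show ?thesis using sum_singles[of v] by simp
qed

lemma linear_eqI:
  fixes T :: "('x \<Rightarrow>\<^sub>0 'k::field_char_0) \<Rightarrow> ('y \<Rightarrow>\<^sub>0 'k)"
  assumes C: "fscale.subspace C"
    and "\<And>v w. v \<in> C \<Longrightarrow> w \<in> C \<Longrightarrow> T (v + w) = T v + T w"
    and "\<And>r v. v \<in> C \<Longrightarrow> T (fscale r v) = fscale r (T v)"
    and "\<And>v w. v \<in> C \<Longrightarrow> w \<in> C \<Longrightarrow> T' (v + w) = T' v + T' w"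
    and "\<And>r v. v \<in> C \<Longrightarrow> T' (fscale r v) = fscale r (T' v)"
    and "\<And>x. x \<in> Poly_Mapping.keys v \<Longrightarrow> Poly_Mapping.single x 1 \<in> C"
    and "\<And>x. x \<in> Poly_Mapping.keys v \<Longrightarrow> T (Poly_Mapping.single x 1) = T' (Poly_Mapping.single x 1)"
  shows "T v = T' v"
proof -
  have "(\<lambda>v. T v - T' v) v \<in> {0}"
    by (rule linear_mem[OF C]) (simp_all add: assms fscale.scale_right_diff_distrib)
  then show ?thesis by simp
qed

lemma heis_lift: "heis form h n = lift (heis_basis form h n)"
  by (simp add: fun_eq_iff heis_def lift_def)

lemma heis_add: "heis form h n (v + w) = heis form h n v + heis form h n w"
  by (simp add: heis_lift lift_add)

lemma heis_scale: "heis form h n (fscale r v) = fscale r (heis form h n v)"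
  by (simp add: heis_lift lift_scale)

lemma heis_0 [simp]: "heis form h n 0 = 0"
  by (simp add: heis_lift)

abbreviation creation :: "'i \<Rightarrow> nat \<Rightarrow> ('i, 'k) fock \<Rightarrow> ('i, 'k::field_char_0) fock" where
  "creation i k \<equiv> lift (\<lambda>(a, m). Poly_Mapping.single (a, add_mset (i, k) m) 1)"

text \<open>
  It is enough to know the creation operators \<open>i(-k)\<close> for basis elements \<open>i\<close> of \<open>\<hh>\<close>; they are
  multiplications in the polynomial rings of the Fock space, whatever the form is.
\<close>
lemma heis_neg:
  fixes v :: "('i, 'k::field_char_0) fock"
  assumes "k > 0"
  shows "heis form h (- int k) v = (\<Sum>i\<in>Poly_Mapping.keys h. fscale (Poly_Mapping.lookup h i) (creation i k v))"
proof (rule linear_eqI[where C = UNIV and v = v])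
  fix x :: "('i \<Rightarrow>\<^sub>0 int) \<times> ('i \<times> nat) multiset"
  obtain a m where x: "x = (a, m)" by (cases x)
  show "heis form h (- int k) (Poly_Mapping.single x 1)
      = (\<Sum>i\<in>Poly_Mapping.keys h. fscale (Poly_Mapping.lookup h i) (creation i k (Poly_Mapping.single x 1)))"
    using assms by (simp add: x heis_lift heis_basis_def)
qed (simp_all add: heis_add heis_scale lift_add lift_scale fscale.scale_right_distrib sum.distrib
      fscale.scale_sum_right mult.commute)

lemma heis_single_neg:
  assumes "k > 0"
  shows "heis form (Poly_Mapping.single i 1) (- int k) v = creation i k v"
  using heis_neg[OF assms, of form "Poly_Mapping.single i 1" v] by simp

lemma to_cartan_keys: "Poly_Mapping.keys (to_cartan b :: 'i \<Rightarrow>\<^sub>0 'k::field_char_0) = Poly_Mapping.keys b"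
  and to_cartan_lookup: "Poly_Mapping.lookup (to_cartan b :: 'i \<Rightarrow>\<^sub>0 'k) i = of_int (Poly_Mapping.lookup b i)"
proof -
  show l: "Poly_Mapping.lookup (to_cartan b :: 'i \<Rightarrow>\<^sub>0 'k) i = of_int (Poly_Mapping.lookup b i)" for i
    by (simp add: to_cartan_def map.rep_eq when_def)
  show "Poly_Mapping.keys (to_cartan b :: 'i \<Rightarrow>\<^sub>0 'k) = Poly_Mapping.keys b"
    by (auto simp: in_keys_iff l)
qed

section \<open>Weights and derivations of the Fock space\<close>

text \<open>
  The part of \<open>S(\<hh> \<otimes> t\<^sup>-\<^sup>1\<k>[t\<^sup>-\<^sup>1]) v\<^sub>b\<close> in which the mode numbers add up to \<open>d\<close>.
\<close>
definition weight_space :: "('i \<Rightarrow>\<^sub>0 int) \<Rightarrow> int \<Rightarrow> ('i, 'k::field_char_0) fock set" where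
  "weight_space b d = {v. \<forall>(a, m)\<in>Poly_Mapping.keys v. a = b \<and> int (\<Sum>y\<in>#m. snd y) = d}"

lemma weight_space_iff: "v \<in> weight_space b d \<longleftrightarrow> (\<forall>a m. (a, m) \<in> Poly_Mapping.keys v \<longrightarrow> a = b \<and> int (\<Sum>y\<in>#m. snd y) = d)"
  by (auto simp: weight_space_def)

lemma subspace_weight_space: "fscale.subspace (weight_space b d :: ('i, 'k::field_char_0) fock set)"
proof (rule fscale.subspaceI)
  show "x + y \<in> weight_space b d" if "x \<in> weight_space b d" "y \<in> weight_space b d" for x y :: "('i, 'k) fock"
    using that keys_add[of x y] unfolding weight_space_iff by blast
  show "fscale c x \<in> weight_space b d" if "x \<in> weight_space b d" for c and x :: "('i, 'k) fock"
    using that unfolding weight_space_iff by (auto simp: in_keys_iff lookup_fscale)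
qed (simp add: weight_space_def)

lemma creation_weight_space:
  fixes v :: "('i, 'k::field_char_0) fock"
  assumes "v \<in> weight_space b d" shows "creation i k v \<in> weight_space b (d + int k)"
proof (rule linear_mem[where C = UNIV and v = v])
  fix x assume x: "x \<in> Poly_Mapping.keys v"
  obtain a m where am: "x = (a, m)" by (cases x)
  show "creation i k (Poly_Mapping.single x 1) \<in> weight_space b (d + int k)"
    using assms x by (simp add: am weight_space_iff)
qed (simp_all add: subspace_weight_space lift_add lift_scale)

definition ev :: "('i \<Rightarrow> 'k::field_char_0) \<Rightarrow> ('i \<Rightarrow>\<^sub>0 int) \<Rightarrow> 'k" where
  "ev l a = (\<Sum>i\<in>Poly_Mapping.keys a. of_int (Poly_Mapping.lookup a i) * l i)"

lemma ev_0 [simp]: "ev l 0 = 0"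
  by (simp add: ev_def)

lemma ev_superset:
  assumes "finite S" "Poly_Mapping.keys v \<subseteq> S"
  shows "ev l v = (\<Sum>i\<in>S. of_int (Poly_Mapping.lookup v i) * l i)"
  unfolding ev_def by (rule sum.mono_neutral_left) (use assms in \<open>auto simp: in_keys_iff\<close>)

lemma ev_add: "ev l (v + w) = ev l v + ev l w"
proof -
  let ?S = "Poly_Mapping.keys v \<union> Poly_Mapping.keys w"
  have "Poly_Mapping.keys (v + w) \<subseteq> ?S" by (rule keys_add)
  then show ?thesis
    by (simp add: ev_superset[of ?S] lookup_add distrib_right sum.distrib)
qed

text \<open>
  The operators \<open>\<delta>\<^sub>l\<^sub>,\<^sub>n\<close> for \<open>n \<ge> 0\<close>: defined like \<open>h(n)\<close>, with an arbitrary functional \<open>l\<close> on \<open>\<hh>\<close>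
  instead of \<open>(h|\<cdot>)\<close>. The normalisation with the factor \<open>n\<close>, and \<open>\<delta>\<^sub>l\<^sub>,\<^sub>0 = l(b)\<close> on the summand of
  \<open>v\<^sub>b\<close>, make the commutators with \<open>D\<close> and with \<open>v\<^sub>a\<^sub>(\<^sub>k\<^sub>)\<close> uniform in \<open>n\<close>.
\<close>
definition der_basis :: "('i \<Rightarrow> 'k) \<Rightarrow> nat \<Rightarrow> ('i \<Rightarrow>\<^sub>0 int) \<times> ('i \<times> nat) multiset \<Rightarrow> ('i, 'k::field_char_0) fock" where
  "der_basis l n = (\<lambda>(a, m). if n = 0 then Poly_Mapping.single (a, m) (ev l a)
     else \<Sum>y\<in>#m. Poly_Mapping.single (a, m - {#y#}) (if snd y = n then of_nat n * l (fst y) else 0))"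

abbreviation der :: "('i \<Rightarrow> 'k) \<Rightarrow> nat \<Rightarrow> ('i, 'k) fock \<Rightarrow> ('i, 'k::field_char_0) fock" where
  "der l n \<equiv> lift (der_basis l n)"

lemma lift_sum_mset: "lift g (\<Sum>y\<in>#m. f y) = (\<Sum>y\<in>#m. lift g (f y))"
  by (induction m) (simp_all add: lift_add)

lemma der_creation:
  fixes v :: "('i, 'k::field_char_0) fock"
  assumes "k > 0"
  shows "der l n (creation i k v) = creation i k (der l n v) + fscale (if n = k then of_nat n * l i else 0) v"
proof (rule linear_eqI[where C = UNIV and v = v])
  fix x :: "('i \<Rightarrow>\<^sub>0 int) \<times> ('i \<times> nat) multiset"
  obtain a m where x: "x = (a, m)" by (cases x)
  show "der l n (creation i k (Poly_Mapping.single x 1)) = creation i k (der l n (Poly_Mapping.single x 1))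
      + fscale (if n = k then of_nat n * l i else 0) (Poly_Mapping.single x 1)"
  proof (cases "n = 0")
    case True
    then show ?thesis using assms by (simp add: x der_basis_def)
  next
    case False
    have "(\<Sum>y\<in>#m. Poly_Mapping.single (a, add_mset (i, k) m - {#y#}) (if snd y = n then of_nat n * l (fst y) else 0))
      = (\<Sum>y\<in>#m. Poly_Mapping.single (a, add_mset (i, k) (m - {#y#})) (if snd y = n then of_nat n * l (fst y) else 0))"
    proof (intro arg_cong[where f = sum_mset] image_mset_cong)
      fix y assume "y \<in># m"
      then have "add_mset (i, k) m - {#y#} = add_mset (i, k) (m - {#y#})"
      proof (cases "y = (i, k)")
        case False
        then show ?thesis by (rule diff_union_swap[symmetric])
      qed simp
      then show "Poly_Mapping.single (a, add_mset (i, k) m - {#y#}) (if snd y = n then of_nat n * l (fst y) else 0)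
        = Poly_Mapping.single (a, add_mset (i, k) (m - {#y#})) (if snd y = n then of_nat n * l (fst y) else 0)" by simp
    qed
    then show ?thesis using False
      by (simp add: x der_basis_def lift_sum_mset)
  qed
qed (simp_all add: lift_add lift_scale fscale.scale_right_distrib mult.commute)

lemma der_weight_space_0:
  fixes v :: "('i, 'k::field_char_0) fock"
  assumes v: "v \<in> weight_space b d"
  shows "der l 0 v = fscale (ev l b) v"
proof (rule linear_eqI[where C = UNIV and T = "der l 0" and T' = "fscale (ev l b)"])
  fix x assume "x \<in> Poly_Mapping.keys v"
  then have "fst x = b" using v unfolding weight_space_iff by (cases x) auto
  then show "der l 0 (Poly_Mapping.single x 1) = fscale (ev l b) (Poly_Mapping.single x 1)"
    by (cases x) (simp add: der_basis_def)
qed (simp_all add: lift_add lift_scale fscale.scale_right_distrib mult.commute)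

lemma der_lattice_vec: "n > 0 \<Longrightarrow> der l n (lattice_vec b) = 0"
  by (simp add: lattice_vec_def der_basis_def)

section \<open>Lattice vectors and the derivations\<close>

context lattice_vertex_algebra
begin

lemma carrier_keys:
  assumes "v \<in> va_carrier V" "(a, m) \<in> Poly_Mapping.keys v"
  shows "Poly_Mapping.keys a \<subseteq> I" "set_mset m \<subseteq> I \<times> {1..}"
proof -
  obtain y z where yz: "y \<in> grade V False" "z \<in> grade V True" "v = y + z"
    using assms(1) by (rule carrier_cases)
  then have "(a, m) \<in> Poly_Mapping.keys y \<or> (a, m) \<in> Poly_Mapping.keys z"
    using assms(2) keys_add[of y z] by blast
  then show "Poly_Mapping.keys a \<subseteq> I" "set_mset m \<subseteq> I \<times> {1..}"
    using yz(1,2) unfolding grade_V fock_grade_def by fastforce+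
qed

lemma single_carrier:
  assumes "Poly_Mapping.keys a \<subseteq> I" "set_mset m \<subseteq> I \<times> {1..}"
  shows "Poly_Mapping.single (a, m) 1 \<in> va_carrier V"
proof (rule grade_carrier)
  show "Poly_Mapping.single (a, m) 1 \<in> grade V (odd (form a a))"
    using assms by (simp add: grade_V fock_grade_def)
qed

lemma keys_carrier: "v \<in> va_carrier V \<Longrightarrow> x \<in> Poly_Mapping.keys v \<Longrightarrow> Poly_Mapping.single x 1 \<in> va_carrier V"
  using carrier_keys single_carrier by (cases x) auto

lemma lattice_vec_grade: "Poly_Mapping.keys a \<subseteq> I \<Longrightarrow> lattice_vec a \<in> grade V (odd (form a a))"
  by (simp add: lattice_vec_def grade_V fock_grade_def)

lemma lattice_vec_carrier: "Poly_Mapping.keys a \<subseteq> I \<Longrightarrow> lattice_vec a \<in> va_carrier V"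
  using lattice_vec_grade grade_carrier by blast

lemma keys_plus: "Poly_Mapping.keys a \<subseteq> I \<Longrightarrow> Poly_Mapping.keys b \<subseteq> I \<Longrightarrow> Poly_Mapping.keys (a + b :: 'i \<Rightarrow>\<^sub>0 int) \<subseteq> I"
  using keys_add[of a b] by blast

lemma form_0: "Poly_Mapping.keys b \<subseteq> I \<Longrightarrow> form 0 b = 0"
  using form_add[of 0 0 b] by simp

abbreviation "hvec i \<equiv> heis form (Poly_Mapping.single i 1) (- 1) (lattice_vec 0 :: ('i, 'k) fock)"

lemma hvec_eq: "hvec i = Poly_Mapping.single (0, {#(i, 1)#}) 1"
  using heis_single_neg[of 1 form i "lattice_vec 0 :: ('i, 'k) fock"] by (simp add: lattice_vec_def)

lemma hvec_grade: "i \<in> I \<Longrightarrow> hvec i \<in> grade V False"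
  unfolding hvec_eq by (simp add: grade_V fock_grade_def form_0)

lemma hvec_carrier: "i \<in> I \<Longrightarrow> hvec i \<in> va_carrier V"
  using hvec_grade grade_carrier by blast

lemma nprod_hvec: "i \<in> I \<Longrightarrow> v \<in> va_carrier V \<Longrightarrow> nprod V (hvec i) n v = heis form (Poly_Mapping.single i 1) n v"
  by (rule heis_V) (simp_all add: cartan_def)

lemma creation_eq_nprod:
  assumes "i \<in> I" "k > 0" "v \<in> va_carrier V"
  shows "creation i k v = nprod V (hvec i) (- int k) v"
  using assms by (simp add: nprod_hvec heis_single_neg)

lemma creation_carrier: "i \<in> I \<Longrightarrow> k > 0 \<Longrightarrow> v \<in> va_carrier V \<Longrightarrow> creation i k v \<in> va_carrier V"
  by (simp add: creation_eq_nprod nprod_carrier hvec_carrier)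

lemma D_creation:
  assumes "i \<in> I" "k > 0" "v \<in> va_carrier V"
  shows "va_D V (creation i k v) = creation i k (va_D V v) + fscale (of_nat k) (creation i (Suc k) v)"
  using D_nprod'[OF hvec_carrier[OF assms(1)] assms(3), of "- int k"] assms
  by (simp add: creation_eq_nprod D_carrier fscale.scale_minus_left)
    (simp add: minus_diff_commute[of "int k" 1])

text \<open>
  Compare the formula for \<open>v\<^sub>0\<^sub>(\<^sub>-\<^sub>2\<^sub>)v\<^sub>b\<close> with \<open>v\<^sub>0 = 1\<close>.
\<close>
lemma D_lattice_vec:
  assumes "Poly_Mapping.keys b \<subseteq> I"
  shows "va_D V (lattice_vec b) = heis form (to_cartan b) (- 1) (lattice_vec b)"
proof -
  have "\<epsilon> 0 b \<noteq> 0" using eps_values[of 0 b] assms by auto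
  moreover have "nprod V (vac V) (- 2) (lattice_vec b) = 0"
    using assms by (simp add: vac_nprod lattice_vec_carrier)
  ultimately show ?thesis using lattice_vec_nprod[of 0 b 1] assms by (simp add: form_0 vac_V)
qed

text \<open>
  \<open>h\<close> and \<open>v\<^sub>a\<close> are local of order 1, so their commutator is the field of
  \<open>h\<^sub>(\<^sub>0\<^sub>)v\<^sub>a = (h|a) v\<^sub>a\<close>.
\<close>
lemma nprod_lattice_vec_creation:
  assumes a: "Poly_Mapping.keys a \<subseteq> I" and i: "i \<in> I" and k: "k > 0" and u: "u \<in> va_carrier V"
  shows "nprod V (lattice_vec a) n (creation i k u) = creation i k (nprod V (lattice_vec a) n u)
     - fscale (cartan_form form (Poly_Mapping.single i 1) (to_cartan a)) (nprod V (lattice_vec a) (n - int k) u)"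
proof -
  let ?h = "hvec i" and ?v = "lattice_vec a :: ('i, 'k) fock"
  let ?c = "cartan_form form (Poly_Mapping.single i 1) (to_cartan a) :: 'k"
  note vc = lattice_vec_carrier[OF a]
  have act: "nprod V ?h n ?v = (if n = 0 then fscale ?c ?v else 0)" if "n \<ge> 0" for n
    unfolding nprod_hvec[OF i vc] using that by (simp add: heis_lift heis_basis_def lattice_vec_def)
  have "va_local fscale V (if False \<and> odd (form a a) then - 1 else 1) 1 ?h ?v"
    by (rule local_of_nprod_zero[OF hvec_grade[OF i] lattice_vec_grade[OF a]]) (simp add: act)
  from local_comm_top[OF hvec_grade[OF i] lattice_vec_grade[OF a] u, of 0 "- int k" n] this
  have "local_comm 1 ?h ?v 0 (- int k) n u = nprod V (nprod V ?h 0 ?v) (- int k + n) u" by simp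
  then show ?thesis
    using i k u vc by (simp add: local_comm_zero act nprod_scale_left creation_eq_nprod nprod_carrier)
      (simp add: algebra_simps)
qed

lemma basis_induct:
  assumes a: "Poly_Mapping.keys a \<subseteq> I" and m: "set_mset m \<subseteq> I \<times> {1..}"
    and vec: "P (lattice_vec a)"
    and step: "\<And>i k u m. i \<in> I \<Longrightarrow> k > 0 \<Longrightarrow> u = Poly_Mapping.single (a, m) 1 \<Longrightarrow> u \<in> va_carrier V
      \<Longrightarrow> P u \<Longrightarrow> P (creation i k u)"
  shows "P (Poly_Mapping.single (a, m) 1)"
  using m
proof (induction m)
  case empty
  then show ?case using vec by (simp add: lattice_vec_def)
next
  case (add y m)
  obtain i k where y: "y = (i, k)" by (cases y)
  have "P (creation i k (Poly_Mapping.single (a, m) 1))"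
    by (rule step[OF _ _ refl]) (use add y single_carrier[OF a] in auto)
  then show ?case by (simp add: y)
qed

lemma carrier_eqI:
  fixes T :: "('i, 'k) fock \<Rightarrow> ('i, 'k) fock"
  assumes v: "v \<in> va_carrier V"
    and "\<And>v w. v \<in> va_carrier V \<Longrightarrow> w \<in> va_carrier V \<Longrightarrow> T (v + w) = T v + T w"
    and "\<And>r v. v \<in> va_carrier V \<Longrightarrow> T (fscale r v) = fscale r (T v)"
    and "\<And>v w. v \<in> va_carrier V \<Longrightarrow> w \<in> va_carrier V \<Longrightarrow> T' (v + w) = T' v + T' w"
    and "\<And>r v. v \<in> va_carrier V \<Longrightarrow> T' (fscale r v) = fscale r (T' v)"
    and "\<And>a m. Poly_Mapping.keys a \<subseteq> I \<Longrightarrow> set_mset m \<subseteq> I \<times> {1..}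
        \<Longrightarrow> T (Poly_Mapping.single (a, m) 1) = T' (Poly_Mapping.single (a, m) 1)"
  shows "T v = T' v"
proof (rule linear_eqI[OF subspace_carrier, where v = v])
  fix x assume x: "x \<in> Poly_Mapping.keys v"
  show "Poly_Mapping.single x 1 \<in> va_carrier V" using keys_carrier[OF v x] .
  show "T (Poly_Mapping.single x 1) = T' (Poly_Mapping.single x 1)"
    using carrier_keys[OF v] x assms(6) by (cases x) auto
qed (use assms in auto)

lemma heis_to_cartan:
  "heis form (to_cartan b) (- 1) (v :: ('i, 'k) fock)
    = (\<Sum>i\<in>Poly_Mapping.keys b. fscale (of_int (Poly_Mapping.lookup b i)) (creation i 1 v))"
  using heis_neg[of 1 form "to_cartan b" v] by (simp add: to_cartan_keys to_cartan_lookup)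

lemma heis_to_cartan_carrier:
  "Poly_Mapping.keys b \<subseteq> I \<Longrightarrow> v \<in> va_carrier V \<Longrightarrow> heis form (to_cartan b) (- 1) v \<in> va_carrier V"
  unfolding heis_to_cartan by (intro carrier_sum carrier_scale creation_carrier) auto

lemma heis_to_cartan_weight_space:
  "v \<in> weight_space a d \<Longrightarrow> heis form (to_cartan b) (- 1) (v :: ('i, 'k) fock) \<in> weight_space a (d + 1)"
  unfolding heis_to_cartan
  by (intro fscale.subspace_sum[OF subspace_weight_space] fscale.subspace_scale[OF subspace_weight_space])
    (use creation_weight_space[of v a d _ 1] in simp)

lemma der_heis_to_cartan:
  "der l n (heis form (to_cartan b) (- 1) (v :: ('i, 'k) fock))
    = heis form (to_cartan b) (- 1) (der l n v) + fscale (if n = 1 then ev l b else 0) v"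
  unfolding heis_to_cartan lift_sum lift_scale der_creation[OF zero_less_one]
  by (auto simp: fscale.scale_right_distrib sum.distrib ev_def fscale.scale_sum_left)

lemma der_carrier:
  assumes "v \<in> va_carrier V" shows "der l n v \<in> va_carrier V"
proof (rule linear_mem[OF fscale.subspace_UNIV subspace_carrier, where v = v])
  fix x assume x: "x \<in> Poly_Mapping.keys v"
  obtain a m where am: "x = (a, m)" by (cases x)
  have a: "Poly_Mapping.keys a \<subseteq> I" "set_mset m \<subseteq> I \<times> {1..}"
    using carrier_keys[OF assms, of a m] x am by auto
  have "der l n (Poly_Mapping.single (a, m) 1) \<in> va_carrier V"
  proof (cases "n = 0")
    case True
    have "der l n (Poly_Mapping.single (a, m) 1) = fscale (ev l a) (Poly_Mapping.single (a, m) 1)"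
      using True by (simp add: der_basis_def)
    then show ?thesis using single_carrier[OF a] by (simp only: carrier_scale)
  next
    case False
    show ?thesis
      using a
    proof (rule basis_induct)
      fix i k u m assume "i \<in> I" "(k::nat) > 0" "u = Poly_Mapping.single (a, m) 1" "u \<in> va_carrier V" "der l n u \<in> va_carrier V"
      then show "der l n (creation i k u) \<in> va_carrier V"
        by (simp only: der_creation carrier_add creation_carrier carrier_scale)
    qed (use False in \<open>simp add: der_lattice_vec\<close>)
  qed
  then show "der l n (Poly_Mapping.single x 1) \<in> va_carrier V" by (simp add: am)
qed (simp_all add: lift_add lift_scale)

lemma D_weight_space:
  assumes "v \<in> va_carrier V" "v \<in> weight_space b d" shows "va_D V v \<in> weight_space b (d + 1)"
proof (rule linear_mem[OF subspace_carrier subspace_weight_space, where v = v])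
  fix x assume x: "x \<in> Poly_Mapping.keys v"
  obtain a m where am: "x = (a, m)" by (cases x)
  have a: "Poly_Mapping.keys a \<subseteq> I" "set_mset m \<subseteq> I \<times> {1..}"
    using carrier_keys[OF assms(1), of a m] x am by auto
  have ab: "a = b" "int (\<Sum>y\<in>#m. snd y) = d" using assms(2) x am unfolding weight_space_iff by auto
  have "va_D V (Poly_Mapping.single (a, m) 1) \<in> weight_space a (int (\<Sum>y\<in>#m. snd y) + 1)"
    using a(2)
  proof (induction m)
    case empty
    have "lattice_vec a \<in> weight_space a 0" by (simp add: weight_space_iff lattice_vec_def)
    from heis_to_cartan_weight_space[OF this] show ?case
      using D_lattice_vec[OF a(1)] by (simp add: lattice_vec_def)
  next
    case (add y m)
    obtain i k where y: "y = (i, k)" by (cases y)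
    let ?u = "Poly_Mapping.single (a, m) (1 :: 'k)"
    let ?d = "int (\<Sum>y\<in>#m. snd y)"
    have ik: "i \<in> I" "k > 0" "?u \<in> va_carrier V" using add.prems y single_carrier[OF a(1)] by auto
    have "?u \<in> weight_space a ?d" by (simp add: weight_space_iff)
    then have 1: "creation i (Suc k) ?u \<in> weight_space a (?d + 1 + int k)"
      using creation_weight_space[of ?u a ?d i "Suc k"] by (simp add: algebra_simps)
    have "va_D V ?u \<in> weight_space a (?d + 1)" using add by simp
    then have 2: "creation i k (va_D V ?u) \<in> weight_space a (?d + 1 + int k)" by (rule creation_weight_space)
    have "va_D V (creation i k ?u) \<in> weight_space a (?d + 1 + int k)"
      unfolding D_creation[OF ik] using 1 2
      by (intro fscale.subspace_add[OF subspace_weight_space] fscale.subspace_scale[OF subspace_weight_space])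
    then show ?case by (simp add: y algebra_simps)
  qed
  then show "va_D V (Poly_Mapping.single x 1) \<in> weight_space b (d + 1)" unfolding am ab .
  show "Poly_Mapping.single x 1 \<in> va_carrier V" using keys_carrier[OF assms(1) x] .
qed (simp_all add: D_add D_scale)

text \<open>
  The product of lattice vectors indexed by its weight, which is \<open>1/r! (D - b(-1))^r v\<^sub>a\<^sub>+\<^sub>b\<close> up to sign.
\<close>
definition lprod :: "('i \<Rightarrow>\<^sub>0 int) \<Rightarrow> ('i \<Rightarrow>\<^sub>0 int) \<Rightarrow> int \<Rightarrow> ('i, 'k) fock" where
  "lprod a b r = nprod V (lattice_vec a) (- form a b - 1 - r) (lattice_vec b)"

lemma lprod_neg: "Poly_Mapping.keys a \<subseteq> I \<Longrightarrow> Poly_Mapping.keys b \<subseteq> I \<Longrightarrow> r < 0 \<Longrightarrow> lprod a b r = 0"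
  unfolding lprod_def by (rule lattice_vec_zero) auto

lemma lprod_0: "Poly_Mapping.keys a \<subseteq> I \<Longrightarrow> Poly_Mapping.keys b \<subseteq> I \<Longrightarrow> lprod a b 0 = fscale (\<epsilon> a b) (lattice_vec (a + b))"
  using lattice_vec_nprod[of a b 0] by (simp add: lprod_def)

lemma lprod_carrier: "Poly_Mapping.keys a \<subseteq> I \<Longrightarrow> Poly_Mapping.keys b \<subseteq> I \<Longrightarrow> lprod a b r \<in> va_carrier V"
  unfolding lprod_def by (intro nprod_carrier lattice_vec_carrier)

text \<open>
  In the form of a recursion the formula for \<open>v\<^sub>a\<^sub>(\<^sub>k\<^sub>)v\<^sub>b\<close> holds for all \<open>r\<close>, negative ones included.
\<close>
lemma lprod_Suc:
  assumes a: "Poly_Mapping.keys a \<subseteq> I" and b: "Poly_Mapping.keys b \<subseteq> I"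
  shows "va_D V (lprod a b r) - heis form (to_cartan b) (- 1) (lprod a b r) = fscale (of_int (r + 1)) (lprod a b (r + 1))"
proof (cases "r < 0")
  case True
  then show ?thesis using lprod_neg[OF a b, of r] lprod_neg[OF a b, of "r + 1"] by (cases "r + 1 = 0") auto
next
  case False
  define T where "T = (\<lambda>x. va_D V x - heis form (to_cartan b) (- 1) x)"
  define k where "k = nat r"
  have T_scale: "T (fscale s v) = fscale s (T v)" if "v \<in> va_carrier V" for s v
    using that by (simp add: T_def D_scale heis_scale fscale.scale_right_diff_distrib)
  have ck: "(T ^^ k) (lattice_vec (a + b)) \<in> va_carrier V" for k
    by (induction k) (simp_all add: T_def carrier_diff D_carrier heis_to_cartan_carrier b lattice_vec_carrier keys_plus a)
  have k: "lprod a b (int k) = fscale (\<epsilon> a b / fact k) ((T ^^ k) (lattice_vec (a + b)))" for k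
    using lattice_vec_nprod[of a b k] a b unfolding lprod_def T_def by (simp add: algebra_simps)
  have "T (lprod a b (int k)) = fscale (of_nat (Suc k)) (lprod a b (int (Suc k)))"
    unfolding k T_scale[OF ck] by (simp add: field_simps del: of_nat_Suc)
  then show ?thesis using False by (simp add: T_def k_def add.commute)
qed

lemma lprod_weight_space:
  assumes a: "Poly_Mapping.keys a \<subseteq> I" and b: "Poly_Mapping.keys b \<subseteq> I"
  shows "lprod a b r \<in> weight_space (a + b) r"
proof (cases "r < 0")
  case True
  then show ?thesis using lprod_neg[OF a b] by (simp add: weight_space_iff)
next
  case False
  have "lprod a b (int k) \<in> weight_space (a + b) (int k)" for k
  proof (induction k)
    case 0
    have "lattice_vec (a + b) \<in> weight_space (a + b) 0" by (simp add: weight_space_iff lattice_vec_def)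
    then show ?case using lprod_0[OF a b] fscale.subspace_scale[OF subspace_weight_space] by simp
  next
    case (Suc k)
    have "fscale (of_nat (Suc k)) (lprod a b (int (Suc k))) \<in> weight_space (a + b) (int k + 1)"
      using lprod_Suc[OF a b, of "int k"] D_weight_space[OF lprod_carrier[OF a b] Suc] heis_to_cartan_weight_space[OF Suc, of b]
        fscale.subspace_diff[OF subspace_weight_space]
      by (metis add.commute of_int_of_nat_eq of_nat_Suc)
    then have "fscale (inverse (of_nat (Suc k))) (fscale (of_nat (Suc k)) (lprod a b (int (Suc k)))) \<in> weight_space (a + b) (int k + 1)"
      by (rule fscale.subspace_scale[OF subspace_weight_space])
    moreover have "int k + 1 = int (Suc k)" by simp
    ultimately show ?case by (simp del: of_nat_Suc)
  qed
  from this[of "nat r"] show ?thesis using False by simp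
qed

lemma der_D:
  assumes "v \<in> va_carrier V" "n > 0"
  shows "der l n (va_D V v) = va_D V (der l n v) + fscale (of_nat n) (der l (n - 1) v)"
proof (rule carrier_eqI[OF assms(1)])
  fix a :: "'i \<Rightarrow>\<^sub>0 int" and m :: "('i \<times> nat) multiset"
  assume am: "Poly_Mapping.keys a \<subseteq> I" "set_mset m \<subseteq> I \<times> {1..}"
  show "der l n (va_D V (Poly_Mapping.single (a, m) 1)) = va_D V (der l n (Poly_Mapping.single (a, m) 1))
      + fscale (of_nat n) (der l (n - 1) (Poly_Mapping.single (a, m) 1))"
    using am
  proof (rule basis_induct)
    have "der l 0 (lattice_vec a) = fscale (ev l a) (lattice_vec a)"
      by (rule der_weight_space_0[of _ a 0]) (simp add: weight_space_iff lattice_vec_def)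
    then show "der l n (va_D V (lattice_vec a)) = va_D V (der l n (lattice_vec a))
      + fscale (of_nat n) (der l (n - 1) (lattice_vec a))"
      using assms(2) der_lattice_vec[of "n - 1" l a]
      by (cases "n = 1") (simp_all add: D_lattice_vec am der_heis_to_cartan der_lattice_vec)
  next
    fix i k u m assume i: "i \<in> I" "(k::nat) > 0" "u \<in> va_carrier V"
      and IH: "der l n (va_D V u) = va_D V (der l n u) + fscale (of_nat n) (der l (n - 1) u)"
    have c: "der l n u \<in> va_carrier V" "creation i k (der l n u) \<in> va_carrier V"
      using i der_carrier creation_carrier by auto
    have "der l n (va_D V (creation i k u)) = creation i k (va_D V (der l n u)) + fscale (of_nat n) (creation i k (der l (n - 1) u))
      + fscale (if n = k then of_nat n * l i else 0) (va_D V u)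
      + fscale (of_nat k) (creation i (Suc k) (der l n u))
      + fscale (of_nat k * (if n = Suc k then of_nat n * l i else 0)) u"
      unfolding D_creation[OF i] lift_add lift_scale der_creation[OF i(2)] der_creation[OF zero_less_Suc] IH
      by (simp add: fscale.scale_right_distrib add_ac)
    also have "\<dots> = va_D V (creation i k (der l n u)) + fscale (if n = k then of_nat n * l i else 0) (va_D V u)
      + fscale (of_nat n) (creation i k (der l (n - 1) u) + fscale (if n - 1 = k then of_nat (n - 1) * l i else 0) u)"
      using D_creation[OF i(1,2) c(1)] i(2) by (auto simp: fscale.scale_right_distrib add_ac mult_ac)
    also have "\<dots> = va_D V (der l n (creation i k u)) + fscale (of_nat n) (der l (n - 1) (creation i k u))"
      unfolding der_creation[OF i(2)] using c i by (simp add: D_add D_scale carrier_scale)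
    finally show "der l n (va_D V (creation i k u)) = va_D V (der l n (creation i k u)) + fscale (of_nat n) (der l (n - 1) (creation i k u))" .
  qed
qed (simp_all add: D_add D_scale lift_add lift_scale der_carrier fscale.scale_right_distrib add_ac mult_ac)

text \<open>
  Induction on \<open>r\<close> by means of \<open>lprod_Suc\<close>: on the summand of \<open>v\<^sub>a\<^sub>+\<^sub>b\<close> the commutator of \<open>\<delta>\<^sub>l\<^sub>,\<^sub>n\<close> with \<open>D - b(-1)\<close>
  is \<open>n \<delta>\<^sub>l\<^sub>,\<^sub>n\<^sub>-\<^sub>1\<close>, except that for \<open>n = 1\<close> the term \<open>b(-1)\<close> turns \<open>\<delta>\<^sub>l\<^sub>,\<^sub>0 = l(a + b)\<close> into \<open>l(a)\<close>.
\<close>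
lemma der_lprod:
  assumes a: "Poly_Mapping.keys a \<subseteq> I" and b: "Poly_Mapping.keys b \<subseteq> I" and "n > 0"
  shows "der l n (lprod a b r) = fscale (ev l a) (lprod a b (r - int n))"
proof (cases "r < 0")
  case True
  then show ?thesis using lprod_neg[OF a b] by simp
next
  case False
  have "\<forall>n>0. der l n (lprod a b (int k)) = fscale (ev l a) (lprod a b (int k - int n))" for k
  proof (induction k)
    case 0
    then show ?case by (simp add: lprod_0[OF a b] lprod_neg[OF a b] lift_scale der_lattice_vec)
  next
    case (Suc k)
    show ?case
    proof (intro allI impI)
      fix n :: nat assume n: "n > 0"
      let ?w = "lprod a b" and ?h = "heis form (to_cartan b) (- 1) :: ('i, 'k) fock \<Rightarrow> _"
      have wc: "?w r \<in> va_carrier V" for r using lprod_carrier[OF a b] .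
      have IH: "der l n (?w (int k)) = fscale (ev l a) (?w (int k - int n))" using Suc n by blast
      have low: "fscale (of_nat n) (der l (n - 1) (?w (int k))) - fscale (if n = 1 then ev l b else 0) (?w (int k))
          = fscale (of_nat n * ev l a) (?w (int k + 1 - int n))"
      proof (cases "n = 1")
        case True
        then show ?thesis using der_weight_space_0[OF lprod_weight_space[OF a b, of "int k"], of l]
          by (simp add: ev_add fscale.scale_left_distrib)
      next
        case False
        then have p: "n - 1 > 0" and e: "int k - int (n - 1) = int k + 1 - int n" using n by auto
        have "der l (n - 1) (?w (int k)) = fscale (ev l a) (?w (int k + 1 - int n))"
          using Suc p unfolding e[symmetric] by blast
        then show ?thesis using False by simp
      qed
      have "fscale (of_nat (Suc k)) (der l n (?w (int (Suc k)))) = der l n (fscale (of_int (int k + 1)) (?w (int k + 1)))"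
        by (simp add: lift_scale add.commute)
      also have "\<dots> = der l n (va_D V (?w (int k)) - ?h (?w (int k)))"
        by (simp only: lprod_Suc[OF a b])
      also have "\<dots> = der l n (va_D V (?w (int k))) - der l n (?h (?w (int k)))"
        by (metis lift_add add_diff_cancel_right' diff_add_cancel)
      also have "\<dots> = va_D V (der l n (?w (int k))) - ?h (der l n (?w (int k)))
         + (fscale (of_nat n) (der l (n - 1) (?w (int k))) - fscale (if n = 1 then ev l b else 0) (?w (int k)))"
        unfolding der_D[OF wc n] der_heis_to_cartan by (simp add: algebra_simps)
      also have "\<dots> = fscale (ev l a) (va_D V (?w (int k - int n)) - ?h (?w (int k - int n)))
         + fscale (of_nat n * ev l a) (?w (int k + 1 - int n))"
        unfolding low IH D_scale[OF wc] heis_scale fscale.scale_right_diff_distrib ..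
      also have "\<dots> = fscale (ev l a * of_int (int k - int n + 1) + of_nat n * ev l a) (?w (int k + 1 - int n))"
        unfolding lprod_Suc[OF a b] by (simp add: fscale.scale_left_distrib diff_add_eq)
      also have "\<dots> = fscale (of_nat (Suc k)) (fscale (ev l a) (?w (int (Suc k) - int n)))"
        by (simp add: algebra_simps)
      finally show "der l n (?w (int (Suc k))) = fscale (ev l a) (?w (int (Suc k) - int n))"
        by (simp only: fscale.scale_cancel_left) (simp del: of_nat_Suc)
    qed
  qed
  from this[of "nat r"] show ?thesis using False assms(3) by simp
qed

text \<open>
  The derivation commutes with creation operators up to constants, so the relation spreads from
  the vectors \<open>v\<^sub>b\<close> to the whole Fock space.
\<close>
lemma der_nprod:
  assumes a: "Poly_Mapping.keys a \<subseteq> I" and u: "u \<in> va_carrier V" and n: "n > 0"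
  shows "der l n (nprod V (lattice_vec a) q u)
    = nprod V (lattice_vec a) q (der l n u) + fscale (ev l a) (nprod V (lattice_vec a) (q + int n) u)"
proof (rule carrier_eqI[OF u])
  note vc = lattice_vec_carrier[OF a]
  fix b :: "'i \<Rightarrow>\<^sub>0 int" and m :: "('i \<times> nat) multiset"
  assume bm: "Poly_Mapping.keys b \<subseteq> I" "set_mset m \<subseteq> I \<times> {1..}"
  have "\<forall>q. der l n (nprod V (lattice_vec a) q (Poly_Mapping.single (b, m) 1))
    = nprod V (lattice_vec a) q (der l n (Poly_Mapping.single (b, m) 1))
      + fscale (ev l a) (nprod V (lattice_vec a) (q + int n) (Poly_Mapping.single (b, m) 1))"
    using bm
  proof (rule basis_induct)
    show "\<forall>q. der l n (nprod V (lattice_vec a) q (lattice_vec b)) = nprod V (lattice_vec a) q (der l n (lattice_vec b))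
      + fscale (ev l a) (nprod V (lattice_vec a) (q + int n) (lattice_vec b))"
    proof
      fix q
      have "lprod a b (- form a b - 1 - q) = nprod V (lattice_vec a) q (lattice_vec b)"
        "lprod a b (- form a b - 1 - q - int n) = nprod V (lattice_vec a) (q + int n) (lattice_vec b)"
        by (simp_all add: lprod_def)
      then show "der l n (nprod V (lattice_vec a) q (lattice_vec b)) = nprod V (lattice_vec a) q (der l n (lattice_vec b))
        + fscale (ev l a) (nprod V (lattice_vec a) (q + int n) (lattice_vec b))"
        using der_lprod[OF a bm(1) n, of l "- form a b - 1 - q"] vc n by (simp add: der_lattice_vec)
    qed
  next
    fix i k u m assume i: "i \<in> I" "(k::nat) > 0" "u \<in> va_carrier V"
      and IH: "\<forall>q. der l n (nprod V (lattice_vec a) q u)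
        = nprod V (lattice_vec a) q (der l n u) + fscale (ev l a) (nprod V (lattice_vec a) (q + int n) u)"
    let ?c = "cartan_form form (Poly_Mapping.single i 1) (to_cartan a) :: 'k"
    let ?v = "nprod V (lattice_vec a)"
    have dc: "der l n u \<in> va_carrier V" using i der_carrier by blast
    note com = nprod_lattice_vec_creation[OF a i(1,2)]
    have dd: "der l n (x - y) = der l n x - der l n y" for x y
      by (metis lift_add add_diff_cancel_right' diff_add_cancel)
    have cd: "creation i k (x + y) = creation i k x + creation i k y" for x y by (rule lift_add)
    have sh: "q - int k + int n = q + int n - int k" for q by simp
    show "\<forall>q. der l n (?v q (creation i k u)) = ?v q (der l n (creation i k u)) + fscale (ev l a) (?v (q + int n) (creation i k u))"
    proof
      fix q
      have "?v q (der l n (creation i k u)) = ?v q (creation i k (der l n u)) + fscale (if n = k then of_nat n * l i else 0) (?v q u)"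
        unfolding der_creation[OF i(2)] using vc i dc
        by (simp add: nprod_add_right nprod_scale_right carrier_scale creation_carrier)
      then show "der l n (?v q (creation i k u)) = ?v q (der l n (creation i k u)) + fscale (ev l a) (?v (q + int n) (creation i k u))"
        unfolding com[OF i(3)] com[OF dc] dd lift_scale der_creation[OF i(2)] IH[rule_format] sh
        by (simp add: lift_add lift_scale fscale.scale_right_distrib fscale.scale_right_diff_distrib algebra_simps)
    qed
  qed
  then show "der l n (nprod V (lattice_vec a) q (Poly_Mapping.single (b, m) 1))
    = nprod V (lattice_vec a) q (der l n (Poly_Mapping.single (b, m) 1))
      + fscale (ev l a) (nprod V (lattice_vec a) (q + int n) (Poly_Mapping.single (b, m) 1))" by blast
qed (simp_all add: nprod_add_right nprod_scale_right lattice_vec_carrier[OF a] der_carrier lift_add lift_scale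
    fscale.scale_right_distrib mult_ac add_ac)

lemma nprod_weight_space:
  assumes a: "Poly_Mapping.keys a \<subseteq> I" and b: "Poly_Mapping.keys b \<subseteq> I"
    and u: "u \<in> va_carrier V" "u \<in> weight_space b d"
  shows "nprod V (lattice_vec a) q u \<in> weight_space (a + b) (d - form a b - 1 - q)"
proof (rule linear_mem[OF subspace_carrier subspace_weight_space, where v = u])
  note vc = lattice_vec_carrier[OF a]
  fix x assume x: "x \<in> Poly_Mapping.keys u"
  obtain c m where cm: "x = (c, m)" by (cases x)
  have c: "c = b" "int (\<Sum>y\<in>#m. snd y) = d" using u(2) x cm unfolding weight_space_iff by auto
  have m: "set_mset m \<subseteq> I \<times> {1..}" using carrier_keys[OF u(1), of c m] x cm by auto
  have "\<forall>q. nprod V (lattice_vec a) q (Poly_Mapping.single (b, m) 1)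
      \<in> weight_space (a + b) (int (\<Sum>y\<in>#m. snd y) - form a b - 1 - q)"
    using m
  proof (induction m)
    case empty
    have "nprod V (lattice_vec a) q (lattice_vec b) \<in> weight_space (a + b) (- form a b - 1 - q)" for q
      using lprod_weight_space[OF a b, of "- form a b - 1 - q"] by (simp add: lprod_def)
    then show ?case by (simp add: lattice_vec_def)
  next
    case (add y m)
    obtain i k where y: "y = (i, k)" by (cases y)
    let ?u = "Poly_Mapping.single (b, m) (1 :: 'k)"
    let ?d = "int (\<Sum>y\<in>#m. snd y)"
    have ik: "i \<in> I" "k > 0" "?u \<in> va_carrier V" using add.prems y single_carrier[OF b] by auto
    have IH: "nprod V (lattice_vec a) q ?u \<in> weight_space (a + b) (?d - form a b - 1 - q)" for q
      using add by simp
    have "nprod V (lattice_vec a) q (creation i k ?u) \<in> weight_space (a + b) (?d + int k - form a b - 1 - q)" for q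
      unfolding nprod_lattice_vec_creation[OF a ik]
      using creation_weight_space[OF IH[of q], of i k] IH[of "q - int k"]
      by (intro fscale.subspace_diff[OF subspace_weight_space] fscale.subspace_scale[OF subspace_weight_space])
        (simp_all add: algebra_simps)
    then show ?case by (simp add: y algebra_simps)
  qed
  then show "nprod V (lattice_vec a) q (Poly_Mapping.single x 1) \<in> weight_space (a + b) (d - form a b - 1 - q)"
    unfolding cm c by blast
  show "Poly_Mapping.single x 1 \<in> va_carrier V" using keys_carrier[OF u(1) x] .
qed (simp_all add: nprod_add_right nprod_scale_right lattice_vec_carrier[OF a])

end

section \<open>Dual functionals\<close>

text \<open>
  A rational relation becomes an integral one after multiplication by a common denominator.
\<close>
lemma to_cartan_independent:
  fixes B :: "('i \<Rightarrow>\<^sub>0 int) set"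
  assumes "frag.independent B"
  shows "fscale.independent (to_cartan ` B :: ('i \<Rightarrow>\<^sub>0 rat) set)" and "inj (to_cartan :: _ \<Rightarrow> 'i \<Rightarrow>\<^sub>0 rat)"
proof -
  show inj: "inj (to_cartan :: _ \<Rightarrow> 'i \<Rightarrow>\<^sub>0 rat)"
  proof (rule injI)
    fix x y :: "'i \<Rightarrow>\<^sub>0 int" assume "to_cartan x = (to_cartan y :: 'i \<Rightarrow>\<^sub>0 rat)"
    then have "Poly_Mapping.lookup (to_cartan x :: 'i \<Rightarrow>\<^sub>0 rat) i = Poly_Mapping.lookup (to_cartan y) i" for i by simp
    then show "x = y" by (intro poly_mapping_eqI) (simp add: to_cartan_lookup)
  qed
  show "fscale.independent (to_cartan ` B :: ('i \<Rightarrow>\<^sub>0 rat) set)"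
  proof
    assume "fscale.dependent (to_cartan ` B :: ('i \<Rightarrow>\<^sub>0 rat) set)"
    then obtain t u v where t: "finite t" "t \<subseteq> to_cartan ` B" "(\<Sum>v\<in>t. fscale (u v) v) = (0 :: 'i \<Rightarrow>\<^sub>0 rat)"
      and v: "v \<in> t" "u v \<noteq> 0"
      unfolding fscale.dependent_explicit by blast
    obtain s where s: "s \<subseteq> B" "t = to_cartan ` s" using t(2) by (meson subset_imageE)
    have fs: "finite s" using t(1) s(2) inj by (metis finite_imageD inj_on_subset subset_UNIV)
    define r where "r b = u (to_cartan b)" for b
    have rel: "(\<Sum>b\<in>s. r b * of_int (Poly_Mapping.lookup b i)) = 0" for i
    proof -
      have "(\<Sum>v\<in>t. fscale (u v) v) = (\<Sum>b\<in>s. fscale (r b) (to_cartan b))"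
        unfolding s(2) r_def using inj by (subst sum.reindex) (auto intro: inj_on_subset)
      then have "Poly_Mapping.lookup (\<Sum>b\<in>s. fscale (r b) (to_cartan b)) i = 0" using t(3) by simp
      then show ?thesis by (simp add: lookup_sum lookup_fscale to_cartan_lookup)
    qed
    define M where "M = (\<Prod>b\<in>s. snd (quotient_of (r b)))"
    have M: "M > 0" unfolding M_def by (intro prod_pos) (simp add: quotient_of_denom_pos')
    have "\<exists>c. of_int M * r b = of_int c" if "b \<in> s" for b
    proof -
      obtain p q where pq: "quotient_of (r b) = (p, q)" by (cases "quotient_of (r b)")
      have q: "q > 0" "r b = of_int p / of_int q"
        using quotient_of_denom_pos[OF pq] quotient_of_div[OF pq] by auto
      have "M = q * (\<Prod>b\<in>s - {b}. snd (quotient_of (r b)))"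
        unfolding M_def using prod.remove[OF fs that, of "\<lambda>b. snd (quotient_of (r b))"] pq by simp
      then have "of_int M * r b = of_int (p * (\<Prod>b\<in>s - {b}. snd (quotient_of (r b))))"
        using q by simp
      then show ?thesis by blast
    qed
    then obtain c where c: "\<And>b. b \<in> s \<Longrightarrow> of_int M * r b = of_int (c b)" by metis
    have "(\<Sum>b\<in>s. frag_cmul (c b) b) = 0"
    proof (rule poly_mapping_eqI)
      fix i
      have "of_int (\<Sum>b\<in>s. c b * Poly_Mapping.lookup b i) = (\<Sum>b\<in>s. of_int M * (r b * of_int (Poly_Mapping.lookup b i)))"
        by (simp add: c mult.assoc[symmetric])
      also have "\<dots> = 0" using rel[of i] by (simp add: sum_distrib_left[symmetric])
      finally have "(\<Sum>b\<in>s. c b * Poly_Mapping.lookup b i) = 0" by (simp only: of_int_eq_0_iff)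
      then show "Poly_Mapping.lookup (\<Sum>b\<in>s. frag_cmul (c b) b) i = Poly_Mapping.lookup 0 i"
        by (simp add: lookup_sum)
    qed
    then have "\<forall>b\<in>s. c b = 0"
      using assms fs s(1) unfolding frag.dependent_explicit by blast
    moreover obtain b where "b \<in> s" "v = to_cartan b" using v(1) s(2) by blast
    ultimately show False using c[of b] v(2) M by (simp add: r_def)
  qed
qed

text \<open>
  The functionals are constructed over the rationals and then mapped to \<open>\<k>\<close>, which does not change
  their values \<open>0\<close> and \<open>1\<close> on \<open>B\<close>.
\<close>
lemma dual_functionals:
  fixes B :: "('i \<Rightarrow>\<^sub>0 int) set"
  assumes "frag.independent B"
  shows "\<exists>d :: ('i \<Rightarrow>\<^sub>0 int) \<Rightarrow> 'i \<Rightarrow> 'k::field_char_0. \<forall>a\<in>B. \<forall>b\<in>B. ev (d a) b = (if b = a then 1 else 0)"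
proof -
  interpret Q: vector_space "(*) :: rat \<Rightarrow> rat \<Rightarrow> rat"
    by unfold_locales (simp_all add: algebra_simps)
  interpret QQ: vector_space_pair "fscale :: rat \<Rightarrow> ('i \<Rightarrow>\<^sub>0 rat) \<Rightarrow> ('i \<Rightarrow>\<^sub>0 rat)" "(*) :: rat \<Rightarrow> rat \<Rightarrow> rat" ..
  note ind = to_cartan_independent[OF assms]
  have "\<exists>l :: 'i \<Rightarrow> 'k. \<forall>b\<in>B. ev l b = (if b = a then 1 else 0)" for a
  proof -
    obtain g :: "('i \<Rightarrow>\<^sub>0 rat) \<Rightarrow> rat" where g: "Vector_Spaces.linear fscale (*) g"
      and gB: "\<forall>x\<in>to_cartan ` B. g x = (if x = to_cartan a then 1 else 0)"
      using QQ.linear_independent_extend[OF ind(1), of "\<lambda>x. if x = to_cartan a then 1 else 0"] by blast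
    interpret g: Vector_Spaces.linear fscale "(*)" g by (rule g)
    have "ev (\<lambda>i. of_rat (g (Poly_Mapping.single i 1))) b = (of_rat (g (to_cartan b)) :: 'k)" for b
    proof -
      have "g (to_cartan b) = (\<Sum>i\<in>Poly_Mapping.keys b. of_int (Poly_Mapping.lookup b i) * g (Poly_Mapping.single i 1))"
        by (subst sum_singles[of "to_cartan b"])
          (simp only: g.sum g.scale to_cartan_keys to_cartan_lookup)
      then show ?thesis by (simp add: ev_def of_rat_sum of_rat_mult)
    qed
    then show ?thesis using gB ind(2) by (intro exI[of _ "\<lambda>i. of_rat (g (Poly_Mapping.single i 1))"]) (auto dest: injD)
  qed
  then obtain d :: "('i \<Rightarrow>\<^sub>0 int) \<Rightarrow> 'i \<Rightarrow> 'k"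
    where "\<And>a. \<forall>b\<in>B. ev (d a) b = (if b = a then 1 else 0)" by metis
  then show ?thesis by blast
qed

lemma sum_mset_inj:
  fixes d :: "('i \<Rightarrow>\<^sub>0 int) \<Rightarrow> 'i \<Rightarrow> 'k::field_char_0"
  assumes d: "\<forall>a\<in>B. \<forall>b\<in>B. ev (d a) b = (if b = a then 1 else 0)"
    and M: "set_mset M \<subseteq> B" and M': "set_mset M' \<subseteq> B" and eq: "\<Sum>\<^sub># M = \<Sum>\<^sub># M'"
  shows "M = M'"
proof (rule multiset_eqI)
  fix a
  have c: "ev (d a) (\<Sum>\<^sub># M) = of_nat (count M a)" if "set_mset M \<subseteq> B" "a \<in> B" for M
    using that(1) by (induction M) (use d that(2) in \<open>auto simp: ev_add\<close>)
  show "count M a = count M' a"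
  proof (cases "a \<in> B")
    case True
    then have "(of_nat (count M a) :: 'k) = of_nat (count M' a)" using c[OF M] c[OF M'] eq by metis
    then show ?thesis by simp
  next
    case False
    then show ?thesis using M M' by (metis count_eq_zero_iff subsetD)
  qed
qed

section \<open>Linear independence in the lattice vertex algebra\<close>

text \<open>
  The coefficient of \<open>v\<^sub>b\<close> after applying the derivations \<open>\<delta>\<^sub>d\<^sub>(\<^sub>a\<^sub>)\<^sub>,\<^sub>n\<close> for the entries \<open>(a, n)\<close> of a list.
\<close>
fun dual_coef :: "('l \<Rightarrow> 'i \<Rightarrow> 'k) \<Rightarrow> ('i \<Rightarrow>\<^sub>0 int) \<Rightarrow> ('l \<times> int) list \<Rightarrow> ('i, 'k::field_char_0) fock \<Rightarrow> 'k" where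
  "dual_coef d b [] v = Poly_Mapping.lookup v (b, {#})"
| "dual_coef d b ((a, n) # Q) v = dual_coef d b Q (der (d a) (nat n) v)"

lemma dual_coef_add: "dual_coef d b Q (v + w) = dual_coef d b Q v + dual_coef d b Q w"
  by (induction Q arbitrary: v w) (auto simp: lookup_add lift_add)

lemma dual_coef_scale: "dual_coef d b Q (fscale r v) = r * dual_coef d b Q v"
  by (induction Q arbitrary: v) (auto simp: lookup_fscale lift_scale)

lemma dual_coef_0 [simp]: "dual_coef d b Q 0 = 0"
  using dual_coef_scale[of d b Q 0 0] by simp

lemma dual_coef_sum: "dual_coef d b Q (sum f S) = (\<Sum>i\<in>S. dual_coef d b Q (f i))"
  by (induction S rule: infinite_finite_induct) (simp_all add: dual_coef_add)

definition pos_part :: "('l \<times> int) list \<Rightarrow> ('l \<times> int) multiset" where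
  "pos_part xs = filter_mset (\<lambda>x. snd x > 0) (mset xs)"

lemma pos_part_empty: "pos_part xs = {#} \<longleftrightarrow> (\<forall>x\<in>set xs. \<not> snd x > 0)"
  by (induction xs) (auto simp: pos_part_def)

lemma pos_part_update:
  assumes i: "i < length xs" and s: "xs ! i = (a, s)" and n: "n > 0" "n \<le> s"
  shows "pos_part xs = add_mset (a, s) (pos_part xs - {#(a, s)#})"
    and "pos_part (xs[i := (a, s - n)]) = (if s = n then pos_part xs - {#(a, s)#} else add_mset (a, s - n) (pos_part xs - {#(a, s)#}))"
proof -
  have "(a, s) \<in># pos_part xs" using i s n nth_mem[OF i] by (simp add: pos_part_def)
  then show "pos_part xs = add_mset (a, s) (pos_part xs - {#(a, s)#})" by simp
  show "pos_part (xs[i := (a, s - n)]) = (if s = n then pos_part xs - {#(a, s)#} else add_mset (a, s - n) (pos_part xs - {#(a, s)#}))"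
    using n unfolding pos_part_def mset_update[OF i] s by (auto simp: filter_diff_mset)
qed

sublocale lattice_vertex_algebra \<subseteq> lat: local_family fscale V "lattice_carrier I" "\<lambda>a b. - form a b" lattice_vec
proof
  show "va_admissible V (lattice_carrier I) (\<lambda>a b. - form a b) lattice_vec"
    unfolding va_admissible_def using lattice_vec_grade lattice_vec_zero by auto
  show "- form a b = - form b a" if "a \<in> lattice_carrier I" "b \<in> lattice_carrier I" for a b
    using form_sym[OF that] by simp
qed

context lattice_vertex_algebra
begin

lemma subset_lattice: "S \<subseteq> lattice_carrier I \<longleftrightarrow> (\<forall>b\<in>S. Poly_Mapping.keys b \<subseteq> I)"
  by (simp add: subset_eq)

lemma form_sum_list:
  assumes "Poly_Mapping.keys a \<subseteq> I" "\<forall>b\<in>set bs. Poly_Mapping.keys b \<subseteq> I"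
  shows "Poly_Mapping.keys (sum_list bs) \<subseteq> I" "form a (sum_list bs) = (\<Sum>b\<leftarrow>bs. form a b)"
proof -
  have "Poly_Mapping.keys (sum_list bs) \<subseteq> I \<and> form a (sum_list bs) = (\<Sum>b\<leftarrow>bs. form a b)"
    using assms(2)
  proof (induction bs)
    case Nil
    then show ?case using assms(1) form_sym[of a 0] by (simp add: form_0)
  next
    case (Cons b bs)
    then have k: "Poly_Mapping.keys b \<subseteq> I" "Poly_Mapping.keys (sum_list bs) \<subseteq> I" by auto
    have "form a (b + sum_list bs) = form (b + sum_list bs) a"
      using keys_plus[OF k] assms(1) by (intro form_sym) auto
    also have "\<dots> = form b a + form (sum_list bs) a" using k assms(1) by (intro form_add) auto
    also have "\<dots> = form a b + form a (sum_list bs)" using k assms(1) form_sym[of a] by simp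
    finally show ?case using Cons k keys_plus[OF k] by simp
  qed
  then show "Poly_Mapping.keys (sum_list bs) \<subseteq> I" "form a (sum_list bs) = (\<Sum>b\<leftarrow>bs. form a b)" by auto
qed

lemma R_weight_space:
  assumes "fst ` set xs \<subseteq> lattice_carrier I"
  shows "lat.R xs \<in> weight_space (sum_list (map fst xs)) (sum_list (map snd xs))"
  using assms
proof (induction "length xs" arbitrary: xs)
  case 0
  then show ?case by (simp add: vac_V lattice_vec_def weight_space_iff)
next
  case (Suc n)
  then obtain a r ys where xs: "xs = (a, r) # ys" by (cases xs) auto
  let ?W = "weight_space (sum_list (map fst xs)) (sum_list (map snd xs)) :: ('i, 'k) fock set"
  have a: "Poly_Mapping.keys a \<subseteq> I" using Suc.prems xs by simp
  have ysI: "\<forall>b\<in>set (map fst ys). Poly_Mapping.keys b \<subseteq> I" using Suc.prems xs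
    by (simp add: subset_lattice)
  show ?case unfolding xs reg_coeff.simps
  proof (rule mul_factors_mem[OF subspace_weight_space])
    fix t' :: int and zs :: "(('i \<Rightarrow>\<^sub>0 int) \<times> int) list"
    assume zs: "map fst zs = map fst ys"
      and t': "t' - sum_list (map snd zs) = (\<Sum>b\<leftarrow>map fst ys. - form a b) - r - 1 - sum_list (map snd ys)"
    have L: "fst ` set zs \<subseteq> lattice_carrier I" using arg_cong[OF zs, of set] Suc.prems xs by simp
    have "n = length zs" using Suc.hyps(2) xs map_eq_imp_length_eq[OF zs] by simp
    from Suc.hyps(1)[OF this L] have "lat.R zs \<in> weight_space (sum_list (map fst ys)) (sum_list (map snd zs))" by (simp only: zs)
    from nprod_weight_space[OF a form_sum_list(1)[OF a ysI] lat.R_carrier[OF L] this, of t']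
    have "nprod V (lattice_vec a) t' (lat.R zs) \<in> weight_space (a + sum_list (map fst ys)) (sum_list (map snd zs) - form a (sum_list (map fst ys)) - 1 - t')" .
    moreover have "(\<Sum>b\<leftarrow>map fst ys. - form a b) = - form a (sum_list (map fst ys))"
      unfolding form_sum_list(2)[OF a ysI] by (rule uminus_sum_list_map[unfolded comp_def, symmetric])
    then have "sum_list (map snd zs) - form a (sum_list (map fst ys)) - 1 - t' = r + sum_list (map snd ys)"
      using t' by linarith
    ultimately show "nprod V (lattice_vec a) t' (lat.R zs) \<in> weight_space (sum_list (map fst ((a, r) # ys))) (sum_list (map snd ((a, r) # ys)))"
      by simp
  qed
qed

lemma mul_factors_zeros: "mul_factors N f t (map (\<lambda>a. (a, 0)) w) = f t (map (\<lambda>a. (a, 0)) w)"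
  by (induction w arbitrary: f) auto

text \<open>
  With all exponents zero only the leading terms \<open>v\<^sub>a\<^sub>(\<^sub>-\<^sub>(\<^sub>a\<^sub>|\<^sub>b\<^sub>)\<^sub>-\<^sub>1\<^sub>)v\<^sub>b = \<plusminus>v\<^sub>a\<^sub>+\<^sub>b\<close> occur.
\<close>
lemma R_zeros:
  assumes "set w \<subseteq> lattice_carrier I"
  shows "\<exists>e\<noteq>0. lat.R (map (\<lambda>a. (a, 0)) w) = fscale e (lattice_vec (sum_list w))"
  using assms
proof (induction w)
  case Nil
  show ?case by (intro exI[of _ 1]) (simp add: vac_V)
next
  case (Cons a w)
  then have a: "Poly_Mapping.keys a \<subseteq> I" and w: "\<forall>b\<in>set w. Poly_Mapping.keys b \<subseteq> I"
    by (simp_all add: subset_lattice)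
  have s: "(\<Sum>b\<leftarrow>w. - form a b) = - form a (sum_list w)"
    unfolding form_sum_list(2)[OF a w] by (rule uminus_sum_list_map[unfolded comp_def, symmetric])
  obtain e where e: "e \<noteq> 0" "lat.R (map (\<lambda>a. (a, 0)) w) = fscale e (lattice_vec (sum_list w))" using Cons by auto
  have "lat.R (map (\<lambda>a. (a, 0)) (a # w)) = nprod V (lattice_vec a) (- form a (sum_list w) - 1) (fscale e (lattice_vec (sum_list w)))"
    by (simp add: mul_factors_zeros e(2) comp_def s)
  also have "\<dots> = fscale e (lprod a (sum_list w) 0)"
    using form_sum_list(1)[OF a w] a by (simp add: lprod_def nprod_scale_right lattice_vec_carrier)
  also have "\<dots> = fscale (e * \<epsilon> a (sum_list w)) (lattice_vec (sum_list (a # w)))"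
    using form_sum_list(1)[OF a w] a by (simp add: lprod_0)
  finally show ?case using e(1) eps_values[of a "sum_list w"] form_sum_list(1)[OF a w] a
    by (intro exI[of _ "e * \<epsilon> a (sum_list w)"]) auto
qed

lemma der_R:
  assumes "fst ` set xs \<subseteq> lattice_carrier I" and n: "n > 0"
  shows "der l n (lat.R xs) = (\<Sum>i<length xs. fscale (ev l (fst (xs ! i))) (lat.R (xs[i := apsnd (\<lambda>s. s - int n) (xs ! i)])))"
  using assms(1)
proof (induction "length xs" arbitrary: xs)
  case 0
  then show ?case using n by (simp add: vac_V der_lattice_vec)
next
  case (Suc m)
  then obtain a r ys where xs: "xs = (a, r) # ys" by (cases xs) auto
  have a: "Poly_Mapping.keys a \<subseteq> I" using Suc.prems xs by simp
  note va = lattice_vec_carrier[OF a]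
  let ?N = "\<lambda>b. - form a b" and ?dec = "apsnd (\<lambda>s. s - int n) :: ('i \<Rightarrow>\<^sub>0 int) \<times> int \<Rightarrow> _"
  define t where "t = (\<Sum>b\<leftarrow>map fst ys. - form a b) - r - 1"
  define f where "f = (\<lambda>t zs. nprod V (lattice_vec a) t (lat.R zs))"
  have L: "fst ` set zs \<subseteq> lattice_carrier I" if "map fst zs = map fst ys" for zs :: "(('i \<Rightarrow>\<^sub>0 int) \<times> int) list"
    using arg_cong[OF that, of set] Suc.prems xs by simp
  have fst_dec: "map fst (zs[i := ?dec (zs ! i)]) = map fst zs" for zs i
    by (cases "i < length zs") (simp_all add: map_update list_update_same_conv list_update_beyond)
  have "der l n (lat.R xs) = mul_factors ?N (\<lambda>t zs. der l n (f t zs)) t ys"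
    unfolding xs reg_coeff.simps f_def t_def
    by (rule mul_factors_linear[where S = UNIV]) (simp_all add: lift_add lift_scale)
  also have "\<dots> = mul_factors ?N (\<lambda>t zs. (\<Sum>i<length ys. fscale (ev l (fst (ys ! i))) (f t (zs[i := ?dec (zs ! i)]))) + fscale (ev l a) (f (t + int n) zs)) t ys"
  proof (rule mul_factors_cong)
    fix t :: int and zs :: "(('i \<Rightarrow>\<^sub>0 int) \<times> int) list"
    assume zs: "map fst zs = map fst ys"
    have len: "length zs = length ys" using map_eq_imp_length_eq[OF zs] .
    have "fst (zs ! i) = fst (ys ! i)" if "i < length ys" for i
      using arg_cong[OF zs, of "\<lambda>xs. xs ! i"] that len by simp
    then have "der l n (lat.R zs) = (\<Sum>i<length ys. fscale (ev l (fst (ys ! i))) (lat.R (zs[i := ?dec (zs ! i)])))"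
      using Suc.hyps(1)[OF _ L[OF zs]] Suc.hyps(2) xs len by simp
    moreover have "nprod V (lattice_vec a) t (\<Sum>i<length ys. fscale (ev l (fst (ys ! i))) (lat.R (zs[i := ?dec (zs ! i)])))
       = (\<Sum>i<length ys. fscale (ev l (fst (ys ! i))) (f t (zs[i := ?dec (zs ! i)])))"
    proof -
      have "lat.R (zs[i := ?dec (zs ! i)]) \<in> va_carrier V" for i
        by (rule lat.R_carrier[OF L]) (simp only: fst_dec zs)
      then show ?thesis unfolding f_def using va
        by (simp add: nprod_sum_right nprod_scale_right carrier_scale)
    qed
    ultimately show "der l n (f t zs) = (\<Sum>i<length ys. fscale (ev l (fst (ys ! i))) (f t (zs[i := ?dec (zs ! i)]))) + fscale (ev l a) (f (t + int n) zs)"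
      using der_nprod[OF a lat.R_carrier[OF L[OF zs]] n, of l t] unfolding f_def by simp
  qed
  also have "\<dots> = (\<Sum>i<length ys. fscale (ev l (fst (ys ! i))) (mul_factors ?N (\<lambda>t zs. f t (zs[i := ?dec (zs ! i)])) t ys))
      + fscale (ev l a) (mul_factors ?N (\<lambda>t. f (t + int n)) t ys)"
    by (simp add: mul_factors_add mul_factors_sum mul_factors_scale)
  also have "mul_factors ?N (\<lambda>t. f (t + int n)) t ys = lat.R ((a, r - int n) # ys)"
  proof -
    have e: "(\<Sum>b\<leftarrow>map fst ys. - form a b) - (r - int n) - 1 = t + int n" by (simp add: t_def)
    show ?thesis unfolding reg_coeff.simps e f_def mul_factors_translate ..
  qed
  also have "(\<Sum>i<length ys. fscale (ev l (fst (ys ! i))) (mul_factors ?N (\<lambda>t zs. f t (zs[i := ?dec (zs ! i)])) t ys))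
      = (\<Sum>i<length ys. fscale (ev l (fst (ys ! i))) (lat.R ((a, r) # ys[i := ?dec (ys ! i)])))"
  proof (intro sum.cong refl arg_cong[where f = "fscale _"])
    fix i assume i: "i \<in> {..<length ys}"
    have "mul_factors ?N (\<lambda>t zs. f t (zs[i := ?dec (zs ! i)])) t ys = mul_factors ?N f t (ys[i := ?dec (ys ! i)])"
    proof (rule mul_factors_decrement)
      fix t' :: int and zs :: "(('i \<Rightarrow>\<^sub>0 int) \<times> int) list"
      assume zs: "map fst zs = map fst ys" and neg: "snd (zs ! i) < 0"
      have "zs ! i \<in> set zs" using i map_eq_imp_length_eq[OF zs] by simp
      then have "lat.R zs = 0" using neg lat.R_neg[OF L[OF zs]] by blast
      then show "f t' zs = 0" using va by (simp add: f_def)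
    qed (use i in auto)
    also have "\<dots> = lat.R ((a, r) # ys[i := ?dec (ys ! i)])"
      unfolding reg_coeff.simps f_def t_def fst_dec ..
    finally show "mul_factors ?N (\<lambda>t zs. f t (zs[i := ?dec (zs ! i)])) t ys = lat.R ((a, r) # ys[i := ?dec (ys ! i)])" .
  qed
  finally show ?case unfolding xs length_Cons sum.lessThan_Suc_shift
    by (simp add: add.commute del: reg_coeff.simps)
qed

end

context lattice_vertex_algebra
begin

text \<open>
  Each derivation lowers the exponent at one position carrying its letter, so it removes at most one
  positive exponent, and it does so only if it matches that exponent exactly. What remains at the end
  has weight zero only if no positive exponent is left. In the matching case the sign depends on
  the word alone, so the contributions of the different positions cannot cancel.
\<close>
lemma dual_coef_R:
  fixes d :: "('i \<Rightarrow>\<^sub>0 int) \<Rightarrow> 'i \<Rightarrow> 'k"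
  assumes B: "B \<subseteq> lattice_carrier I"
    and d: "\<forall>a\<in>B. \<forall>b\<in>B. ev (d a) b = (if b = a then 1 else 0)"
    and "\<forall>q\<in>set Q. fst q \<in> B \<and> snd q > 0" and "fst ` set xs \<subseteq> B"
  shows "length Q \<le> size (pos_part xs) \<Longrightarrow> pos_part xs \<noteq> mset Q \<Longrightarrow> dual_coef d b Q (lat.R xs) = 0"
    and "pos_part xs = mset Q \<Longrightarrow> \<forall>x\<in>set xs. snd x \<ge> 0 \<Longrightarrow> \<exists>m>0. dual_coef d b Q (lat.R xs)
        = Poly_Mapping.lookup (lat.R (map (\<lambda>a. (a, 0)) (map fst xs))) (b, {#}) * of_nat m"
proof -
  have "(length Q \<le> size (pos_part xs) \<longrightarrow> pos_part xs \<noteq> mset Q \<longrightarrow> dual_coef d b Q (lat.R xs) = 0)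
    \<and> (pos_part xs = mset Q \<longrightarrow> (\<forall>x\<in>set xs. snd x \<ge> 0) \<longrightarrow> (\<exists>m>0. dual_coef d b Q (lat.R xs)
        = Poly_Mapping.lookup (lat.R (map (\<lambda>a. (a, 0)) (map fst xs))) (b, {#}) * of_nat m))"
    using assms(3,4)
  proof (induction Q arbitrary: xs)
    case Nil
    have L: "fst ` set xs \<subseteq> lattice_carrier I" using Nil.prems B by blast
    have "dual_coef d b [] (lat.R xs) = 0" if p: "pos_part xs \<noteq> {#}"
    proof (cases "\<exists>x\<in>set xs. snd x < 0")
      case True
      then show ?thesis using lat.R_neg[OF L] by simp
    next
      case False
      then have nonneg: "\<forall>s\<in>set (map snd xs). s \<ge> 0" by auto
      have "\<exists>x\<in>set xs. snd x > 0" using p by (auto simp: pos_part_empty)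
      then obtain x where x: "x \<in> set xs" "snd x > 0" by blast
      have "sum_list (map snd xs) \<noteq> 0"
      proof
        assume "sum_list (map snd xs) = 0"
        then have "\<forall>s\<in>set (map snd xs). s = 0" using sum_list_nonneg_eq_0_iff[of "map snd xs"] nonneg
          by (simp del: set_map)
        with x show False by simp
      qed
      have "(b, {#}) \<notin> Poly_Mapping.keys (lat.R xs)"
      proof
        assume "(b, {#}) \<in> Poly_Mapping.keys (lat.R xs)"
        with R_weight_space[OF L, unfolded weight_space_iff, rule_format, of b "{#}"] \<open>sum_list (map snd xs) \<noteq> 0\<close>
        show False by simp
      qed
      then show ?thesis by (simp add: in_keys_iff)
    qed
    moreover have "\<exists>m>0. dual_coef d b [] (lat.R xs)
        = Poly_Mapping.lookup (lat.R (map (\<lambda>a. (a, 0)) (map fst xs))) (b, {#}) * of_nat m"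
      if p: "pos_part xs = {#}" "\<forall>x\<in>set xs. snd x \<ge> 0"
    proof -
      have "\<forall>x\<in>set xs. \<not> snd x > 0" using p(1) by (simp add: pos_part_empty)
      then have "\<forall>x\<in>set xs. snd x = 0" using p(2) by force
      then have "map (\<lambda>a. (a, 0)) (map fst xs) = xs" by (induction xs) auto
      then show ?thesis by (intro exI[of _ 1]) simp
    qed
    ultimately show ?case by simp
  next
    case (Cons q Q)
    obtain a n where q: "q = (a, n)" by (cases q)
    have a: "a \<in> B" and n: "n > 0" and Q: "\<forall>q\<in>set Q. fst q \<in> B \<and> snd q > 0" using Cons.prems q by auto
    have L: "fst ` set xs \<subseteq> lattice_carrier I" using Cons.prems B by blast
    define ys where "ys i = xs[i := apsnd (\<lambda>s. s - n) (xs ! i)]" for i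
    define summand where "summand i = ev (d a) (fst (xs ! i)) * dual_coef d b Q (lat.R (ys i))" for i
    have sum: "dual_coef d b (q # Q) (lat.R xs) = (\<Sum>i<length xs. summand i)"
      using der_R[OF L, of "nat n" "d a"] n by (simp add: q dual_coef_sum dual_coef_scale summand_def ys_def)
    have fst_ys: "map fst (ys i) = map fst xs" if "i < length xs" for i
      using that by (simp add: ys_def map_update list_update_same_conv)
    have ysB: "fst ` set (ys i) \<subseteq> B" if "i < length xs" for i
      using Cons.prems(2) arg_cong[OF fst_ys[OF that], of set] by simp
    have IH1: "dual_coef d b Q (lat.R (ys i)) = 0" if "i < length xs" "length Q \<le> size (pos_part (ys i))" "pos_part (ys i) \<noteq> mset Q" for i
      using Cons.IH[OF Q ysB[OF that(1)]] that by blast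
    have IH2: "\<exists>m>0. dual_coef d b Q (lat.R (ys i)) = Poly_Mapping.lookup (lat.R (map (\<lambda>a. (a, 0)) (map fst xs))) (b, {#}) * of_nat m"
      if "i < length xs" "pos_part (ys i) = mset Q" "\<forall>x\<in>set (ys i). snd x \<ge> 0" for i
      using Cons.IH[OF Q ysB[OF that(1)]] that(2,3) unfolding fst_ys[OF that(1)] by blast
    have other: "summand i = 0" if i: "i < length xs" and ne: "xs ! i \<noteq> (a, n)" and sz: "length Q < size (pos_part xs)" for i
    proof -
      obtain c s where cs: "xs ! i = (c, s)" by (cases "xs ! i")
      have cB: "c \<in> B" using Cons.prems(2) nth_mem[OF i] cs by force
      show ?thesis
      proof (cases "c = a \<and> s \<ge> n")
        case False
        consider "c \<noteq> a" | "s < n" using False by force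
        then show ?thesis
        proof cases
          case 1
          then show ?thesis using d a cB cs by (simp add: summand_def)
        next
          case 2
          have "(c, s - n) \<in> set (ys i)" unfolding ys_def cs using i by (simp add: set_update_memI)
          then have "lat.R (ys i) = 0" using 2 ysB[OF i] B by (intro lat.R_neg) (auto intro: bexI[of _ "(c, s - n)"])
          then show ?thesis by (simp add: summand_def)
        qed
      next
        case True
        then have s: "s > n" "c = a" using ne cs by auto
        note u = pos_part_update[OF i cs n, unfolded s(2)]
        have "size (pos_part (ys i)) = size (pos_part xs)"
          using u(2) s arg_cong[OF u(1), of size] by (simp add: ys_def cs)
        then have "length Q < size (pos_part (ys i))" using sz by simp
        moreover from this have "pos_part (ys i) \<noteq> mset Q" by (metis less_irrefl size_mset)
        ultimately show ?thesis using IH1[OF i] by (simp add: summand_def)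
      qed
    qed
    have same: "pos_part xs = add_mset (a, n) (pos_part (ys i))" if i: "i < length xs" and e: "xs ! i = (a, n)" for i
      using pos_part_update[OF i e n] by (simp add: ys_def e)
    show ?case
    proof (intro conjI impI)
      assume sz: "length (q # Q) \<le> size (pos_part xs)" and ne: "pos_part xs \<noteq> mset (q # Q)"
      have "summand i = 0" if i: "i < length xs" for i
      proof (cases "xs ! i = (a, n)")
        case True
        have "length Q \<le> size (pos_part (ys i))" "pos_part (ys i) \<noteq> mset Q"
          using same[OF i True] sz ne q by auto
        then show ?thesis using IH1[OF i] by (simp add: summand_def)
      qed (use other i sz in simp)
      then show "dual_coef d b (q # Q) (lat.R xs) = 0" unfolding sum by simp
    next
      assume eq: "pos_part xs = mset (q # Q)" and nonneg: "\<forall>x\<in>set xs. snd x \<ge> 0"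
      let ?c = "Poly_Mapping.lookup (lat.R (map (\<lambda>a. (a, 0)) (map fst xs))) (b, {#})"
      have "\<exists>m. summand i = ?c * of_nat m \<and> (xs ! i = (a, n) \<longrightarrow> m > 0)" if i: "i < length xs" for i
      proof (cases "xs ! i = (a, n)")
        case True
        have p: "pos_part (ys i) = mset Q" using same[OF i True] eq q by simp
        have "\<forall>x\<in>set (ys i). snd x \<ge> 0"
        proof -
          have "set (ys i) \<subseteq> insert (a, 0) (set xs)"
            unfolding ys_def True using set_update_subset_insert[of xs i "(a, 0)"] by simp
          then show ?thesis using nonneg by auto
        qed
        from IH2[OF i p this] obtain m where "m > 0" "dual_coef d b Q (lat.R (ys i)) = ?c * of_nat m" by blast
        then show ?thesis using True d a by (intro exI[of _ m]) (simp add: summand_def)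
      next
        case False
        have "length Q < size (pos_part xs)" using eq by simp
        then show ?thesis using other[OF i False] False by (intro exI[of _ 0]) simp
      qed
      then obtain f where f: "\<And>i. i < length xs \<Longrightarrow> summand i = ?c * of_nat (f i)"
        "\<And>i. i < length xs \<Longrightarrow> xs ! i = (a, n) \<Longrightarrow> f i > 0" by metis
      have "(a, n) \<in># pos_part xs" using eq q by simp
      then have "(a, n) \<in> set xs" by (simp add: pos_part_def)
      then obtain i where i: "i < length xs" "xs ! i = (a, n)" by (meson in_set_conv_nth)
      have "dual_coef d b (q # Q) (lat.R xs) = ?c * of_nat (\<Sum>i<length xs. f i)"
        unfolding sum of_nat_sum sum_distrib_left by (rule sum.cong) (use f(1) in auto)
      moreover have "(\<Sum>i<length xs. f i) > 0"
        using f(2)[OF i] i(1) member_le_sum[of i "{..<length xs}" f] by simp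
      ultimately show "\<exists>m>0. dual_coef d b (q # Q) (lat.R xs) = ?c * of_nat m" by blast
    qed
  qed
  then show "length Q \<le> size (pos_part xs) \<Longrightarrow> pos_part xs \<noteq> mset Q \<Longrightarrow> dual_coef d b Q (lat.R xs) = 0"
    and "pos_part xs = mset Q \<Longrightarrow> \<forall>x\<in>set xs. snd x \<ge> 0 \<Longrightarrow> \<exists>m>0. dual_coef d b Q (lat.R xs)
        = Poly_Mapping.lookup (lat.R (map (\<lambda>a. (a, 0)) (map fst xs))) (b, {#}) * of_nat m" by blast+
qed

text \<open>
  In a nontrivial relation choose a term with the least number of positive exponents and apply the
  functional belonging to it. A term with the same positive part and the same sum of letters has
  the same letters, because \<open>B\<close> is independent, and therefore the same zero exponents.
\<close>
lemma R_linear_independent: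
  fixes c :: "(('i \<Rightarrow>\<^sub>0 int) \<times> int) multiset \<Rightarrow> 'k"
  assumes B: "B \<subseteq> lattice_carrier I" and ind: "frag.independent B"
    and U: "finite U" "\<And>P. P \<in> U \<Longrightarrow> fst ` set_mset P \<subseteq> B \<and> (\<forall>x\<in>#P. snd x \<ge> 0)"
    and rep: "\<And>P. P \<in> U \<Longrightarrow> mset (rep P) = P"
    and zero: "(\<Sum>P\<in>U. fscale (c P) (lat.R (rep P))) = 0"
  shows "\<forall>P\<in>U. c P = 0"
proof (rule ccontr)
  obtain d :: "('i \<Rightarrow>\<^sub>0 int) \<Rightarrow> 'i \<Rightarrow> 'k" where d: "\<forall>a\<in>B. \<forall>b\<in>B. ev (d a) b = (if b = a then 1 else 0)"
    using dual_functionals[OF ind] by blast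
  define U' where "U' = {P \<in> U. c P \<noteq> 0}"
  assume "\<not> (\<forall>P\<in>U. c P = 0)"
  then have "U' \<noteq> {}" "finite U'" using U(1) by (auto simp: U'_def)
  then obtain P0 where P0: "P0 \<in> U'" and min: "\<And>P. P \<in> U' \<Longrightarrow> size (pos_part (rep P0)) \<le> size (pos_part (rep P))"
    using ex_min_if_finite[of "(\<lambda>P. size (pos_part (rep P))) ` U'"] by (auto simp: not_less)
  have U'U: "P \<in> U' \<Longrightarrow> P \<in> U" for P by (simp add: U'_def)
  have letters: "fst ` set (rep P) \<subseteq> B" "\<forall>x\<in>set (rep P). snd x \<ge> 0" if "P \<in> U" for P
    using U(2)[OF that] rep[OF that] by (metis set_mset_mset)+
  define b where "b = sum_list (map fst (rep P0))"
  obtain Q where Q: "mset Q = pos_part (rep P0)" using ex_mset by blast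
  have QB: "\<forall>q\<in>set Q. fst q \<in> B \<and> snd q > 0"
    using letters(1)[OF U'U[OF P0]] unfolding set_mset_mset[symmetric] Q by (auto simp: pos_part_def)
  have zeros: "\<exists>e\<noteq>0. lat.R (map (\<lambda>a. (a, 0)) (map fst (rep P))) = fscale e (lattice_vec (sum_list (map fst (rep P))))"
    if "P \<in> U" for P
    by (rule R_zeros) (use letters(1)[OF that] B in auto)
  have off: "dual_coef d b Q (lat.R (rep P)) = 0" if P: "P \<in> U'" "P \<noteq> P0" for P
  proof (cases "pos_part (rep P) = mset Q")
    case False
    have "length Q \<le> size (pos_part (rep P))" using min[OF P(1)] Q by (metis size_mset)
    then show ?thesis using dual_coef_R(1)[OF B d QB letters(1)[OF U'U[OF P(1)]]] False by blast
  next
    case True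
    have "sum_list (map fst (rep P)) \<noteq> b"
    proof
      assume "sum_list (map fst (rep P)) = b"
      then have "\<Sum>\<^sub># (mset (map fst (rep P))) = \<Sum>\<^sub># (mset (map fst (rep P0)))"
        unfolding b_def sum_mset_sum_list by simp
      then have fsts: "mset (map fst (rep P)) = mset (map fst (rep P0))"
        by (rule sum_mset_inj[OF d, rotated 2]) (use letters(1) U'U P P0 in auto)
      have split: "P = pos_part (rep P) + image_mset (\<lambda>a. (a, 0)) (image_mset fst P - image_mset fst (pos_part (rep P)))"
        if "P \<in> U" for P
      proof -
        have nn: "\<forall>x\<in>#P. snd x \<ge> 0" using U(2)[OF that] by blast
        have 1: "P = pos_part (rep P) + filter_mset (\<lambda>x. \<not> snd x > 0) P"
          unfolding pos_part_def rep[OF that] by (rule multiset_partition)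
        then have "image_mset fst P = image_mset fst (pos_part (rep P)) + image_mset fst (filter_mset (\<lambda>x. \<not> snd x > 0) P)"
          by (metis image_mset_union)
        then have "image_mset (\<lambda>a. (a, 0)) (image_mset fst P - image_mset fst (pos_part (rep P)))
          = image_mset (\<lambda>x. (fst x, 0)) (filter_mset (\<lambda>x. \<not> snd x > 0) P)"
          by (simp add: image_mset.compositionality comp_def)
        also have "\<dots> = image_mset (\<lambda>x. x) (filter_mset (\<lambda>x. \<not> snd x > 0) P)"
          by (rule image_mset_cong) (use nn in \<open>force simp: prod_eq_iff\<close>)
        finally show ?thesis using 1 by simp
      qed
      have "image_mset fst P = image_mset fst P0"
        using fsts rep[OF U'U[OF P(1)]] rep[OF U'U[OF P0]] by simp
      then have "P = P0"
        using split[OF U'U[OF P(1)]] split[OF U'U[OF P0]] True Q by simp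
      with P(2) show False by simp
    qed
    then have "Poly_Mapping.lookup (lat.R (map (\<lambda>a. (a, 0)) (map fst (rep P)))) (b, {#}) = 0"
      using zeros[OF U'U[OF P(1)]] by (auto simp: lookup_fscale lattice_vec_def lookup_single when_def)
    then show ?thesis
      using dual_coef_R(2)[OF B d QB letters(1)[OF U'U[OF P(1)]] True letters(2)[OF U'U[OF P(1)]], of b] by auto
  qed
  have on: "dual_coef d b Q (lat.R (rep P0)) \<noteq> 0"
  proof -
    have "Poly_Mapping.lookup (lat.R (map (\<lambda>a. (a, 0)) (map fst (rep P0)))) (b, {#}) \<noteq> 0"
      using zeros[OF U'U[OF P0]] by (auto simp: b_def lookup_fscale lattice_vec_def)
    then show ?thesis
      using dual_coef_R(2)[OF B d QB letters(1)[OF U'U[OF P0]] Q[symmetric] letters(2)[OF U'U[OF P0]], of b] by auto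
  qed
  have "0 = dual_coef d b Q (\<Sum>P\<in>U. fscale (c P) (lat.R (rep P)))" unfolding zero by simp
  also have "\<dots> = (\<Sum>P\<in>U. c P * dual_coef d b Q (lat.R (rep P)))" by (simp add: dual_coef_sum dual_coef_scale)
  also have "\<dots> = (\<Sum>P\<in>{P0}. c P * dual_coef d b Q (lat.R (rep P)))"
    by (rule sum.mono_neutral_right) (use U(1) U'U[OF P0] off in \<open>auto simp: U'_def\<close>)
  finally show False using on P0 by (simp add: U'_def)
qed

end

lemma hom_reg_coeff:
  assumes F: "vertex_algebra scale\<^sub>F F" and V: "vertex_algebra scale\<^sub>V V" and \<phi>: "\<phi> \<in> va_hom scale\<^sub>F F scale\<^sub>V V"
    and j: "\<And>a. a \<in> L \<Longrightarrow> j a \<in> va_carrier F" "\<And>a. a \<in> L \<Longrightarrow> \<phi> (j a) = X a"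
    and xs: "fst ` set xs \<subseteq> L"
  shows "\<phi> (vertex_algebra.reg_coeff scale\<^sub>F F N j xs) = vertex_algebra.reg_coeff scale\<^sub>V V N X xs
    \<and> vertex_algebra.reg_coeff scale\<^sub>F F N j xs \<in> va_carrier F"
proof -
  interpret F: vertex_algebra scale\<^sub>F F by (rule F)
  interpret V: vertex_algebra scale\<^sub>V V by (rule V)
  have hom: "x \<in> va_carrier F \<Longrightarrow> y \<in> va_carrier F \<Longrightarrow> \<phi> (x + y) = \<phi> x + \<phi> y"
    "x \<in> va_carrier F \<Longrightarrow> \<phi> (scale\<^sub>F r x) = scale\<^sub>V r (\<phi> x)" "\<phi> (vac F) = vac V"
    "x \<in> va_carrier F \<Longrightarrow> y \<in> va_carrier F \<Longrightarrow> \<phi> (nprod F x n y) = nprod V (\<phi> x) n (\<phi> y)" for x y r n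
    using \<phi> by (auto simp: va_hom_def)
  show ?thesis using xs
  proof (induction "length xs" arbitrary: xs)
    case 0
    then show ?case by (simp add: hom)
  next
    case (Suc m)
    then obtain a r ys where xs: "xs = (a, r) # ys" by (cases xs) auto
    have a: "a \<in> L" using Suc.prems xs by simp
    have IH: "\<phi> (F.reg_coeff N j zs) = V.reg_coeff N X zs \<and> F.reg_coeff N j zs \<in> va_carrier F" if "map fst zs = map fst ys" for zs
      by (rule Suc.hyps(1)) (use Suc.hyps(2) Suc.prems xs map_eq_imp_length_eq[OF that] arg_cong[OF that, of set] in simp_all)
    have c: "nprod F (j a) t (F.reg_coeff N j zs) \<in> va_carrier F" if "map fst zs = map fst ys" for t zs
      using IH[OF that] j(1)[OF a] by (simp add: F.nprod_carrier)
    have "F.reg_coeff N j xs \<in> va_carrier F"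
      unfolding xs F.reg_coeff.simps by (rule F.mul_factors_mem[OF F.subspace_carrier]) (rule c)
    moreover have "\<phi> (F.reg_coeff N j xs) = V.mul_factors (N a) (\<lambda>t zs. \<phi> (nprod F (j a) t (F.reg_coeff N j zs))) ((\<Sum>b\<leftarrow>map fst ys. N a b) - r - 1) ys"
      unfolding xs F.reg_coeff.simps by (rule mul_factors_hom[OF F V hom(1,2) F.subspace_carrier c])
    moreover have "\<dots> = V.reg_coeff N X xs"
      unfolding xs V.reg_coeff.simps by (rule V.mul_factors_cong) (use IH hom(4) j a in auto)
    ultimately show ?case by simp
  qed
qed

theorem mainTheorem3:
  fixes I :: "'i set"
    and form :: "('i \<Rightarrow>\<^sub>0 int) \<Rightarrow> ('i \<Rightarrow>\<^sub>0 int) \<Rightarrow> int"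
    and \<epsilon> :: "('i \<Rightarrow>\<^sub>0 int) \<Rightarrow> ('i \<Rightarrow>\<^sub>0 int) \<Rightarrow> 'k::field_char_0"
    and V :: "('i, 'k) fock va"
    and B :: "('i \<Rightarrow>\<^sub>0 int) set"
    and scale\<^sub>F :: "'k \<Rightarrow> 'f::ab_group_add \<Rightarrow> 'f"
    and F :: "'f va"
    and j :: "('i \<Rightarrow>\<^sub>0 int) \<Rightarrow> 'f"
  assumes "lattice_vertex_algebra I form \<epsilon> V"
    and "B \<subseteq> lattice_carrier I"
    and "frag.independent B"
    and "free_vertex_algebra
           (fscale :: 'k \<Rightarrow> ('i, 'k) fock \<Rightarrow> ('i, 'k) fock) scale\<^sub>F F B (\<lambda>a b. - form a b) j"
  shows "(\<exists>!\<phi>. \<phi> \<in> va_hom scale\<^sub>F F fscale V \<and> (\<forall>a\<in>B. \<phi> (j a) = lattice_vec a))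
       \<and> (\<forall>\<phi>. \<phi> \<in> va_hom scale\<^sub>F F fscale V \<and> (\<forall>a\<in>B. \<phi> (j a) = lattice_vec a)
              \<longrightarrow> inj_on \<phi> (va_carrier F))"
proof (intro conjI allI impI)
  interpret V: lattice_vertex_algebra I form \<epsilon> V by fact
  have V: "vertex_algebra fscale V" ..
  from assms(4) have F: "vertex_algebra scale\<^sub>F F" and adm: "va_admissible F B (\<lambda>a b. - form a b) j"
    and gen: "va_generated scale\<^sub>F F (j ` B) = va_carrier F"
    and univ: "\<And>A i. vertex_algebra (fscale :: 'k \<Rightarrow> ('i, 'k) fock \<Rightarrow> _) A \<Longrightarrow> va_admissible A B (\<lambda>a b. - form a b) i \<Longrightarrow>
        \<exists>!\<phi>. \<phi> \<in> va_hom scale\<^sub>F F fscale A \<and> (\<forall>b\<in>B. \<phi> (j b) = i b)"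
    unfolding free_vertex_algebra_def by blast+
  have "va_admissible V B (\<lambda>a b. - form a b) lattice_vec"
    using V.lat.admissible assms(2) unfolding va_admissible_def by blast
  then show "\<exists>!\<phi>. \<phi> \<in> va_hom scale\<^sub>F F fscale V \<and> (\<forall>a\<in>B. \<phi> (j a) = lattice_vec a)"
    using univ[OF V] by blast
  interpret F: local_family scale\<^sub>F F B "\<lambda>a b. - form a b" j
  proof (rule local_family.intro[OF F], unfold_locales)
    show "- form a b = - form b a" if "a \<in> B" "b \<in> B" for a b
    proof -
      have "a \<in> lattice_carrier I" "b \<in> lattice_carrier I" using assms(2) that by blast+
      then show ?thesis by (simp only: V.form_sym)
    qed
  qed (rule adm)
  fix \<phi> assume "\<phi> \<in> va_hom scale\<^sub>F F fscale V \<and> (\<forall>a\<in>B. \<phi> (j a) = lattice_vec a)"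
  then have \<phi>: "\<phi> \<in> va_hom scale\<^sub>F F fscale V" and \<phi>j: "\<And>a. a \<in> B \<Longrightarrow> \<phi> (j a) = lattice_vec a" by auto
  have add: "\<phi> (x + y) = \<phi> x + \<phi> y" if "x \<in> va_carrier F" "y \<in> va_carrier F" for x y
    using \<phi> that by (simp add: va_hom_def)
  have sc: "\<phi> (scale\<^sub>F r x) = fscale r (\<phi> x)" if "x \<in> va_carrier F" for x r
    using \<phi> that by (simp add: va_hom_def)
  have R: "\<phi> (F.R xs) = V.lat.R xs" if "fst ` set xs \<subseteq> B" for xs
    using hom_reg_coeff[OF F V \<phi> F.X_carrier \<phi>j that] by simp
  define rep where "rep P = (SOME xs. mset xs = P)" for P :: "(('i \<Rightarrow>\<^sub>0 int) \<times> int) multiset"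
  have rep: "mset (rep P) = P" for P unfolding rep_def using ex_mset[of P] by (rule someI_ex)
  define PP where "PP = {P :: (('i \<Rightarrow>\<^sub>0 int) \<times> int) multiset. fst ` set_mset P \<subseteq> B \<and> (\<forall>x\<in>#P. snd x \<ge> 0)}"
  have letters: "fst ` set (rep P) \<subseteq> B" if "P \<in> PP" for P
    using that rep[of P] by (metis (mono_tags, lifting) PP_def mem_Collect_eq set_mset_mset)
  have span: "va_carrier F \<subseteq> F.span ((\<lambda>P. F.R (rep P)) ` PP)"
  proof -
    have "F.span {F.R xs | xs. fst ` set xs \<subseteq> B \<and> (\<forall>x\<in>set xs. snd x \<ge> 0)} \<subseteq> F.span ((\<lambda>P. F.R (rep P)) ` PP)"
    proof (rule F.span_minimal)
      show "{F.R xs | xs. fst ` set xs \<subseteq> B \<and> (\<forall>x\<in>set xs. snd x \<ge> 0)} \<subseteq> F.span ((\<lambda>P. F.R (rep P)) ` PP)"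
      proof
        fix x assume "x \<in> {F.R xs | xs. fst ` set xs \<subseteq> B \<and> (\<forall>x\<in>set xs. snd x \<ge> 0)}"
        then obtain xs where xs: "x = F.R xs" "fst ` set xs \<subseteq> B" "\<forall>x\<in>set xs. snd x \<ge> 0" by blast
        obtain e where "x = scale\<^sub>F e (F.R (rep (mset xs)))"
          using F.R_perm[OF rep[symmetric] xs(2)] xs(1) by blast
        moreover have "mset xs \<in> PP" using xs by (simp add: PP_def)
        ultimately show "x \<in> F.span ((\<lambda>P. F.R (rep P)) ` PP)"
          by (auto intro: F.span_scale F.span_base)
      qed
    qed simp
    then show ?thesis using F.generated_subset_span_R gen by blast
  qed
  have ker: "x = 0" if x: "x \<in> va_carrier F" and z: "\<phi> x = 0" for x
  proof -
    from x span obtain t r where t: "finite t" "t \<subseteq> (\<lambda>P. F.R (rep P)) ` PP" and xt: "x = (\<Sum>a\<in>t. scale\<^sub>F (r a) a)"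
      unfolding F.span_explicit by blast
    from t(2) obtain U where U: "U \<subseteq> PP" "inj_on (\<lambda>P. F.R (rep P)) U" "t = (\<lambda>P. F.R (rep P)) ` U"
      unfolding subset_image_inj by blast
    have fU: "finite U" using t(1) U(2,3) finite_imageD by blast
    define c where "c P = r (F.R (rep P))" for P
    have xU: "x = (\<Sum>P\<in>U. scale\<^sub>F (c P) (F.R (rep P)))"
      unfolding xt U(3) c_def using U(2) by (simp add: sum.reindex)
    have Rc: "F.R (rep P) \<in> va_carrier F" if "P \<in> U" for P
      using letters U(1) that by (intro F.R_carrier) blast
    have \<phi>0: "\<phi> 0 = 0" using sc[of 0 0] by simp
    have "\<phi> (\<Sum>P\<in>U. scale\<^sub>F (c P) (F.R (rep P))) = (\<Sum>P\<in>U. fscale (c P) (\<phi> (F.R (rep P))))"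
      using fU Rc by (induction U) (simp_all add: \<phi>0 add sc F.carrier_sum F.carrier_scale)
    moreover have "\<phi> (F.R (rep P)) = V.lat.R (rep P)" if "P \<in> U" for P
      using R[OF letters] U(1) that by blast
    ultimately have "(\<Sum>P\<in>U. fscale (c P) (V.lat.R (rep P))) = 0"
      using z xU by simp
    then have "\<forall>P\<in>U. c P = 0"
      by (intro V.R_linear_independent[OF assms(2,3) fU _ rep]) (use U(1) in \<open>auto simp: PP_def\<close>)
    then show "x = 0" unfolding xU by simp
  qed
  show "inj_on \<phi> (va_carrier F)"
  proof (rule inj_onI)
    fix x y assume xy: "x \<in> va_carrier F" "y \<in> va_carrier F" "\<phi> x = \<phi> y"
    have "\<phi> x = \<phi> (x - y) + \<phi> y" using add[OF F.carrier_diff[OF xy(1,2)] xy(2)] by simp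
    then have "\<phi> (x - y) = 0" using xy(3) by simp
    then show "x = y" using ker[OF F.carrier_diff[OF xy(1,2)]] by simp
  qed
qed

end
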